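(* Let $D\subset\mathbb R^n$, $n\ge 2$, be a domain, let $p,q\ge 1$, and let $f:D\to\mathbb R^n$ be a mapping with finite length $(p,q)$-distortion. Then $$M_q(f(\Gamma))\le \int_D K_{I,q}(x,f)\,\rho^q(x)\,dm(x)$$ for every family of curves $\Gamma$ in $D$ and every $\rho\in\operatorname{adm}\Gamma$; and $$M_p(\Gamma)\le \int_{f(E)} K_{I,p}(y,f^{-1},E)\,\rho_*^p(y)\,dm(y)$$ for every measurable set $E\subset D$, every family $\Gamma$ of curves in $E$ and every $\rho_*\in\operatorname{adm} f(\Gamma)$, where $K_{I,p}(y,f^{-1},E):=\sum_{x\in E\cap f^{-1}(y)}K_{O,p}(x,f)$.
   Context: $m$ denotes Lebesgue measure on $\mathbb R^n$. All mappings $f:D\to\mathbb R^n$ are continuous and orientation preserving (the topological degree $\mu(y,f,G)>0$ for every domain $G$ with $\overline G\subset D$ and $y\in f(G)\setminus f(\partial G)$). A curve is a continuous map $\gamma:\Delta\to\mathbb R^n$, $\Delta\subset\mathbb R$ an interval; $f(\Gamma)=\{f\circ\gamma:\gamma\in\Gamma\}$. For a curve family $\Gamma$, a Borel $\rho:\mathbb R^n\to[0,\infty]$ is admissible, $\rho\in\operatorname{adm}\Gamma$, if $\int_\gamma\rho\,|dx|\ge1$ for every locally rectifiable $\gamma\in\Gamma$; the $p$-modulus is $M_p(\Gamma)=\inf_{\rho\in\operatorname{adm}\Gamma}\int_{\mathbb R^n}\rho^p\,dm$ ($=+\infty$ if $\operatorname{adm}\Gamma=\varnothing$). A property holds for $p$-a.e.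 curve of a family if the subfamily where it fails has $p$-modulus zero. $f$ has the $N$-property if $m(f(S))=0$ whenever $m(S)=0$, and the $N^{-1}$-property if $m(f^{-1}(S))=0$ whenever $m(S)=0$. For a locally rectifiable $\gamma:\Delta\to\mathbb R^n$, $l_\gamma:\Delta\to\Delta_\gamma$ is the (signed) length function normalized at some $t_0\in\Delta$ ($l_\gamma(t)=\pm$ length of $\gamma$ between $t_0$ and $t$). If $\tilde\gamma=f\circ\gamma$ is also locally rectifiable, $L_{\gamma,f}:\Delta_\gamma\to\Delta_{\tilde\gamma}$ is the unique nondecreasing function with $L_{\gamma,f}(l_\gamma(t))=l_{\tilde\gamma}(t)$ for all $t\in\Delta$. A curve $\gamma$ in $D$ is a lifting of $\tilde\gamma$ if $\tilde\gamma=f\circ\gamma$. $f$ has property $L^{(1)}_p$ if for $p$-a.e. curve $\gamma$ in $D$, $f\circ\gamma$ is locally rectifiable and $L_{\gamma,f}$ has the $N$-property (maps null sets to null sets); $f$ has property $L^{(2)}_q$ if for $q$-a.e. curve $\tilde\gamma$ in $f(D)$ every lifting $\gamma$ of $\tilde\gamma$ is locally rectifiable and $L_{\gamma,f}$ has the $N^{-1}$-property. $f$ has finite length $(p,q)$-distortion if $f$ is differentiable a.e. in $D$, has the $N$- and $N^{-1}$-properties, and has properties $L^{(1)}_p$ and $L^{(2)}_q$. At points of differentiability: $l(f'(x))=\min_{|h|=1}|f'(x)h|$, $\|f'(x)\|=\max_{|h|=1}|f'(x)h|$, $J(x,f)=\det f'(x)$. For $p,q\ge1$: $K_{I,q}(x,f)=|J(x,f)|/l(f'(x))^q$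 if $J(x,f)\ne0$, $=1$ if $f'(x)=0$, $=\infty$ otherwise; $K_{O,p}(x,f)=\|f'(x)\|^p/|J(x,f)|$ if $J(x,f)\ne0$, $=1$ if $f'(x)=0$, $=\infty$ otherwise. *)

theory Defs
  imports "HOL-Analysis.Analysis"
begin

type_synonym 'a curve = "real set \<times> (real \<Rightarrow> 'a)"

definition is_curve :: "'a::metric_space curve \<Rightarrow> bool" where
  "is_curve c \<longleftrightarrow> is_interval (fst c) \<and> fst c \<noteq> {} \<and> continuous_on (fst c) (snd c)"

definition curve_in :: "'a::metric_space set \<Rightarrow> 'a curve \<Rightarrow> bool" where
  "curve_in A c \<longleftrightarrow> is_curve c \<and> snd c ` fst c \<subseteq> A"

definition curve_length :: "(real \<Rightarrow> 'a::metric_space) \<Rightarrow> real \<Rightarrow> real \<Rightarrow> ennreal" where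
  "curve_length \<gamma> a b =
     (SUP xs \<in> {xs. sorted xs \<and> set xs \<subseteq> {a..b}}.
        \<Sum>i<length xs - 1. ennreal (dist (\<gamma> (xs ! i)) (\<gamma> (xs ! Suc i))))"

definition loc_rectifiable :: "'a::metric_space curve \<Rightarrow> bool" where
  "loc_rectifiable c \<longleftrightarrow>
     (\<forall>a\<in>fst c. \<forall>b\<in>fst c. a \<le> b \<longrightarrow> curve_length (snd c) a b < \<infinity>)"

definition base_point :: "'a curve \<Rightarrow> real" where
  "base_point c = (SOME t. t \<in> fst c)"

definition length_fun :: "'a::metric_space curve \<Rightarrow> real \<Rightarrow> real" where
  "length_fun c t =
     (if base_point c \<le> t then enn2real (curve_length (snd c) (base_point c) t)
      else - enn2real (curve_length (snd c) t (base_point c)))"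

definition arclength_param :: "'a::metric_space curve \<Rightarrow> real \<Rightarrow> 'a" where
  "arclength_param c s = snd c (SOME t. t \<in> fst c \<and> length_fun c t = s)"

definition line_integral :: "('a::metric_space \<Rightarrow> ennreal) \<Rightarrow> 'a curve \<Rightarrow> ennreal" where
  "line_integral \<rho> c =
     (\<integral>\<^sup>+ s. indicator (length_fun c ` fst c) s * \<rho> (arclength_param c s) \<partial>lborel)"

definition enn_powr :: "ennreal \<Rightarrow> real \<Rightarrow> ennreal" where
  "enn_powr x p = (if x = \<infinity> then \<infinity> else ennreal (enn2real x powr p))"

definition adm :: "('a::euclidean_space) curve set \<Rightarrow> ('a \<Rightarrow> ennreal) set" where
  "adm \<Gamma> = {\<rho>. \<rho> \<in> borel_measurable borel \<and>
      (\<forall>c\<in>\<Gamma>. loc_rectifiable c \<longrightarrow> line_integral \<rho> c \<ge> 1)}"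

definition modulus :: "real \<Rightarrow> ('a::euclidean_space) curve set \<Rightarrow> ennreal" where
  "modulus p \<Gamma> = (INF \<rho> \<in> adm \<Gamma>. \<integral>\<^sup>+ x. enn_powr (\<rho> x) p \<partial>lebesgue)"

definition curve_image :: "('a \<Rightarrow> 'b) \<Rightarrow> 'a curve set \<Rightarrow> 'b curve set" where
  "curve_image f \<Gamma> = (\<lambda>c. (fst c, f \<circ> snd c)) ` \<Gamma>"

definition ae_curves :: "real \<Rightarrow> ('a::euclidean_space) curve set \<Rightarrow> ('a curve \<Rightarrow> bool) \<Rightarrow> bool" where
  "ae_curves p F P \<longleftrightarrow> modulus p {c \<in> F. \<not> P c} = 0"

definition L_fun :: "('a::metric_space \<Rightarrow> 'b::metric_space) \<Rightarrow> 'a curve \<Rightarrow> real \<Rightarrow> real" where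
  "L_fun f c s = length_fun (fst c, f \<circ> snd c) (SOME t. t \<in> fst c \<and> length_fun c t = s)"

definition L_N_prop :: "('a::metric_space \<Rightarrow> 'b::metric_space) \<Rightarrow> 'a curve \<Rightarrow> bool" where
  "L_N_prop f c \<longleftrightarrow> (\<forall>S \<subseteq> length_fun c ` fst c.
      S \<in> null_sets lebesgue \<longrightarrow> L_fun f c ` S \<in> null_sets lebesgue)"

definition L_Ninv_prop :: "('a::metric_space \<Rightarrow> 'b::metric_space) \<Rightarrow> 'a curve \<Rightarrow> bool" where
  "L_Ninv_prop f c \<longleftrightarrow> (\<forall>S. S \<in> null_sets lebesgue \<longrightarrow>
      {s \<in> length_fun c ` fst c. L_fun f c s \<in> S} \<in> null_sets lebesgue)"

definition N_prop :: "('a::euclidean_space \<Rightarrow> 'a) \<Rightarrow> 'a set \<Rightarrow> bool" where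
  "N_prop f D \<longleftrightarrow> (\<forall>S \<subseteq> D. S \<in> null_sets lebesgue \<longrightarrow> f ` S \<in> null_sets lebesgue)"

definition Ninv_prop :: "('a::euclidean_space \<Rightarrow> 'a) \<Rightarrow> 'a set \<Rightarrow> bool" where
  "Ninv_prop f D \<longleftrightarrow> (\<forall>S. S \<in> null_sets lebesgue \<longrightarrow> D \<inter> f -` S \<in> null_sets lebesgue)"

definition prop_L1 :: "real \<Rightarrow> ('a::euclidean_space \<Rightarrow> 'a) \<Rightarrow> 'a set \<Rightarrow> bool" where
  "prop_L1 p f D \<longleftrightarrow> ae_curves p {c. curve_in D c}
     (\<lambda>c. loc_rectifiable c \<longrightarrow> loc_rectifiable (fst c, f \<circ> snd c) \<and> L_N_prop f c)"

definition is_lifting :: "('a::euclidean_space \<Rightarrow> 'a) \<Rightarrow> 'a set \<Rightarrow> 'a curve \<Rightarrow> 'a curve \<Rightarrow> bool" where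
  "is_lifting f D c ct \<longleftrightarrow> curve_in D c \<and> fst c = fst ct \<and> (\<forall>t\<in>fst c. f (snd c t) = snd ct t)"

definition prop_L2 :: "real \<Rightarrow> ('a::euclidean_space \<Rightarrow> 'a) \<Rightarrow> 'a set \<Rightarrow> bool" where
  "prop_L2 q f D \<longleftrightarrow> ae_curves q {ct. curve_in (f ` D) ct}
     (\<lambda>ct. loc_rectifiable ct \<longrightarrow>
        (\<forall>c. is_lifting f D c ct \<longrightarrow> loc_rectifiable c \<and> L_Ninv_prop f c))"

definition finite_length_distortion ::
    "real \<Rightarrow> real \<Rightarrow> ('a::euclidean_space \<Rightarrow> 'a) \<Rightarrow> 'a set \<Rightarrow> bool" where
  "finite_length_distortion p q f D \<longleftrightarrow>
     (AE x in lebesgue. x \<in> D \<longrightarrow> f differentiable (at x)) \<and>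
     N_prop f D \<and> Ninv_prop f D \<and> prop_L1 p f D \<and> prop_L2 q f D"

text \<open>Degree via smooth approximation (Nagumo/Heinz): for bounded G, f continuous on closure G and
  y not in f(frontier G), deg(y,f,G) is the integer d such that for some eps > 0 every C^1 map g with
  sup-distance < eps from f on closure G, having y as a regular value in G, satisfies
  d = sum over g^{-1}(y) in G of sign det g'(x).\<close>

definition is_C1 :: "(real^'n \<Rightarrow> real^'n) \<Rightarrow> bool" where
  "is_C1 g \<longleftrightarrow> (\<forall>x. g differentiable (at x)) \<and>
     continuous_on UNIV (\<lambda>x. matrix (frechet_derivative g (at x)))"

definition jacobian :: "(real^'n \<Rightarrow> real^'n) \<Rightarrow> real^'n \<Rightarrow> real" where
  "jacobian f x = det (matrix (frechet_derivative f (at x)))"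

definition top_degree :: "(real^'n \<Rightarrow> real^'n) \<Rightarrow> (real^'n) set \<Rightarrow> real^'n \<Rightarrow> int" where
  "top_degree f G y = (THE d. \<exists>\<epsilon>>0. \<forall>g. is_C1 g \<and> (\<forall>x\<in>closure G. norm (g x - f x) < \<epsilon>) \<and>
        (\<forall>x\<in>G. g x = y \<longrightarrow> jacobian g x \<noteq> 0) \<longrightarrow>
        of_int d = (\<Sum>x\<in>{x\<in>G. g x = y}. sgn (jacobian g x)))"

definition orientation_preserving :: "(real^'n \<Rightarrow> real^'n) \<Rightarrow> (real^'n) set \<Rightarrow> bool" where
  "orientation_preserving f D \<longleftrightarrow>
     (\<forall>G. open G \<and> connected G \<and> bounded G \<and> closure G \<subseteq> D \<longrightarrow>
        (\<forall>y \<in> f ` G - f ` frontier G. top_degree f G y > 0))"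

definition min_stretch :: "(real^'n \<Rightarrow> real^'n) \<Rightarrow> real" where
  "min_stretch L = Inf {norm (L h) | h. norm h = 1}"

definition K_I :: "real \<Rightarrow> (real^'n \<Rightarrow> real^'n) \<Rightarrow> real^'n \<Rightarrow> ennreal" where
  "K_I q f x = (if jacobian f x \<noteq> 0
      then ennreal (\<bar>jacobian f x\<bar> / min_stretch (frechet_derivative f (at x)) powr q)
      else if frechet_derivative f (at x) = (\<lambda>h. 0) then 1 else \<infinity>)"

definition K_O :: "real \<Rightarrow> (real^'n \<Rightarrow> real^'n) \<Rightarrow> real^'n \<Rightarrow> ennreal" where
  "K_O p f x = (if jacobian f x \<noteq> 0
      then ennreal (onorm (frechet_derivative f (at x)) powr p / \<bar>jacobian f x\<bar>)
      else if frechet_derivative f (at x) = (\<lambda>h. 0) then 1 else \<infinity>)"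

definition K_I_inv :: "real \<Rightarrow> (real^'n \<Rightarrow> real^'n) \<Rightarrow> (real^'n) set \<Rightarrow> real^'n \<Rightarrow> ennreal" where
  "K_I_inv p f E y = (\<Sum>\<^sub>\<infinity>x \<in> E \<inter> f -` {y}. K_O p f x)"

end

theory Submission
  imports Defs
begin

text \<open>
  Part (1). Off a null set \<open>f\<close> is differentiable with nonzero Jacobian: the image of the critical set
  is null by Sard, hence so is the critical set by the \<open>N\<inverse>\<close>-property. The good set splits into
  countably many Borel pieces on which \<open>f\<close> is injective. Let \<open>\<rho>'\<close> be the \<open>l\<^sup>q\<close>-sum over the pieces of
  \<open>(\<rho> / l(f')) \<circ> f\<inverse>\<close>, made infinite on the null image of the bad set. The area formula bounds
  \<open>\<integral> \<rho>'\<^sup>q\<close> by the right-hand side. For almost every lifting, both curves being parametrized by arc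
  length, \<open>L\<inverse>\<close> maps null sets to null sets and has upper derivative at most \<open>1 / l(f')\<close>, which gives
  \<open>\<integral>\<^sub>\<gamma> \<rho> \<le> \<integral>\<^bsub>f \<circ> \<gamma>\<^esub> \<rho>'\<close>. Part (2) is the same argument for \<open>L\<close> itself with \<open>\<rho> = \<rho>\<^sub>* \<circ> f \<cdot> \<parallel>f'\<parallel>\<close>.

  No differentiability of \<open>L\<close> is needed. By a Vitali covering argument a map of an interval with the
  \<open>N\<close>-property and pointwise upper derivative at most \<open>\<sigma>\<close> satisfies \<open>m(\<phi>(A)) \<le> \<integral>\<^sub>A \<sigma>\<close>; and a curve
  parametrized by arc length has metric derivative 1 almost everywhere, so increments of arc length may
  be replaced by chords.
\<close>

section \<open>The area formula for an arbitrary finite index type\<close>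

text \<open>Differentiability of \<open>f\<close> controls chords only, and only at points of the
  space, while \<open>adm\<close> speaks of arc length; the assumed properties of \<open>L\<close>
  turn such pointwise bounds into inequalities between line integrals. The minimal stretch bounds
  distances in the domain by distances in the image, so the first inequality has to run from the
  image curve back to the lifting, along the inverse of \<open>L\<close>; the second runs along
  \<open>L\<close>. The sum of \<open>q\<close>-th powers is chosen because the \<open>q\<close>-th
  power of \<rho>' is then a plain series over the pieces, which integrates term by term, while
  \<rho>' still dominates each single term. The value infinity on a null set costs nothing in the
  integral and settles every curve that spends positive length there; every other curve meets the
  bad set in length zero, which is what the comparison of line integrals assumes. Two constraints
  shape the statements: images of sets on the line are estimated by outer measure, and admissible
  functions must be Borel on the whole space, so Lebesgue measurable candidates are replaced by
  Borel majorants.\<close>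

text \<open>The library states Sard's theorem and the change of variables formula for well-ordered index types
  only; they are transported to \<open>'n\<close> along a bijection with the following copy of \<open>{..<CARD('n)}\<close>.\<close>

typedef ('n::finite) ordered_index = "{..<CARD('n)}"
  by (auto intro!: exI[of _ 0])

setup_lifting type_definition_ordered_index

instantiation ordered_index :: (finite) linorder
begin
lift_definition less_eq_ordered_index :: "'a ordered_index \<Rightarrow> 'a ordered_index \<Rightarrow> bool" is "(\<le>)" .
lift_definition less_ordered_index :: "'a ordered_index \<Rightarrow> 'a ordered_index \<Rightarrow> bool" is "(<)" .
instance by standard (transfer; auto)+
end

lemma card_ordered_index: "CARD('n::finite ordered_index) = CARD('n)"
  using type_definition.card[OF type_definition_ordered_index] by simp

instance ordered_index :: (finite) finite
proof
  show "finite (UNIV :: 'a ordered_index set)"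
    by (rule card_ge_0_finite) (simp add: card_ordered_index)
qed

instance ordered_index :: (finite) wellorder
proof
  fix P :: "'a ordered_index \<Rightarrow> bool" and a :: "'a ordered_index"
  assume *: "\<And>x. (\<And>y. y < x \<Longrightarrow> P y) \<Longrightarrow> P x"
  show "P a"
  proof (induction "Rep_ordered_index a" arbitrary: a rule: less_induct)
    case less
    show ?case
      by (rule *) (auto intro!: less simp: less_ordered_index.rep_eq)
  qed
qed

text \<open>Coordinates are pulled back, so the map runs against \<open>\<pi>\<close>; for bijective
  \<open>\<pi>\<close> it merely permutes coordinates.\<close>

definition reindex :: "('m \<Rightarrow> 'n) \<Rightarrow> real^'n \<Rightarrow> real^'m" where
  "reindex \<pi> x = (\<chi> i. x $ \<pi> i)"

lemma reindex_nth [simp]: "reindex \<pi> x $ i = x $ \<pi> i"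
  by (simp add: reindex_def)

lemma reindex_inverse [simp]:
  assumes "bij \<pi>"
  shows "reindex (inv \<pi>) (reindex \<pi> x) = x" "reindex \<pi> (reindex (inv \<pi>) y) = y"
  using assms by (simp_all add: vec_eq_iff bij_is_surj surj_f_inv_f bij_is_inj)

lemma linear_reindex: "linear (reindex \<pi>)"
  by (rule linearI) (simp_all add: vec_eq_iff)

lemma bounded_linear_reindex: "bounded_linear (reindex \<pi> :: real^'n \<Rightarrow> real^'m)"
  using linear_reindex linear_conv_bounded_linear by blast

lemma prod_Basis_cart: "(\<Prod>b\<in>Basis. x \<bullet> b) = (\<Prod>i\<in>UNIV. (x::real^'n) $ i)"
proof -
  have "(Basis :: (real^'n) set) = (\<lambda>i. axis i 1) ` UNIV"
    by (auto simp: Basis_vec_def)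
  moreover have "inj (\<lambda>i::'n. axis i (1::real))"
    by (auto simp: inj_on_def axis_eq_axis)
  ultimately show ?thesis
    using prod.reindex[of "\<lambda>i::'n. axis i (1::real)" UNIV "\<lambda>b. x \<bullet> b"] by (simp add: inner_axis)
qed

text \<open>Preimages of boxes are boxes with permuted sides and equal volume, and
  \<open>lborel\<close> is determined by its values on boxes.\<close>

lemma distr_lborel_reindex:
  fixes \<pi> :: "'m::finite \<Rightarrow> 'n::finite"
  assumes "bij \<pi>"
  shows "distr lborel borel (reindex \<pi>) = lborel"
proof (rule lborel_eqI[symmetric])
  have [measurable]: "reindex \<pi> \<in> borel_measurable borel"
    by (intro borel_measurable_continuous_onI linear_continuous_on bounded_linear_reindex)
  fix l u :: "real^'m"
  assume lu: "\<And>b. b \<in> Basis \<Longrightarrow> l \<bullet> b \<le> u \<bullet> b"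
  let ?l = "reindex (inv \<pi>) l" and ?u = "reindex (inv \<pi>) u"
  have le: "l $ i \<le> u $ i" for i
    using lu[of "axis i 1"] by (simp add: inner_axis axis_in_Basis_iff)
  have "reindex \<pi> -` box l u = box ?l ?u"
    using assms unfolding box_def
    by (auto simp: mem_box_cart Basis_vec_def inner_axis)
       (metis bij_inv_eq_iff)+
  then have "emeasure (distr lborel borel (reindex \<pi>)) (box l u) = emeasure lborel (box ?l ?u)"
    by (simp add: emeasure_distr)
  also have "\<dots> = ennreal (\<Prod>b\<in>Basis. (?u - ?l) \<bullet> b)"
    by (rule emeasure_lborel_box) (auto simp: Basis_vec_def inner_axis le)

  also have "(\<Prod>b\<in>Basis. (?u - ?l) \<bullet> b) = (\<Prod>b\<in>Basis. (u - l) \<bullet> b)"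
    unfolding prod_Basis_cart
    using prod.reindex_bij_betw[of "inv \<pi>" UNIV UNIV "\<lambda>i. (u - l) $ i"]
    by (simp add: assms bij_imp_bij_inv)
  finally show "emeasure (distr lborel borel (reindex \<pi>)) (box l u) = ennreal (\<Prod>b\<in>Basis. (u - l) \<bullet> b)" .
qed simp

lemma
  fixes \<pi> :: "'m::finite \<Rightarrow> 'n::finite"
  assumes "bij \<pi>"
  shows reindex_measurable: "reindex \<pi> \<in> lebesgue \<rightarrow>\<^sub>M lebesgue"
    and distr_lebesgue_reindex: "distr lebesgue lebesgue (reindex \<pi>) = lebesgue"
proof -
  have [measurable]: "reindex \<pi> \<in> borel_measurable borel"
    by (intro borel_measurable_continuous_onI linear_continuous_on bounded_linear_reindex)
  have eq: "distr lebesgue lborel (reindex \<pi>) = lborel"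
    using distr_lborel_reindex[OF assms] by (simp add: distr_completion cong: distr_cong)
  show "reindex \<pi> \<in> lebesgue \<rightarrow>\<^sub>M lebesgue"
    by (simp add: completion.measurable_completion2 eq measurable_completion)
  show "distr lebesgue lebesgue (reindex \<pi>) = lebesgue"
    using completion.completion_distr_eq[of "reindex \<pi>" lborel lborel]
    by (simp add: eq measurable_completion)
qed

lemma reindex_image_eq_vimage:
  assumes "bij \<pi>"
  shows "reindex \<pi> ` S = reindex (inv \<pi>) -` S"
proof (intro equalityI subsetI)
  fix y assume "y \<in> reindex (inv \<pi>) -` S"
  then show "y \<in> reindex \<pi> ` S"
    using reindex_inverse(2)[OF assms, of y] by (metis image_eqI vimageE)
qed (auto simp: assms)

lemma
  fixes \<pi> :: "'m::finite \<Rightarrow> 'n::finite"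
  assumes "bij \<pi>" "S \<in> sets lebesgue"
  shows sets_reindex_image: "reindex \<pi> ` S \<in> sets lebesgue"
    and emeasure_reindex_image: "emeasure lebesgue (reindex \<pi> ` S) = emeasure lebesgue S"
proof -
  note m = reindex_measurable[OF bij_imp_bij_inv[OF assms(1)]]
  show "reindex \<pi> ` S \<in> sets lebesgue"
    using measurable_sets[OF m assms(2)] by (simp add: reindex_image_eq_vimage assms)
  have "emeasure lebesgue S = emeasure (distr lebesgue lebesgue (reindex (inv \<pi>))) S"
    by (simp add: distr_lebesgue_reindex bij_imp_bij_inv assms)
  also have "\<dots> = emeasure lebesgue (reindex \<pi> ` S)"
    by (simp add: emeasure_distr m assms reindex_image_eq_vimage)
  finally show "emeasure lebesgue (reindex \<pi> ` S) = emeasure lebesgue S" ..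
qed

text \<open>Conjugation by \<open>\<pi>\<close> is a sign-preserving bijection between the
  permutations of the two index types; it matches the Leibniz sums term by term.\<close>

lemma det_reindex:
  fixes \<pi> :: "'m::finite \<Rightarrow> 'n::finite" and A :: "real^'n^'n"
  assumes "bij \<pi>"
  shows "det (\<chi> i j. A $ \<pi> i $ \<pi> j) = det A"
proof -
  let ?m = "map_permutation UNIV \<pi>"
  have m: "?m p = \<pi> \<circ> p \<circ> inv \<pi>" for p
    using assms by (simp add: map_permutation_def bij_is_surj restrict_id_def fun_eq_iff)
  have bij: "bij_betw ?m {p. p permutes UNIV} {p. p permutes UNIV}"
  proof (rule bij_betw_byWitness[where f' = "\<lambda>p. inv \<pi> \<circ> p \<circ> \<pi>"])
    show "?m ` {p. p permutes UNIV} \<subseteq> {p. p permutes UNIV}"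
      using assms by (auto intro!: map_permutation_permutes)
    show "(\<lambda>p. inv \<pi> \<circ> p \<circ> \<pi>) ` {p. p permutes UNIV} \<subseteq> {p. p permutes UNIV}"
      using assms by (auto intro!: bij_imp_permutes bij_comp bij_imp_bij_inv permutes_bij)
  qed (use assms in \<open>auto simp: m fun_eq_iff bij_is_inj bij_is_surj surj_f_inv_f\<close>)
  have "det A = (\<Sum>p | p permutes UNIV. of_int (sign (?m p)) * (\<Prod>j\<in>UNIV. A $ j $ ?m p j))"
    unfolding det_def by (rule sum.reindex_bij_betw[OF bij, symmetric])
  also have "\<dots> = (\<Sum>p | p permutes UNIV. of_int (sign p) * (\<Prod>i\<in>UNIV. A $ \<pi> i $ \<pi> (p i)))"
  proof (intro sum.cong refl)
    fix p :: "'m \<Rightarrow> 'm" assume p: "p \<in> {p. p permutes UNIV}"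
    have "(\<Prod>j\<in>UNIV. A $ j $ ?m p j) = (\<Prod>i\<in>UNIV. A $ \<pi> i $ ?m p (\<pi> i))"
      using assms by (intro prod.reindex_bij_betw[symmetric]) simp
    then show "of_int (sign (?m p)) * (\<Prod>j\<in>UNIV. A $ j $ ?m p j) =
        of_int (sign p) * (\<Prod>i\<in>UNIV. A $ \<pi> i $ \<pi> (p i))"
      using assms p sign_map_permutation[of \<pi> UNIV p] by (simp add: bij_is_inj m)
  qed
  also have "\<dots> = det (\<chi> i j. A $ \<pi> i $ \<pi> j)"
    by (simp add: det_def)
  finally show ?thesis ..
qed

lemma det_conjugate_reindex:
  fixes \<pi> :: "'m::finite \<Rightarrow> 'n::finite" and L :: "real^'n \<Rightarrow> real^'n"
  assumes "bij \<pi>"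
  shows "det (matrix (reindex \<pi> \<circ> L \<circ> reindex (inv \<pi>))) = det (matrix L)"
proof -
  have "reindex (inv \<pi>) (axis j 1) = axis (\<pi> j) (1::real)" for j
    using assms by (auto simp: vec_eq_iff axis_def bij_is_inj bij_is_surj surj_f_inv_f)
  then have eq: "L (reindex (inv \<pi>) (axis j 1)) = L (axis (\<pi> j) 1)" for j
    by simp
  have "matrix (reindex \<pi> \<circ> L \<circ> reindex (inv \<pi>)) = (\<chi> i j. matrix L $ \<pi> i $ \<pi> j)"
    by (simp add: matrix_def vec_eq_iff eq)
  then show ?thesis
    using det_reindex[OF assms] by simp
qed

lemma has_derivative_conjugate_reindex:
  assumes "bij \<pi>" "(f has_derivative L) (at x within S)"
  shows "(reindex \<pi> \<circ> f \<circ> reindex (inv \<pi>) has_derivative reindex \<pi> \<circ> L \<circ> reindex (inv \<pi>))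
           (at (reindex \<pi> x) within reindex \<pi> ` S)"
proof -
  have eq: "reindex (inv \<pi>) ` reindex \<pi> ` S = S"
    using assms by (auto simp: image_image)
  have d: "(reindex \<sigma> has_derivative reindex \<sigma>) (at y within T)" for \<sigma> y T
    by (rule bounded_linear_imp_has_derivative bounded_linear_reindex)+
  have "(f \<circ> reindex (inv \<pi>) has_derivative L \<circ> reindex (inv \<pi>)) (at (reindex \<pi> x) within reindex \<pi> ` S)"
    by (rule diff_chain_within[OF d]) (use assms in \<open>simp add: eq\<close>)
  from diff_chain_within[OF this d] show ?thesis
    by (simp add: o_assoc)
qed


text \<open>Integrability of the Jacobian on \<open>S\<close> is equivalent to finite measure of the
  image. If both hold, the real-valued formula applies; otherwise both sides are infinite, so the
  identity holds in \<open>ennreal\<close> in every case.\<close>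

lemma area_formula_wellorder:
  fixes f :: "real^'n::{finite,wellorder} \<Rightarrow> real^'n::_"
  assumes S: "S \<in> sets lebesgue" and f: "\<And>x. x \<in> S \<Longrightarrow> (f has_derivative f' x) (at x within S)"
    and inj: "inj_on f S"
  shows "emeasure lebesgue (f ` S) = (\<integral>\<^sup>+ x. ennreal \<bar>det (matrix (f' x))\<bar> * indicator S x \<partial>lebesgue)"
proof -
  let ?J = "\<lambda>x. \<bar>det (matrix (f' x))\<bar>" and ?JS = "\<lambda>x. if x \<in> S then \<bar>det (matrix (f' x))\<bar> else 0"
  have fS: "f ` S \<in> sets lebesgue"
    using f by (intro differentiable_image_in_sets_lebesgue S)
      (auto simp: differentiable_on_def differentiable_def)
  have meas: "?JS \<in> borel_measurable lebesgue"
    using borel_measurable_det_Jacobian[OF S f] S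
    by (subst borel_measurable_if) auto
  have int_eq: "(\<integral>\<^sup>+ x. ennreal (?J x) * indicator S x \<partial>lebesgue) = (\<integral>\<^sup>+ x. ennreal (?JS x) \<partial>lebesgue)"
    by (intro nn_integral_cong) (auto simp: indicator_def)
  show ?thesis
  proof (cases "?J integrable_on S")
    case True
    then have "(?JS has_integral integral S ?J) UNIV"
      by (simp add: has_integral_restrict_UNIV integrable_integral)
    then have "(\<integral>\<^sup>+ x. ennreal (?JS x) \<partial>lebesgue) = integral S ?J"
      by (subst (asm) has_integral_iff_nn_integral_lebesgue) auto
    moreover have "f ` S \<in> lmeasurable" "measure lebesgue (f ` S) = integral S ?J"
      using measurable_differentiable_image_eq[OF S f inj] measure_differentiable_image_eq[OF S f inj] True
      by auto
    ultimately show ?thesis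
      using int_eq by (simp add: emeasure_eq_measure2)
  next
    case False
    have "emeasure lebesgue (f ` S) = \<infinity>"
      using measurable_differentiable_image_eq[OF S f inj] False fS
      by (auto simp: fmeasurable_def less_top[symmetric])
    moreover have "(\<integral>\<^sup>+ x. ennreal (?JS x) \<partial>lebesgue) = \<infinity>"
    \<comment> \<open>A finite value would make the measurable function \<open>?JS\<close>
      integrable over the whole space, hence \<open>?J\<close> integrable on
      \<open>S\<close>.\<close>
    proof (rule ccontr)
      assume "(\<integral>\<^sup>+ x. ennreal (?JS x) \<partial>lebesgue) \<noteq> \<infinity>"
      then obtain r where "0 \<le> r" "(\<integral>\<^sup>+ x. ennreal (?JS x) \<partial>lebesgue) = ennreal r"
        by (cases "\<integral>\<^sup>+ x. ennreal (?JS x) \<partial>lebesgue") auto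
      then have "(?JS has_integral r) UNIV"
        using meas by (subst has_integral_iff_nn_integral_lebesgue) auto
      then show False
        using False has_integral_restrict_UNIV[of S ?J r] by (auto simp: integrable_on_def)
    qed
    ultimately show ?thesis
      using int_eq by simp
  qed
qed

lemma bij_ordered_index_exists: "\<exists>\<pi> :: 'n::finite ordered_index \<Rightarrow> 'n. bij \<pi>"
  by (rule finite_same_card_bij) (simp_all add: card_ordered_index)

text \<open>The conjugate \<open>g\<close> of \<open>f\<close> by a coordinate permutation lives on
  the ordered index type. Determinants of derivatives, measures of images and Lebesgue integrals are
  unchanged by this conjugation.\<close>

theorem area_formula:
  fixes f :: "real^'n \<Rightarrow> real^'n"
  assumes S: "S \<in> sets lebesgue" and f: "\<And>x. x \<in> S \<Longrightarrow> (f has_derivative f' x) (at x within S)"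
    and inj: "inj_on f S"
  shows "emeasure lebesgue (f ` S) = (\<integral>\<^sup>+ x. ennreal \<bar>det (matrix (f' x))\<bar> * indicator S x \<partial>lebesgue)"
proof -
  obtain \<pi> :: "'n ordered_index \<Rightarrow> 'n" where \<pi>: "bij \<pi>"
    using bij_ordered_index_exists by blast
  let ?R = "reindex \<pi>" and ?R' = "reindex (inv \<pi>)"
  define g where "g = ?R \<circ> f \<circ> ?R'"
  define g' where "g' y = ?R \<circ> f' (?R' y) \<circ> ?R'" for y
  have RS: "?R ` S \<in> sets lebesgue"
    by (rule sets_reindex_image[OF \<pi> S])
  have "inj_on g (?R ` S)"
  proof (rule inj_onI)
    fix y z assume yz: "y \<in> ?R ` S" "z \<in> ?R ` S" "g y = g z"
    then obtain a b where ab: "y = ?R a" "z = ?R b" "a \<in> S" "b \<in> S"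
      by blast
    with yz have "?R' (?R (f a)) = ?R' (?R (f b))"
      by (simp add: g_def \<pi>)
    then have "f a = f b"
      by (simp only: reindex_inverse[OF \<pi>])
    with ab inj show "y = z"
      by (auto dest: inj_onD)
  qed
  moreover have g': "(g has_derivative g' y) (at y within ?R ` S)" if "y \<in> ?R ` S" for y
    using that has_derivative_conjugate_reindex[OF \<pi> f] by (auto simp: g_def g'_def \<pi>)
  ultimately have "emeasure lebesgue (g ` ?R ` S) =
      (\<integral>\<^sup>+ y. ennreal \<bar>det (matrix (g' y))\<bar> * indicator (?R ` S) y \<partial>lebesgue)"
    by (intro area_formula_wellorder RS) auto
  also have "\<dots> = (\<integral>\<^sup>+ y. ennreal \<bar>det (matrix (g' y))\<bar> * indicator (?R ` S) y \<partial>distr lebesgue lebesgue ?R)"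
    by (simp add: distr_lebesgue_reindex \<pi>)
  also have "\<dots> = (\<integral>\<^sup>+ x. ennreal \<bar>det (matrix (g' (?R x)))\<bar> * indicator (?R ` S) (?R x) \<partial>lebesgue)"
  proof (rule nn_integral_distr)
    have "(\<lambda>y. if y \<in> ?R ` S then \<bar>det (matrix (g' y))\<bar> else 0) \<in> borel_measurable lebesgue"
      using borel_measurable_det_Jacobian[OF RS g'] RS by (subst borel_measurable_if) auto
    then have "(\<lambda>y. ennreal (if y \<in> ?R ` S then \<bar>det (matrix (g' y))\<bar> else 0)) \<in> borel_measurable lebesgue"
      by measurable
    also have "(\<lambda>y. ennreal (if y \<in> ?R ` S then \<bar>det (matrix (g' y))\<bar> else 0)) =
        (\<lambda>y. ennreal \<bar>det (matrix (g' y))\<bar> * indicator (?R ` S) y)"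
      by (auto simp: indicator_def fun_eq_iff)
    finally show "(\<lambda>y. ennreal \<bar>det (matrix (g' y))\<bar> * indicator (?R ` S) y)
        \<in> borel_measurable (distr lebesgue lebesgue ?R)"
      by simp
  qed (rule reindex_measurable[OF \<pi>])
  also have "\<dots> = (\<integral>\<^sup>+ x. ennreal \<bar>det (matrix (f' x))\<bar> * indicator S x \<partial>lebesgue)"
    by (intro nn_integral_cong)
       (simp add: g'_def det_conjugate_reindex[OF \<pi>] \<pi> reindex_image_eq_vimage[OF \<pi>] indicator_def)
  finally have "emeasure lebesgue (g ` ?R ` S) = \<dots>" .
  moreover have "g ` ?R ` S = ?R ` f ` S"
    by (auto simp: g_def \<pi> image_iff)
  moreover have "f ` S \<in> sets lebesgue"
    using f by (intro differentiable_image_in_sets_lebesgue S)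
      (auto simp: differentiable_on_def differentiable_def)
  ultimately show ?thesis
    using emeasure_reindex_image[OF \<pi>, of "f ` S"] by simp
qed

text \<open>Vanishing determinant means deficient rank, the hypothesis of \<open>baby_Sard\<close>;
  the same conjugation carries the conclusion back, since coordinate permutations preserve null
  sets.\<close>

theorem Sard_negligible:
  fixes f :: "real^'n \<Rightarrow> real^'n"
  assumes f: "\<And>x. x \<in> S \<Longrightarrow> (f has_derivative f' x) (at x within S)"
    and det: "\<And>x. x \<in> S \<Longrightarrow> det (matrix (f' x)) = 0"
  shows "negligible (f ` S)"
proof -
  obtain \<pi> :: "'n ordered_index \<Rightarrow> 'n" where \<pi>: "bij \<pi>"
    using bij_ordered_index_exists by blast
  let ?R = "reindex \<pi>" and ?R' = "reindex (inv \<pi>)"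
  define g where "g = ?R \<circ> f \<circ> ?R'"
  define g' where "g' y = ?R \<circ> f' (?R' y) \<circ> ?R'" for y
  have "negligible (g ` ?R ` S)"
  proof (rule baby_Sard)
    show "(g has_derivative g' y) (at y within ?R ` S)" if "y \<in> ?R ` S" for y
      using that has_derivative_conjugate_reindex[OF \<pi> f] by (auto simp: g_def g'_def \<pi>)
    show "rank (matrix (g' y)) < CARD('n ordered_index)" if "y \<in> ?R ` S" for y
      using that det unfolding det_eq_0_rank[symmetric] g'_def det_conjugate_reindex[OF \<pi>]
      by (auto simp: \<pi>)
  qed simp
  moreover have "g ` ?R ` S = ?R ` f ` S"
    by (auto simp: g_def \<pi> image_iff)
  ultimately have "?R ` f ` S \<in> null_sets lebesgue"
    by (simp add: negligible_iff_null_sets)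
  then have "?R' ` ?R ` f ` S \<in> null_sets lebesgue"
    using sets_reindex_image[of "inv \<pi>"] emeasure_reindex_image[of "inv \<pi>"] \<pi>
    by (auto simp: null_sets_def bij_imp_bij_inv simp del: image_image)
  then show ?thesis
    by (simp add: image_image \<pi> negligible_iff_null_sets)
qed


text \<open>The area formula for all measurable subsets of \<open>S\<close> says that Lebesgue
  measure on the image, pushed forward by the inverse of \<open>f\<close>, has the absolute Jacobian
  as density on \<open>S\<close>. Integrating \<open>u\<close> against both measures gives the
  change of variables.\<close>

lemma
  fixes f :: "real^'n \<Rightarrow> real^'n" and u :: "real^'n \<Rightarrow> ennreal"
  assumes S: "S \<in> sets lebesgue" and f: "\<And>x. x \<in> S \<Longrightarrow> (f has_derivative f' x) (at x within S)"
    and inj: "inj_on f S"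
    and det: "(\<lambda>x. det (matrix (f' x))) \<in> borel_measurable (lebesgue_on S)"
    and u: "u \<in> borel_measurable (lebesgue_on S)"
  shows push_measurable: "(\<lambda>y. u (inv_into S f y) * indicator (f ` S) y) \<in> borel_measurable lebesgue"
    and nn_integral_push: "(\<integral>\<^sup>+ y. u (inv_into S f y) * indicator (f ` S) y \<partial>lebesgue) =
      (\<integral>\<^sup>+ x. ennreal \<bar>det (matrix (f' x))\<bar> * u x * indicator S x \<partial>lebesgue)"
proof -
  let ?g = "inv_into S f"
  \<comment> \<open>Differentiable maps send measurable sets to measurable sets; this is what makes
    the inverse \<open>?g\<close> measurable.\<close>
  have fA: "f ` A \<in> sets lebesgue" if "A \<in> sets (lebesgue_on S)" for A
  proof (rule differentiable_image_in_sets_lebesgue)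
    have "A \<subseteq> S" "A \<in> sets lebesgue"
      using that S by (auto simp: sets_restrict_space_iff dest: sets.sets_into_space)
    then show "A \<in> sets lebesgue" "f differentiable_on A"
      using f by (auto simp: differentiable_on_def differentiable_def intro: has_derivative_subset)
  qed simp
  have fS: "f ` S \<in> sets lebesgue"
    using fA[of S] S by (simp add: sets_restrict_space_iff)
  have vim: "?g -` A \<inter> f ` S = f ` A" if "A \<subseteq> S" for A
    using that inj by (auto simp: inv_into_f_f subset_iff)
  have g: "?g \<in> lebesgue_on (f ` S) \<rightarrow>\<^sub>M lebesgue_on S"
  proof (rule measurableI)
    fix A assume A: "A \<in> sets (lebesgue_on S)"
    then have "A \<subseteq> S"
      using sets.sets_into_space by fastforce
    with A show "?g -` A \<inter> space (lebesgue_on (f ` S)) \<in> sets (lebesgue_on (f ` S))"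
      using fA[OF A] fS by (auto simp: vim sets_restrict_space_iff)
  qed (auto simp: inv_into_into)
  have eq: "distr (lebesgue_on (f ` S)) (lebesgue_on S) ?g =
      density (lebesgue_on S) (\<lambda>x. ennreal \<bar>det (matrix (f' x))\<bar>)"
  proof (rule measure_eqI)
    fix A assume "A \<in> sets (distr (lebesgue_on (f ` S)) (lebesgue_on S) ?g)"
    then have A: "A \<in> sets (lebesgue_on S)"
      by simp
    then have A': "A \<subseteq> S" "A \<in> sets lebesgue"
      using S by (auto simp: sets_restrict_space_iff dest: sets.sets_into_space)
    have "emeasure (distr (lebesgue_on (f ` S)) (lebesgue_on S) ?g) A = emeasure lebesgue (f ` A)"
      using A A' fS by (simp add: emeasure_distr g vim emeasure_restrict_space image_mono)
    also have "\<dots> = (\<integral>\<^sup>+ x. ennreal \<bar>det (matrix (f' x))\<bar> * indicator A x \<partial>lebesgue)"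
      using f A' inj by (intro area_formula) (auto intro: has_derivative_subset inj_on_subset)
    also have "\<dots> = (\<integral>\<^sup>+ x. ennreal \<bar>det (matrix (f' x))\<bar> * indicator A x * indicator S x \<partial>lebesgue)"
      using A' by (intro nn_integral_cong) (auto simp: indicator_def)
    also have "\<dots> = (\<integral>\<^sup>+ x. ennreal \<bar>det (matrix (f' x))\<bar> * indicator A x \<partial>lebesgue_on S)"
      using S by (simp add: nn_integral_restrict_space)
    also have "\<dots> = emeasure (density (lebesgue_on S) (\<lambda>x. ennreal \<bar>det (matrix (f' x))\<bar>)) A"
      using A det by (simp add: emeasure_density)
    finally show "emeasure (distr (lebesgue_on (f ` S)) (lebesgue_on S) ?g) A =
      emeasure (density (lebesgue_on S) (\<lambda>x. ennreal \<bar>det (matrix (f' x))\<bar>)) A" .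
  qed simp
  have ug: "(\<lambda>y. u (?g y)) \<in> borel_measurable (lebesgue_on (f ` S))"
    using measurable_compose[OF g u] .
  then show "(\<lambda>y. u (?g y) * indicator (f ` S) y) \<in> borel_measurable lebesgue"
    using fS by (subst (asm) borel_measurable_restrict_space_iff_ennreal) auto
  have "(\<integral>\<^sup>+ y. u (?g y) * indicator (f ` S) y \<partial>lebesgue) = (\<integral>\<^sup>+ y. u (?g y) \<partial>lebesgue_on (f ` S))"
    using fS by (simp add: nn_integral_restrict_space)
  also have "\<dots> = (\<integral>\<^sup>+ x. u x \<partial>distr (lebesgue_on (f ` S)) (lebesgue_on S) ?g)"
    using u by (simp add: nn_integral_distr g)
  also have "\<dots> = (\<integral>\<^sup>+ x. ennreal \<bar>det (matrix (f' x))\<bar> * u x \<partial>lebesgue_on S)"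
    unfolding eq using u det by (simp add: nn_integral_density)
  also have "\<dots> = (\<integral>\<^sup>+ x. ennreal \<bar>det (matrix (f' x))\<bar> * u x * indicator S x \<partial>lebesgue)"
    using S by (simp add: nn_integral_restrict_space)
  finally show "(\<integral>\<^sup>+ y. u (?g y) * indicator (f ` S) y \<partial>lebesgue) =
      (\<integral>\<^sup>+ x. ennreal \<bar>det (matrix (f' x))\<bar> * u x * indicator S x \<partial>lebesgue)" .
qed

section \<open>Images of null sets and upper derivatives on the line\<close>

text \<open>Outer measure lets images of sets be estimated before anything is known about their
  measurability.\<close>

abbreviation "outer \<equiv> outer_measure_of lebesgue"

lemma outer_measure_hull:
  obtains E where "E \<in> sets lebesgue" "X \<subseteq> E" "outer X = emeasure lebesgue E"
  using outer_measure_of_attain[of X lebesgue] by auto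

text \<open>Each set is replaced by a measurable hull and the two integrals are exchanged. The sum
  is an integral over \<open>count_space I\<close> because the Vitali families below are countable
  sets without a chosen enumeration.\<close>

lemma outer_measure_UN_countable:
  assumes "countable I"
  shows "outer (\<Union>i\<in>I. X i) \<le> (\<integral>\<^sup>+ i. outer (X i) \<partial>count_space I)"
proof -
  have "\<forall>i. \<exists>E. E \<in> sets lebesgue \<and> X i \<subseteq> E \<and> outer (X i) = emeasure lebesgue E"
    using outer_measure_hull by metis
  then obtain E where E: "\<And>i. E i \<in> sets lebesgue" "\<And>i. X i \<subseteq> E i" "\<And>i. outer (X i) = emeasure lebesgue (E i)"
    by metis
  have "outer (\<Union>i\<in>I. X i) \<le> outer (\<Union>i\<in>I. E i)"
    using E by (intro outer_measure_of_mono) auto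
  also have "\<dots> = emeasure lebesgue (\<Union>i\<in>I. E i)"
    using E assms by (intro outer_measure_of_eq) (simp add: sets.countable_UN'')
  also have "\<dots> = (\<integral>\<^sup>+ x. indicator (\<Union>i\<in>I. E i) x \<partial>lebesgue)"
    using E assms by (intro nn_integral_indicator[symmetric]) (simp add: sets.countable_UN'')
  also have "\<dots> \<le> (\<integral>\<^sup>+ x. \<integral>\<^sup>+ i. indicator (E i) x \<partial>count_space I \<partial>lebesgue)"
  proof (intro nn_integral_mono)
    fix x
    show "indicator (\<Union>i\<in>I. E i) x \<le> (\<integral>\<^sup>+ i. indicator (E i) x \<partial>count_space I)"
    proof (cases "x \<in> (\<Union>i\<in>I. E i)")
      case True
      then obtain i where i: "i \<in> I" "x \<in> E i"
        by blast
      have "(\<integral>\<^sup>+ j. indicator {i} j \<partial>count_space I) \<le> (\<integral>\<^sup>+ j. indicator (E j) x \<partial>count_space I)"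
        using i by (intro nn_integral_mono) (auto simp: indicator_def)
      moreover have "(\<integral>\<^sup>+ j. indicator {i} j \<partial>count_space I) = (1::ennreal)"
        using i by (subst nn_integral_indicator) auto
      ultimately show ?thesis
        by (simp add: indicator_def)
    qed auto
  qed
  also have "\<dots> = (\<integral>\<^sup>+ i. \<integral>\<^sup>+ x. indicator (E i) x \<partial>lebesgue \<partial>count_space I)"
    using E by (intro nn_integral_count_space_nn_integral assms) auto
  also have "\<dots> = (\<integral>\<^sup>+ i. outer (X i) \<partial>count_space I)"
    using E by simp
  finally show ?thesis .
qed

lemma outer_measure_UN: "outer (\<Union>i::nat. X i) \<le> (\<Sum>i. outer (X i))"
  using outer_measure_UN_countable[of UNIV X] by (simp add: nn_integral_count_space_nat)

lemma outer_measure_Un: "outer (A \<union> B) \<le> outer A + outer B"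
proof -
  obtain E F where "E \<in> sets lebesgue" "A \<subseteq> E" "outer A = emeasure lebesgue E"
    "F \<in> sets lebesgue" "B \<subseteq> F" "outer B = emeasure lebesgue F"
    using outer_measure_hull by metis
  moreover from this have "outer (A \<union> B) \<le> outer (E \<union> F)"
    by (intro outer_measure_of_mono) auto
  ultimately show ?thesis
    using emeasure_subadditive[of E lebesgue F] by auto
qed

lemma outer_measure_negligible: "negligible N \<Longrightarrow> outer N = 0"
  by (simp add: negligible_iff_null_sets null_sets_def)

lemma outer_measure_zero_negligible:
  assumes "outer N = 0"
  shows "negligible N"
proof -
  obtain E where "E \<in> sets lebesgue" "N \<subseteq> E" "outer N = emeasure lebesgue E"
    using outer_measure_hull by metis
  with assms have "negligible E"
    by (simp add: negligible_iff_null_sets null_sets_def)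
  then show ?thesis
    using \<open>N \<subseteq> E\<close> negligible_subset by blast
qed

text \<open>An interval is coded by its pair of endpoints; with midpoint \<open>m\<close> and
  half-length \<open>r\<close> it is a closed ball, so the Vitali theorem for balls applies.\<close>

lemma Vitali_intervals:
  fixes A :: "real set" and Q :: "(real \<times> real) set"
  assumes less: "\<And>a b. (a, b) \<in> Q \<Longrightarrow> a < b"
    and fine: "\<And>x d. x \<in> A \<Longrightarrow> 0 < d \<Longrightarrow> \<exists>(a, b) \<in> Q. x \<in> {a..b} \<and> b - a < d"
  obtains C where "countable C" "C \<subseteq> Q" "disjoint_family_on (\<lambda>(a, b). {a..b}) C"
    "negligible (A - (\<Union>(a, b)\<in>C. {a..b}))"
proof -
  define m where "m p = (fst p + snd p) / 2" for p :: "real \<times> real"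
  define r where "r p = (snd p - fst p) / 2" for p :: "real \<times> real"
  have cball: "cball (m p) (r p) = (case p of (a, b) \<Rightarrow> {a..b})" for p
    by (cases p) (simp add: m_def r_def cball_eq_atLeastAtMost field_simps)
  obtain C where "countable C" "C \<subseteq> Q" "pairwise (\<lambda>i j. disjnt (cball (m i) (r i)) (cball (m j) (r j))) C"
    "negligible (A - (\<Union>i \<in> C. cball (m i) (r i)))"
  proof (rule Vitali_covering_theorem_cballs[of Q r A m])
    show "0 < r i" if "i \<in> Q" for i
      using less[of "fst i" "snd i"] that by (simp add: r_def)
    show "\<exists>i. i \<in> Q \<and> x \<in> cball (m i) (r i) \<and> r i < d" if xd: "x \<in> A" "0 < d" for x d
    proof -
      obtain a b where ab: "(a, b) \<in> Q" "x \<in> {a..b}" "b - a < d"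
        using fine[OF xd] by blast
      then have "r (a, b) < d"
        using less by (force simp: r_def)
      moreover have "x \<in> cball (m (a, b)) (r (a, b))"
        using ab cball[of "(a, b)"] by simp
      ultimately show ?thesis
        using ab by blast
    qed
  qed blast
  then show ?thesis
    by (intro that[of C]) (auto simp: cball disjoint_family_on_def pairwise_def disjnt_def)
qed

text \<open>The radius of validity may depend on the point, so a Vitali family selects disjoint
  short intervals inside an open set barely larger than \<open>A\<close>. Each image has length at
  most \<open>K\<close> times that of its interval, and the points missed form a null set, whose
  image is null by \<open>N\<close>.\<close>

lemma outer_image_Lipschitz_at:
  fixes \<phi> :: "real \<Rightarrow> real"
  assumes A: "A \<in> sets lebesgue" and K: "0 \<le> K"
    and N: "\<And>N. N \<subseteq> A \<Longrightarrow> negligible N \<Longrightarrow> negligible (\<phi> ` N)"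
    and lip: "\<And>t. t \<in> A \<Longrightarrow> \<exists>d>0. \<forall>t'. \<bar>t' - t\<bar> < d \<longrightarrow> \<bar>\<phi> t' - \<phi> t\<bar> \<le> K * \<bar>t' - t\<bar>"
  shows "outer (\<phi> ` A) \<le> ennreal K * emeasure lebesgue A"
proof -
  have *: "outer (\<phi> ` A) \<le> ennreal K * emeasure lebesgue A + ennreal (K * e)" if "e > 0" for e
  proof -
    obtain T where T: "open T" "A \<subseteq> T" "T - A \<in> lmeasurable" "emeasure lebesgue (T - A) < ennreal e"
      using sets_lebesgue_outer_open[OF A \<open>e > 0\<close>] .
    \<comment> \<open>Intervals are centred at \<open>t\<close>: the image then lies in a ball whose
      diameter is \<open>K\<close> times the length of the interval, so the constant stays
      \<open>K\<close> instead of \<open>2 * K\<close>.\<close>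
    define Q where "Q = {(a, b). \<exists>t r. r > 0 \<and> a = t - r \<and> b = t + r \<and> {a..b} \<subseteq> T \<and>
        \<phi> ` {a..b} \<subseteq> cball (\<phi> t) (K * r)}"
    have fine: "\<exists>(a, b)\<in>Q. t \<in> {a..b} \<and> b - a < d" if "t \<in> A" "d > 0" for t d
    proof -
      obtain d1 where d1: "d1 > 0" "\<And>t'. \<bar>t' - t\<bar> < d1 \<Longrightarrow> \<bar>\<phi> t' - \<phi> t\<bar> \<le> K * \<bar>t' - t\<bar>"
        using lip[OF \<open>t \<in> A\<close>] by blast
      obtain d2 where d2: "d2 > 0" "ball t d2 \<subseteq> T"
        using T \<open>t \<in> A\<close> openE by blast
      define r where "r = min d (min d1 d2) / 3"
      have r: "r > 0" "2 * r < d" "r < d1" "r < d2"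
        using d1 d2 \<open>d > 0\<close> by (auto simp: r_def min_def field_simps)
      have "{t - r..t + r} \<subseteq> T"
        using r d2(2) by (intro order.trans[OF _ d2(2)]) (auto simp: dist_real_def)
      moreover have "\<phi> ` {t - r..t + r} \<subseteq> cball (\<phi> t) (K * r)"
      proof safe
        fix s assume "s \<in> {t - r..t + r}"
        then have s: "\<bar>s - t\<bar> \<le> r" by auto
        with r have "\<bar>\<phi> s - \<phi> t\<bar> \<le> K * \<bar>s - t\<bar>"
          by (intro d1) auto
        also have "\<dots> \<le> K * r"
          using s K by (intro mult_left_mono)
        finally show "\<phi> s \<in> cball (\<phi> t) (K * r)"
          by (simp add: dist_real_def abs_minus_commute)
      qed
      ultimately have "(t - r, t + r) \<in> Q"
        using r unfolding Q_def by blast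
      then show ?thesis
        using r by (intro bexI[of _ "(t - r, t + r)"]) auto
    qed
    have "a < b" if "(a, b) \<in> Q" for a b
      using that by (auto simp: Q_def)
    from Vitali_intervals[OF this fine]
    obtain C where C: "countable C" "C \<subseteq> Q" "disjoint_family_on (\<lambda>(a, b). {a..b}) C"
        "negligible (A - (\<Union>(a, b)\<in>C. {a..b}))"
      by blast
    have "\<phi> ` A \<subseteq> \<phi> ` (A - (\<Union>(a, b)\<in>C. {a..b})) \<union> (\<Union>p\<in>C. \<phi> ` {fst p..snd p})"
      unfolding case_prod_beta by blast
    then have "outer (\<phi> ` A) \<le> outer (\<phi> ` (A - (\<Union>(a, b)\<in>C. {a..b}))) + outer (\<Union>p\<in>C. \<phi> ` {fst p..snd p})"
      by (rule order.trans[OF outer_measure_of_mono outer_measure_Un])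
    also have "outer (\<phi> ` (A - (\<Union>(a, b)\<in>C. {a..b}))) = 0"
      by (intro outer_measure_negligible N C) auto
    also have "outer (\<Union>p\<in>C. \<phi> ` {fst p..snd p}) \<le> (\<integral>\<^sup>+ p. outer (\<phi> ` {fst p..snd p}) \<partial>count_space C)"
      by (rule outer_measure_UN_countable[OF C(1)])
    also have "\<dots> \<le> (\<integral>\<^sup>+ p. ennreal K * emeasure lebesgue {fst p..snd p} \<partial>count_space C)"
    proof (intro nn_integral_mono)
      fix p assume "p \<in> space (count_space C)"
      then obtain t r where tr: "r > 0" "fst p = t - r" "snd p = t + r" "\<phi> ` {fst p..snd p} \<subseteq> cball (\<phi> t) (K * r)"
        using C(2) by (auto simp: Q_def)
      have "outer (\<phi> ` {fst p..snd p}) \<le> outer (cball (\<phi> t) (K * r))"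
        by (intro outer_measure_of_mono tr)
      also have "\<dots> = ennreal (2 * (K * r))"
        using tr K by (simp add: cball_eq_atLeastAtMost)
      also have "\<dots> = ennreal K * emeasure lebesgue {fst p..snd p}"
        using tr K by (simp add: ennreal_mult[symmetric] mult_ac)
      finally show "outer (\<phi> ` {fst p..snd p}) \<le> ennreal K * emeasure lebesgue {fst p..snd p}" .
    qed
    also have "\<dots> = ennreal K * (\<integral>\<^sup>+ p. emeasure lebesgue {fst p..snd p} \<partial>count_space C)"
      by (intro nn_integral_cmult) auto
    also have "(\<integral>\<^sup>+ p. emeasure lebesgue {fst p..snd p} \<partial>count_space C) = emeasure lebesgue (\<Union>p\<in>C. {fst p..snd p})"
      using C by (intro emeasure_UN_countable[symmetric]) (simp_all add: case_prod_beta')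
    also have "\<dots> \<le> emeasure lebesgue T"
    proof (rule emeasure_mono)
      show "(\<Union>p\<in>C. {fst p..snd p}) \<subseteq> T"
        using C(2) unfolding Q_def by fastforce
    qed (use T in \<open>simp add: borel_open\<close>)
    also have "emeasure lebesgue T = emeasure lebesgue (A \<union> (T - A))"
      using T by (simp add: Un_absorb1)
    also have "\<dots> \<le> emeasure lebesgue A + emeasure lebesgue (T - A)"
      using T A by (intro emeasure_subadditive) auto
    also have "\<dots> \<le> emeasure lebesgue A + ennreal e"
      using T by (intro add_left_mono) auto
    finally show ?thesis
      using K that by (simp add: distrib_left ennreal_mult mult_left_mono)
  qed
  show ?thesis
  \<comment> \<open>For \<open>K = 0\<close> the bound is already zero for any \<open>e\<close>;
    otherwise \<open>e / K\<close> cancels the factor in the error term.\<close>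
  proof (cases "K = 0")
    case True
    then show ?thesis using *[of 1] by simp
  next
    case False
    show ?thesis
    proof (rule ennreal_le_epsilon)
      fix e :: real assume "0 < e"
      with False K show "outer (\<phi> ` A) \<le> ennreal K * emeasure lebesgue A + ennreal e"
        using *[of "e / K"] by simp
    qed
  qed
qed

lemma is_interval_boundary_negligible:
  assumes "is_interval (J :: real set)"
  shows "negligible (J - interior J)"
  using closure_subset[of J] assms
  by (intro negligible_subset[OF negligible_convex_frontier[of J]]) (auto simp: is_interval_convex frontier_def)

text \<open>\<open>A\<close> is cut along the values of \<open>\<sigma>\<close> into layers of
  height \<open>e\<close>. On one layer the pointwise Lipschitz constant is at most the upper level,
  which exceeds \<open>\<sigma>\<close> by at most \<open>e\<close>; finite measure of
  \<open>A\<close> makes the total error \<open>e * emeasure lborel A\<close> arbitrarily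
  small.\<close>

lemma outer_image_le_nn_integral_bounded:
  fixes \<phi> :: "real \<Rightarrow> real" and \<sigma> :: "real \<Rightarrow> real"
  assumes J: "is_interval J"
    and N: "\<And>N. N \<subseteq> J \<Longrightarrow> negligible N \<Longrightarrow> negligible (\<phi> ` N)"
    and [measurable]: "\<sigma> \<in> borel_measurable borel" and \<sigma>: "\<And>t. t \<in> J \<Longrightarrow> 0 \<le> \<sigma> t"
    and [measurable]: "W \<in> sets borel" and W: "negligible (\<phi> ` (J \<inter> W))"
    and lip: "\<And>t e. t \<in> J \<Longrightarrow> t \<notin> W \<Longrightarrow> 0 < e \<Longrightarrow>
      \<exists>d>0. \<forall>t'\<in>J. \<bar>t' - t\<bar> < d \<longrightarrow> \<bar>\<phi> t' - \<phi> t\<bar> \<le> (\<sigma> t + e) * \<bar>t' - t\<bar>"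
    and [measurable]: "A \<in> sets borel" and A: "A \<subseteq> J" "emeasure lborel A < \<infinity>"
  shows "outer (\<phi> ` A) \<le> (\<integral>\<^sup>+ t. ennreal (\<sigma> t) * indicator A t \<partial>lborel)"
proof -
  let ?I = "\<lambda>A. \<integral>\<^sup>+ t. ennreal (\<sigma> t) * indicator A t \<partial>lborel"
  have "outer (\<phi> ` A) \<le> ?I A + ennreal e * emeasure lborel A" if "e > 0" for e :: real
  proof -
    \<comment> \<open>The Lipschitz estimate needs whole neighbourhoods, so boundary points of
      \<open>J\<close> are dropped along with \<open>W\<close>; the images of both are null.\<close>
    define A' where "A' = (A - W) \<inter> interior J"
    define P where "P k = {t \<in> A'. real k * e \<le> \<sigma> t \<and> \<sigma> t < real (Suc k) * e}" for k :: nat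
    have [measurable]: "A' \<in> sets borel" "\<And>k. P k \<in> sets borel"
      unfolding A'_def P_def using borel_open[OF open_interior[of J]] by measurable
    have P: "P k \<subseteq> A'" "P k \<subseteq> J" "P k \<subseteq> A" for k
      using A by (auto simp: P_def A'_def)
    have UP: "(\<Union>k. P k) = A'"
    proof (rule antisym; rule subsetI)
      fix t assume t: "t \<in> A'"
      then have "0 \<le> \<sigma> t"
        using \<sigma> A by (auto simp: A'_def)
      then have "real (nat \<lfloor>\<sigma> t / e\<rfloor>) \<le> \<sigma> t / e" "\<sigma> t / e < real (nat \<lfloor>\<sigma> t / e\<rfloor>) + 1"
        using \<open>e > 0\<close> by auto
      then have "t \<in> P (nat \<lfloor>\<sigma> t / e\<rfloor>)"
        using \<open>e > 0\<close> t by (simp add: P_def field_simps)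
      then show "t \<in> (\<Union>k. P k)" by blast
    qed (auto simp: P_def)
    have disj: "disjoint_family P"
    proof -
      have "i = j" if "t \<in> P i" "t \<in> P j" for i j t
      proof -
        have "real i * e < real (Suc j) * e" "real j * e < real (Suc i) * e"
          using that by (auto simp: P_def)
        with \<open>e > 0\<close> show ?thesis by auto
      qed
      then show ?thesis by (auto simp: disjoint_family_on_def)
    qed
    have piece: "outer (\<phi> ` P k) \<le> emeasure (density lborel (\<lambda>t. ennreal (\<sigma> t + e))) (P k)" for k
    proof -
      have "outer (\<phi> ` P k) \<le> ennreal (real (Suc k) * e) * emeasure lebesgue (P k)"
      proof (rule outer_image_Lipschitz_at)
        fix t assume t: "t \<in> P k"
        then have tJ: "t \<in> J" "t \<notin> W" "t \<in> interior J" and st: "\<sigma> t < real (Suc k) * e"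
          using A by (auto simp: P_def A'_def)
        \<comment> \<open>The strict upper bound in \<open>P k\<close> leaves a positive error to be
          passed to \<open>lip\<close>.\<close>
        obtain d1 where d1: "d1 > 0" "\<And>t'. t' \<in> J \<Longrightarrow> \<bar>t' - t\<bar> < d1 \<Longrightarrow>
            \<bar>\<phi> t' - \<phi> t\<bar> \<le> (\<sigma> t + (real (Suc k) * e - \<sigma> t)) * \<bar>t' - t\<bar>"
          using lip[OF tJ(1,2), of "real (Suc k) * e - \<sigma> t"] st by auto
        obtain d2 where d2: "d2 > 0" "ball t d2 \<subseteq> J"
          using tJ by (meson mem_interior)
        show "\<exists>d>0. \<forall>t'. \<bar>t' - t\<bar> < d \<longrightarrow> \<bar>\<phi> t' - \<phi> t\<bar> \<le> (real (Suc k) * e) * \<bar>t' - t\<bar>"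
        proof (intro exI[of _ "min d1 d2"] conjI allI impI)
          fix t' assume t': "\<bar>t' - t\<bar> < min d1 d2"
          then have "t' \<in> ball t d2"
            by (simp add: dist_real_def abs_minus_commute)
          then have "t' \<in> J" using d2 by blast
          from d1(2)[OF this] t' show "\<bar>\<phi> t' - \<phi> t\<bar> \<le> real (Suc k) * e * \<bar>t' - t\<bar>"
            by simp
        qed (use d1 d2 in auto)
      next
        show "negligible (\<phi> ` X)" if "X \<subseteq> P k" "negligible X" for X
          by (rule N[OF order.trans[OF that(1) P(2)] that(2)])
      qed (use \<open>e > 0\<close> in \<open>auto simp del: of_nat_Suc\<close>)
      also have "\<dots> = (\<integral>\<^sup>+ t. ennreal (real (Suc k) * e) * indicator (P k) t \<partial>lborel)"
        by (simp add: nn_integral_cmult_indicator)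
      also have "\<dots> \<le> (\<integral>\<^sup>+ t. ennreal (\<sigma> t + e) * indicator (P k) t \<partial>lborel)"
      proof (intro nn_integral_mono)
        fix t
        have "ennreal (real (Suc k) * e) \<le> ennreal (\<sigma> t + e)" if "t \<in> P k"
        proof (rule ennreal_leI)
          show "real (Suc k) * e \<le> \<sigma> t + e"
            using that by (simp add: P_def algebra_simps)
        qed
        then show "ennreal (real (Suc k) * e) * indicator (P k) t \<le> ennreal (\<sigma> t + e) * indicator (P k) t"
          by (simp only: indicator_def) auto
      qed
      finally show ?thesis
        by (simp add: emeasure_density)
    qed
    have nf: "negligible (\<phi> ` (J - interior J))"
      by (rule N[OF _ is_interval_boundary_negligible[OF J]]) auto
    have "\<phi> ` A \<subseteq> (\<phi> ` (J \<inter> W) \<union> \<phi> ` (J - interior J)) \<union> (\<Union>k. \<phi> ` P k)"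
    proof -
      have "A \<subseteq> (J \<inter> W) \<union> (J - interior J) \<union> (\<Union>k. P k)"
        using A UP by (auto simp: A'_def)
      from image_mono[OF this, of \<phi>] show ?thesis
        by (simp only: image_Un image_UN)
    qed
    then have "outer (\<phi> ` A) \<le> outer (\<phi> ` (J \<inter> W) \<union> \<phi> ` (J - interior J)) + outer (\<Union>k. \<phi> ` P k)"
      by (rule order.trans[OF outer_measure_of_mono outer_measure_Un])
    also have "\<dots> = outer (\<Union>k. \<phi> ` P k)"
      using W nf by (simp add: outer_measure_negligible)
    also have "\<dots> \<le> (\<Sum>k. outer (\<phi> ` P k))"
      by (rule outer_measure_UN)
    also have "\<dots> \<le> (\<Sum>k. emeasure (density lborel (\<lambda>t. ennreal (\<sigma> t + e))) (P k))"
      by (intro suminf_le piece) auto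
    also have "\<dots> = emeasure (density lborel (\<lambda>t. ennreal (\<sigma> t + e))) (\<Union>k. P k)"
      using disj by (intro suminf_emeasure) auto
    also have "\<dots> \<le> (\<integral>\<^sup>+ t. ennreal (\<sigma> t + e) * indicator A t \<partial>lborel)"
      using A by (subst emeasure_density) (auto simp: UP A'_def intro!: nn_integral_mono split: split_indicator)
    also have "\<dots> = (\<integral>\<^sup>+ t. ennreal (\<sigma> t) * indicator A t + ennreal e * indicator A t \<partial>lborel)"
      using A \<sigma> \<open>e > 0\<close> by (intro nn_integral_cong) (auto split: split_indicator)
    also have "\<dots> = ?I A + ennreal e * emeasure lborel A"
      by (simp add: nn_integral_add nn_integral_cmult_indicator)
    finally show ?thesis .
  qed
  note * = this
  obtain M where M: "emeasure lborel A = ennreal M" "0 \<le> M"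
    using A(2) by (cases "emeasure lborel A") auto
  show ?thesis
  proof (rule ennreal_le_epsilon)
    fix e :: real assume "0 < e"
    \<comment> \<open>The denominator \<open>M + 1\<close> also covers the case
      \<open>M = 0\<close>.\<close>
    have "outer (\<phi> ` A) \<le> ?I A + ennreal (e / (M + 1)) * ennreal M"
      using *[of "e / (M + 1)"] M \<open>0 < e\<close> by simp
    also have "ennreal (e / (M + 1)) * ennreal M \<le> ennreal e"
      using M \<open>0 < e\<close> by (simp add: ennreal_mult[symmetric] field_simps)
    finally show "outer (\<phi> ` A) \<le> ?I A + ennreal e"
      by (simp add: add_left_mono)
  qed
qed

text \<open>The pieces on which the integer part of \<open>\<bar>t\<bar>\<close> equals
  \<open>k\<close> are bounded, hence of finite measure, and the right-hand side is countably
  additive.\<close>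

lemma outer_image_le_nn_integral:
  fixes \<phi> :: "real \<Rightarrow> real" and \<sigma> :: "real \<Rightarrow> real"
  assumes J: "is_interval J"
    and N: "\<And>N. N \<subseteq> J \<Longrightarrow> negligible N \<Longrightarrow> negligible (\<phi> ` N)"
    and [measurable]: "\<sigma> \<in> borel_measurable borel" and \<sigma>: "\<And>t. t \<in> J \<Longrightarrow> 0 \<le> \<sigma> t"
    and [measurable]: "W \<in> sets borel" and W: "negligible (\<phi> ` (J \<inter> W))"
    and lip: "\<And>t e. t \<in> J \<Longrightarrow> t \<notin> W \<Longrightarrow> 0 < e \<Longrightarrow>
      \<exists>d>0. \<forall>t'\<in>J. \<bar>t' - t\<bar> < d \<longrightarrow> \<bar>\<phi> t' - \<phi> t\<bar> \<le> (\<sigma> t + e) * \<bar>t' - t\<bar>"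
    and [measurable]: "A \<in> sets borel" and A: "A \<subseteq> J"
  shows "outer (\<phi> ` A) \<le> (\<integral>\<^sup>+ t. ennreal (\<sigma> t) * indicator A t \<partial>lborel)"
proof -
  define P where "P k = {t \<in> A. real k \<le> \<bar>t\<bar> \<and> \<bar>t\<bar> < real (Suc k)}" for k :: nat
  have [measurable]: "P k \<in> sets borel" for k
    by (auto simp: P_def)
  have UP: "(\<Union>k. P k) = A"
  proof (rule antisym; rule subsetI)
    fix t assume t: "t \<in> A"
    have "t \<in> P (nat \<lfloor>\<bar>t\<bar>\<rfloor>)"
      using t by (simp add: P_def) linarith
    then show "t \<in> (\<Union>k. P k)" by blast
  qed (auto simp: P_def)
  have disj: "disjoint_family P"
    by (force simp: disjoint_family_on_def P_def)
  have "emeasure lborel (P k) < \<infinity>" for k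
  proof -
    have "emeasure lborel (P k) \<le> emeasure lborel {- real (Suc k)..real (Suc k)}"
      by (rule emeasure_mono) (auto simp: P_def)
    then show ?thesis
      by (auto intro: le_less_trans)
  qed
  note piece = outer_image_le_nn_integral_bounded[OF J N _ \<sigma> _ W lip _ _ this]
  have "outer (\<phi> ` A) = outer (\<Union>k. \<phi> ` P k)"
    using UP by (simp flip: image_UN)
  also have "\<dots> \<le> (\<Sum>k. outer (\<phi> ` P k))"
    by (rule outer_measure_UN)
  also have "\<dots> \<le> (\<Sum>k. emeasure (density lborel (\<lambda>t. ennreal (\<sigma> t))) (P k))"
    using A by (intro suminf_le) (auto simp: emeasure_density P_def[THEN equalityD1] intro!: piece, auto simp: P_def)
  also have "\<dots> = emeasure (density lborel (\<lambda>t. ennreal (\<sigma> t))) A"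
    using disj by (subst suminf_emeasure) (auto simp: UP)
  finally show ?thesis
    by (simp add: emeasure_density)
qed

text \<open>For Borel \<open>C\<close> the previous estimate, applied to the preimage of
  \<open>C\<close> in \<open>J\<close>, compares Lebesgue measure on the image with the push-forward
  of \<open>\<sigma>\<close> under \<open>\<phi>\<close>. An inequality of measures passes to
  integrals of nonnegative functions. The indicator stands in front of \<open>r\<close> because
  \<open>r\<close> will be measurable only along a curve.\<close>

lemma nn_integral_image_le:
  fixes \<phi> :: "real \<Rightarrow> real" and \<sigma> :: "real \<Rightarrow> real" and r :: "real \<Rightarrow> ennreal"
  assumes J: "is_interval J" and cont: "continuous_on J \<phi>"
    and N: "\<And>N. N \<subseteq> J \<Longrightarrow> negligible N \<Longrightarrow> negligible (\<phi> ` N)"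
    and [measurable]: "\<sigma> \<in> borel_measurable borel" and \<sigma>: "\<And>t. t \<in> J \<Longrightarrow> 0 \<le> \<sigma> t"
    and [measurable]: "W \<in> sets borel" and W: "negligible (\<phi> ` (J \<inter> W))"
    and lip: "\<And>t e. t \<in> J \<Longrightarrow> t \<notin> W \<Longrightarrow> 0 < e \<Longrightarrow>
      \<exists>d>0. \<forall>t'\<in>J. \<bar>t' - t\<bar> < d \<longrightarrow> \<bar>\<phi> t' - \<phi> t\<bar> \<le> (\<sigma> t + e) * \<bar>t' - t\<bar>"
    and r: "(\<lambda>s. indicator (\<phi> ` J) s * r s) \<in> borel_measurable borel"
  shows "(\<integral>\<^sup>+ s. indicator (\<phi> ` J) s * r s \<partial>lborel) \<le> (\<integral>\<^sup>+ t. indicator J t * (ennreal (\<sigma> t) * r (\<phi> t)) \<partial>lborel)"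
proof -
  have Jb [measurable]: "J \<in> sets borel"
    using J by (rule real_interval_borel_measurable)
  have "is_interval (\<phi> ` J)"
    using J cont by (simp add: is_interval_connected_1 connected_continuous_image)
  then have I [measurable]: "\<phi> ` J \<in> sets borel"
    by (rule real_interval_borel_measurable)
  let ?r = "\<lambda>s. indicator (\<phi> ` J) s * r s"
  define M where "M = density lborel (indicator (\<phi> ` J) :: real \<Rightarrow> ennreal)"
  define L where "L = density (restrict_space lborel J) (\<lambda>t. ennreal (\<sigma> t))"
  have \<phi>: "\<phi> \<in> borel_measurable L"
    unfolding L_def using borel_measurable_continuous_on_restrict[OF cont]
    by (simp add: measurable_def space_restrict_space sets_restrict_space)
  have \<sigma>': "\<sigma> \<in> borel_measurable (restrict_space lborel J)"
    by (rule measurable_restrict_space1) simp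
  define M' where "M' = distr L borel \<phi>"
  have "M \<le> M'"
  proof (subst le_measure)
    show "sets M = sets M'"
      by (simp add: M_def M'_def)
    show "\<forall>C\<in>sets M. emeasure M C \<le> emeasure M' C"
    proof
      fix C assume "C \<in> sets M"
      then have C [measurable]: "C \<in> sets borel"
        by (simp add: M_def)
      define A where "A = \<phi> -` C \<inter> J"
      have AL: "A \<in> sets (restrict_space lborel J)"
        using measurable_sets[OF \<phi> C] by (simp add: A_def L_def space_restrict_space)
      then have A: "A \<subseteq> J" "A \<in> sets borel"
        by (auto simp: sets_restrict_space_iff)
      have "\<phi> ` A = \<phi> ` J \<inter> C"
        by (auto simp: A_def)
      then have "emeasure M C = emeasure lborel (\<phi> ` A)"
        by (simp add: M_def emeasure_density flip: indicator_inter_arith)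
      also have "\<dots> = outer (\<phi> ` A)"
        using \<open>\<phi> ` A = \<phi> ` J \<inter> C\<close> by simp
      also have "\<dots> \<le> (\<integral>\<^sup>+ t. ennreal (\<sigma> t) * indicator A t \<partial>lborel)"
        using A by (intro outer_image_le_nn_integral[OF J N _ \<sigma> _ W lip]) auto
      also have "\<dots> = (\<integral>\<^sup>+ t. ennreal (\<sigma> t) * indicator A t * indicator J t \<partial>lborel)"
        using A by (intro nn_integral_cong) (auto split: split_indicator)
      also have "\<dots> = emeasure M' C"
        using AL \<sigma>' \<phi> by (simp add: M'_def emeasure_distr L_def space_restrict_space A_def[symmetric]
            emeasure_density nn_integral_restrict_space)
      finally show "emeasure M C \<le> emeasure M' C" .
    qed
  qed
  have "(\<integral>\<^sup>+ s. ?r s \<partial>lborel) = (\<integral>\<^sup>+ s. ?r s \<partial>M)"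
    using r unfolding M_def by (subst nn_integral_density) (auto intro!: nn_integral_cong split: split_indicator)
  also have "\<dots> \<le> (\<integral>\<^sup>+ s. ?r s \<partial>M')"
    using \<open>M \<le> M'\<close> by (intro nn_integral_mono_measure) (simp_all add: M_def M'_def)
  also have "\<dots> = (\<integral>\<^sup>+ t. ?r (\<phi> t) \<partial>L)"
    using r \<phi> unfolding M'_def by (intro nn_integral_distr) auto
  also have "\<dots> = (\<integral>\<^sup>+ t. ennreal (\<sigma> t) * ?r (\<phi> t) \<partial>restrict_space lborel J)"
  proof -
    have "(\<lambda>t. ?r (\<phi> t)) \<in> borel_measurable (restrict_space lborel J)"
      using measurable_compose[OF \<phi> r] by (simp add: L_def)
    then show ?thesis
      unfolding L_def using \<sigma>' by (intro nn_integral_density) auto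
  qed
  also have "\<dots> = (\<integral>\<^sup>+ t. indicator J t * (ennreal (\<sigma> t) * r (\<phi> t)) \<partial>lborel)"
    by (subst nn_integral_restrict_space) (auto intro!: nn_integral_cong split: split_indicator)
  finally show ?thesis .
qed

section \<open>Length of curves and arc length parametrization\<close>

text \<open>The polygonal sum of \<open>curve_length\<close> in recursive form, so that list
  induction and concatenation are available; it is real-valued, which allows subtraction.\<close>

fun chain_length :: "(real \<Rightarrow> 'a::metric_space) \<Rightarrow> real list \<Rightarrow> real" where
  "chain_length v [] = 0"
| "chain_length v [x] = 0"
| "chain_length v (x # y # xs) = dist (v x) (v y) + chain_length v (y # xs)"

lemma chain_length_nonneg: "0 \<le> chain_length v xs"
  by (induction v xs rule: chain_length.induct) auto

lemma sum_dist_eq_chain_length: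
  "(\<Sum>i<length xs - 1. ennreal (dist (v (xs ! i)) (v (xs ! Suc i)))) = ennreal (chain_length v xs)"
proof (induction v xs rule: chain_length.induct)
  case (3 v x y xs)
  have "(\<Sum>i<length (x # y # xs) - 1. ennreal (dist (v ((x # y # xs) ! i)) (v ((x # y # xs) ! Suc i)))) =
      ennreal (dist (v x) (v y)) +
      (\<Sum>i<length (y # xs) - 1. ennreal (dist (v ((y # xs) ! i)) (v ((y # xs) ! Suc i))))"
    by (simp add: sum.lessThan_Suc_shift del: sum.lessThan_Suc sum_ennreal)
  then show ?case
    using 3 by (simp add: chain_length_nonneg)
qed auto

lemma curve_length_eq_SUP_chain:
  "curve_length v a b = (SUP xs\<in>{xs. sorted xs \<and> set xs \<subseteq> {a..b}}. ennreal (chain_length v xs))"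
  unfolding curve_length_def sum_dist_eq_chain_length ..

lemma chain_length_append:
  "chain_length v (xs @ x # ys) = chain_length v (xs @ [x]) + chain_length v (x # ys)"
  by (induction v xs rule: chain_length.induct) (auto simp: neq_Nil_conv)

lemma chain_length_Cons_ge: "chain_length v xs \<le> chain_length v (x # xs)"
  by (cases xs) auto

lemma chain_length_snoc_ge: "chain_length v xs \<le> chain_length v (xs @ [x])"
  by (induction v xs rule: chain_length.induct) auto

lemma chain_length_append_ge: "chain_length v xs + chain_length v ys \<le> chain_length v (xs @ ys)"
proof (cases ys)
  case (Cons y zs)
  then show ?thesis
    using chain_length_append[of v xs y zs] chain_length_snoc_ge[of v xs y] by simp
qed auto

lemma chain_length_insert_ge: "chain_length v (xs @ ys) \<le> chain_length v (xs @ x # ys)"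
proof (induction v xs rule: chain_length.induct)
  case (2 v z)
  then show ?case
    using dist_triangle[of "v z" "v (hd ys)" "v x"] by (cases ys) auto
qed (auto simp: chain_length_Cons_ge)

lemma chain_length_le_curve_length:
  "sorted xs \<Longrightarrow> set xs \<subseteq> {a..b} \<Longrightarrow> ennreal (chain_length v xs) \<le> curve_length v a b"
  unfolding curve_length_eq_SUP_chain by (rule SUP_upper) auto

text \<open>Inserting \<open>x\<close> into a polygon does not shorten it, and then it splits at
  \<open>x\<close>; conversely, polygons on the two sides of \<open>x\<close> concatenate.\<close>

lemma curve_length_add:
  assumes "a \<le> x" "x \<le> b"
  shows "curve_length v a b = curve_length v a x + curve_length v x b"
proof (rule antisym)
  show "curve_length v a b \<le> curve_length v a x + curve_length v x b"
    unfolding curve_length_eq_SUP_chain[of v a b]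
  proof (rule SUP_least; clarify)
    fix xs :: "real list" assume xs: "sorted xs" "set xs \<subseteq> {a..b}"
    let ?p = "takeWhile (\<lambda>y. y \<le> x) xs" and ?q = "dropWhile (\<lambda>y. y \<le> x) xs"
    have p: "sorted (?p @ [x])" "set (?p @ [x]) \<subseteq> {a..x}"
      using xs assms by (auto simp: sorted_append sorted_takeWhile subset_iff dest!: set_takeWhileD)
    have "\<forall>y\<in>set ?q. x \<le> y"
    proof (cases ?q)
      case (Cons z zs)
      have "\<not> z \<le> x"
        using hd_dropWhile[of "\<lambda>y. y \<le> x" xs] Cons by auto
      moreover have "sorted (z # zs)"
        using sorted_dropWhile[OF xs(1)] Cons by metis
      ultimately show ?thesis
        using Cons by auto
    next
      case Nil
      then show ?thesis
        by (simp only: list.set) simp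
    qed
    then have q: "sorted (x # ?q)" "set (x # ?q) \<subseteq> {x..b}"
      using xs assms by (auto simp: sorted_dropWhile dest: set_dropWhileD)
    have "chain_length v xs \<le> chain_length v (?p @ [x]) + chain_length v (x # ?q)"
      using chain_length_insert_ge[of v ?p ?q x] chain_length_append[of v ?p x ?q] by simp
    then have "ennreal (chain_length v xs) \<le>
        ennreal (chain_length v (?p @ [x])) + ennreal (chain_length v (x # ?q))"
      by (simp add: chain_length_nonneg ennreal_leI flip: ennreal_plus)
    also have "\<dots> \<le> curve_length v a x + curve_length v x b"
      by (intro add_mono chain_length_le_curve_length p q)
    finally show "ennreal (chain_length v xs) \<le> curve_length v a x + curve_length v x b" .
  qed
  have ne: "{xs. sorted xs \<and> set xs \<subseteq> {c..d}} \<noteq> {}" for c d :: real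
    by (auto intro!: exI[of _ "[]"])
  show "curve_length v a x + curve_length v x b \<le> curve_length v a b"
    unfolding curve_length_eq_SUP_chain[of v a x] curve_length_eq_SUP_chain[of v x b]
    \<comment> \<open>Both suprema may be pulled out of the sum, since the empty list makes the
      index sets nonempty.\<close>
    unfolding ennreal_SUP_add_left[OF ne, symmetric] unfolding ennreal_SUP_add_right[OF ne]
  proof (intro SUP_least; clarify)
    fix xs ys :: "real list"
    assume xy: "sorted xs" "set xs \<subseteq> {a..x}" "sorted ys" "set ys \<subseteq> {x..b}"
    have "ennreal (chain_length v xs) + ennreal (chain_length v ys) \<le> ennreal (chain_length v (xs @ ys))"
      by (simp add: chain_length_nonneg chain_length_append_ge ennreal_leI flip: ennreal_plus)
    also have "\<dots> \<le> curve_length v a b"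
      using xy assms
      by (intro chain_length_le_curve_length) (auto simp: sorted_append subset_iff intro: order.trans[of _ x])
    finally show "ennreal (chain_length v xs) + ennreal (chain_length v ys) \<le> curve_length v a b" .
  qed
qed

lemma dist_le_curve_length:
  assumes "a \<le> b"
  shows "ennreal (dist (v a) (v b)) \<le> curve_length v a b"
  using chain_length_le_curve_length[of "[a, b]" a b v] assms by simp

text \<open>Adding the endpoints does not shorten a polygon; the resulting partition covers all of
  \<open>{a..b}\<close>, which the cell-by-cell inductions below require.\<close>

lemma curve_length_approx:
  assumes "a \<le> b" "curve_length v a b = ennreal l" "0 \<le> l" "0 < e"
  obtains xs where "sorted (a # xs @ [b])" "l - e < chain_length v (a # xs @ [b])"
proof -
  have "\<exists>xs\<in>{xs. sorted xs \<and> set xs \<subseteq> {a..b}}. l - e < chain_length v xs"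
  proof (rule ccontr)
    assume no: "\<not> (\<exists>xs\<in>{xs. sorted xs \<and> set xs \<subseteq> {a..b}}. l - e < chain_length v xs)"
    then have "ennreal l \<le> ennreal (l - e)"
      unfolding assms(2)[symmetric] curve_length_eq_SUP_chain
      by (intro SUP_least) (auto intro!: ennreal_leI simp: not_less)
    \<comment> \<open>The empty polygon has length 0, so failure forces \<open>l - e\<close> to be
      nonnegative and the comparison in \<open>ennreal\<close> is a real one.\<close>
    moreover have "0 \<le> l - e"
      using no by (metis (mono_tags) chain_length.simps(1) empty_subsetI list.set(1) mem_Collect_eq not_le sorted_wrt.simps(1))
    ultimately show False
      using assms by (simp add: ennreal_le_iff)
  qed
  then obtain xs where xs: "sorted xs" "set xs \<subseteq> {a..b}" "l - e < chain_length v xs"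
    by auto
  have "chain_length v xs \<le> chain_length v (xs @ [b])"
    by (rule chain_length_snoc_ge)
  also have "\<dots> \<le> chain_length v (a # xs @ [b])"
    by (rule chain_length_Cons_ge)
  finally have "l - e < chain_length v (a # xs @ [b])"
    using xs by simp
  moreover have "sorted (a # xs @ [b])"
    using xs \<open>a \<le> b\<close> by (auto simp: sorted_append)
  ultimately show ?thesis
    by (rule that[rotated])
qed

text \<open>On \<open>Z\<close> arbitrarily short chords are shorter than the parameter interval by a fixed factor. The
  function \<open>s - dist (v a) (v s)\<close> is monotone and its increments dominate these deficits, so disjoint
  intervals with a deficit have total length at most \<open>1 / c\<close> times its total increment.\<close>

lemma outer_deficit_set_cell:
  fixes v :: "real \<Rightarrow> 'a::metric_space"
  assumes "a \<le> b" "0 < c"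
    and lip: "\<And>s t. s \<in> {a..b} \<Longrightarrow> t \<in> {a..b} \<Longrightarrow> dist (v s) (v t) \<le> \<bar>s - t\<bar>"
    and Z: "\<And>s d. s \<in> Z \<Longrightarrow> 0 < d \<Longrightarrow> \<exists>t. \<bar>t - s\<bar> < d \<and> t \<noteq> s \<and> c * \<bar>t - s\<bar> \<le> \<bar>t - s\<bar> - dist (v t) (v s)"
  shows "outer (Z \<inter> {a..b}) \<le> ennreal ((b - a - dist (v a) (v b)) / c)"
proof -
  define w where "w s = s - dist (v a) (v s)" for s
  have w: "(t - s) - dist (v s) (v t) \<le> w t - w s" if "s \<le> t" "s \<in> {a..b}" "t \<in> {a..b}" for s t
    using dist_triangle[of "v a" "v t" "v s"] by (simp add: w_def)
  have mono: "w s \<le> w t" if "s \<le> t" "s \<in> {a..b}" "t \<in> {a..b}" for s t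
    using w[OF that] lip[OF that(2,3)] that(1) by linarith
  define Q where "Q = {(s, t). a < s \<and> s < t \<and> t < b \<and> c * (t - s) \<le> w t - w s}"
  have less: "s < t" if "(s, t) \<in> Q" for s t
    using that by (auto simp: Q_def)
  have fine: "\<exists>(s, t)\<in>Q. x \<in> {s..t} \<and> t - s < d" if "x \<in> Z \<inter> {a<..<b}" "0 < d" for x d
  proof -
    obtain t where t: "\<bar>t - x\<bar> < min d (min (x - a) (b - x))" "t \<noteq> x" "c * \<bar>t - x\<bar> \<le> \<bar>t - x\<bar> - dist (v t) (v x)"
      using Z[of x "min d (min (x - a) (b - x))"] \<open>x \<in> Z \<inter> {a<..<b}\<close> \<open>0 < d\<close> by auto
    show ?thesis
    proof (cases "x < t")
      case True
      then show ?thesis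
        using t w[of x t] \<open>x \<in> Z \<inter> {a<..<b}\<close>
        by (intro bexI[of _ "(x, t)"]) (auto simp: Q_def dist_commute abs_if)
    next
      case False
      then show ?thesis
        using t w[of t x] \<open>x \<in> Z \<inter> {a<..<b}\<close>
        by (intro bexI[of _ "(t, x)"]) (auto simp: Q_def abs_if split: if_splits)
    qed
  qed
  obtain C where C: "countable C" "C \<subseteq> Q" "disjoint_family_on (\<lambda>(a, b). {a..b}) C"
      "negligible (Z \<inter> {a<..<b} - (\<Union>(a, b)\<in>C. {a..b}))"
    using Vitali_intervals[OF less fine] by blast
  have "Z \<inter> {a..b} \<subseteq> ({a, b} \<union> (Z \<inter> {a<..<b} - (\<Union>(a, b)\<in>C. {a..b}))) \<union> (\<Union>p\<in>C. {fst p..snd p})"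
  proof
    fix x assume "x \<in> Z \<inter> {a..b}"
    then show "x \<in> ({a, b} \<union> (Z \<inter> {a<..<b} - (\<Union>(a, b)\<in>C. {a..b}))) \<union> (\<Union>p\<in>C. {fst p..snd p})"
      unfolding case_prod_beta by (cases "x = a \<or> x = b") auto
  qed
  then have "outer (Z \<inter> {a..b}) \<le>
      outer ({a, b} \<union> (Z \<inter> {a<..<b} - (\<Union>(a, b)\<in>C. {a..b}))) + outer (\<Union>p\<in>C. {fst p..snd p})"
    by (rule order.trans[OF outer_measure_of_mono outer_measure_Un])
  also have "outer ({a, b} \<union> (Z \<inter> {a<..<b} - (\<Union>(a, b)\<in>C. {a..b}))) = 0"
    by (intro outer_measure_negligible negligible_Un C) auto
  also have "outer (\<Union>p\<in>C. {fst p..snd p}) \<le> (\<integral>\<^sup>+ p. outer {fst p..snd p} \<partial>count_space C)"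
    by (rule outer_measure_UN_countable[OF C(1)])
  \<comment> \<open>Half-open image intervals stay disjoint even when \<open>w\<close> is constant
    between two chosen intervals and their image endpoints coincide.\<close>
  also have "\<dots> \<le> (\<integral>\<^sup>+ p. ennreal (1 / c) * emeasure lebesgue {w (fst p)..<w (snd p)} \<partial>count_space C)"
  proof (intro nn_integral_mono)
    fix p assume "p \<in> space (count_space C)"
    then have p: "fst p < snd p" "c * (snd p - fst p) \<le> w (snd p) - w (fst p)"
      using C(2) by (auto simp: Q_def)
    have "0 \<le> c * (snd p - fst p)"
      using p \<open>0 < c\<close> by simp
    with p have "w (fst p) \<le> w (snd p)"
      by linarith
    with p \<open>0 < c\<close> show "outer {fst p..snd p} \<le> ennreal (1 / c) * emeasure lebesgue {w (fst p)..<w (snd p)}"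
      by (simp add: ennreal_mult[symmetric] field_simps)
  qed
  also have "\<dots> = ennreal (1 / c) * (\<integral>\<^sup>+ p. emeasure lebesgue {w (fst p)..<w (snd p)} \<partial>count_space C)"
    by (intro nn_integral_cmult) auto
  also have "\<dots> \<le> ennreal (1 / c) * ennreal (b - a - dist (v a) (v b))"
  proof (rule mult_left_mono)
    have "(\<integral>\<^sup>+ p. emeasure lebesgue {w (fst p)..<w (snd p)} \<partial>count_space C) =
      emeasure lebesgue (\<Union>p\<in>C. {w (fst p)..<w (snd p)})"
    proof (intro emeasure_UN_countable[symmetric] C)
      show "disjoint_family_on (\<lambda>p. {w (fst p)..<w (snd p)}) C"
      proof -
        have "{w (fst p)..<w (snd p)} \<inter> {w (fst q)..<w (snd q)} = {}" if pq: "p \<in> C" "q \<in> C" "p \<noteq> q" for p q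
        proof -
          have "{fst p..snd p} \<inter> {fst q..snd q} = {}"
            using C(3) pq by (auto simp: disjoint_family_on_def case_prod_beta)
          then have disj: "max (fst p) (fst q) \<notin> {fst p..snd p} \<inter> {fst q..snd q}"
            by simp
          have "fst p < snd p" "fst q < snd q" "a < fst p" "snd p < b" "a < fst q" "snd q < b"
            using pq C(2) by (auto simp: Q_def)
          with disj have "snd p < fst q \<or> snd q < fst p"
            by (auto simp: max_def split: if_splits)
          then have "w (snd p) \<le> w (fst q) \<or> w (snd q) \<le> w (fst p)"
            using \<open>fst p < snd p\<close> \<open>fst q < snd q\<close> \<open>a < fst p\<close> \<open>snd p < b\<close> \<open>a < fst q\<close> \<open>snd q < b\<close>
            using mono[of "snd p" "fst q"] mono[of "snd q" "fst p"] by auto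
          then show ?thesis by auto
        qed
        then show ?thesis
          by (auto simp: disjoint_family_on_def)
      qed
    qed auto
    also have "\<dots> \<le> emeasure lebesgue {w a..w b}"
    proof (rule emeasure_mono)
      show "(\<Union>p\<in>C. {w (fst p)..<w (snd p)}) \<subseteq> {w a..w b}"
      proof
        fix y assume "y \<in> (\<Union>p\<in>C. {w (fst p)..<w (snd p)})"
        then obtain s t where "(s, t) \<in> Q" "y \<in> {w s..<w t}"
          using C(2) by force
        then show "y \<in> {w a..w b}"
          using mono[of a s] mono[of t b] by (auto simp: Q_def)
      qed
    qed simp
    also have "emeasure lebesgue {w a..w b} = ennreal (b - a - dist (v a) (v b))"
      using mono[of a b] \<open>a \<le> b\<close> by (simp add: w_def algebra_simps)
    finally show "(\<integral>\<^sup>+ p. emeasure lebesgue {w (fst p)..<w (snd p)} \<partial>count_space C) \<le> ennreal (b - a - dist (v a) (v b))" .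
  qed simp
  finally show ?thesis
    using \<open>0 < c\<close> lip[of a b] \<open>a \<le> b\<close> by (simp add: ennreal_mult'[symmetric])
qed

text \<open>The deficits of the cells add up to the excess of the parameter length over the polygon
  length. The second conjunct keeps every deficit nonnegative, so that sums in
  \<open>ennreal\<close> agree with real sums.\<close>

lemma outer_deficit_set:
  fixes v :: "real \<Rightarrow> 'a::metric_space"
  assumes "sorted (a # xs @ [b])" "0 < c"
    and lip: "\<And>s t. s \<in> {a..b} \<Longrightarrow> t \<in> {a..b} \<Longrightarrow> dist (v s) (v t) \<le> \<bar>s - t\<bar>"
    and Z: "\<And>s d. s \<in> Z \<Longrightarrow> 0 < d \<Longrightarrow> \<exists>t. \<bar>t - s\<bar> < d \<and> t \<noteq> s \<and> c * \<bar>t - s\<bar> \<le> \<bar>t - s\<bar> - dist (v t) (v s)"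
  shows "outer (Z \<inter> {a..b}) \<le> ennreal ((b - a - chain_length v (a # xs @ [b])) / c) \<and>
    chain_length v (a # xs @ [b]) \<le> b - a"
  using assms(1) lip
proof (induction xs arbitrary: a)
  case Nil
  then show ?case
    using outer_deficit_set_cell[of a b c v Z] \<open>0 < c\<close> Z Nil(2)[of a b] by simp
next
  case (Cons x xs)
  then have ax: "a \<le> x" "x \<le> b" "sorted (x # xs @ [b])"
    by (auto simp: sorted_append)
  have IH: "outer (Z \<inter> {x..b}) \<le> ennreal ((b - x - chain_length v (x # xs @ [b])) / c)"
      "chain_length v (x # xs @ [b]) \<le> b - x"
    using Cons.IH[OF ax(3)] Cons.prems(2) ax by auto
  have cell: "outer (Z \<inter> {a..x}) \<le> ennreal ((x - a - dist (v a) (v x)) / c)"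
    using ax Cons.prems(2) by (intro outer_deficit_set_cell \<open>0 < c\<close> Z) auto
  have d: "dist (v a) (v x) \<le> x - a"
    using Cons.prems(2)[of a x] ax by auto
  have "outer (Z \<inter> {a..b}) \<le> outer ((Z \<inter> {a..x}) \<union> (Z \<inter> {x..b}))"
    using ax by (intro outer_measure_of_mono) auto
  also have "\<dots> \<le> outer (Z \<inter> {a..x}) + outer (Z \<inter> {x..b})"
    by (rule outer_measure_Un)
  also have "\<dots> \<le> ennreal ((x - a - dist (v a) (v x)) / c) + ennreal ((b - x - chain_length v (x # xs @ [b])) / c)"
    by (intro add_mono cell IH)
  also have "\<dots> = ennreal ((b - a - chain_length v (a # (x # xs) @ [b])) / c)"
  proof -
    have "ennreal ((x - a - dist (v a) (v x)) / c) + ennreal ((b - x - chain_length v (x # xs @ [b])) / c) =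
        ennreal ((x - a - dist (v a) (v x)) / c + (b - x - chain_length v (x # xs @ [b])) / c)"
      using d IH(2) \<open>0 < c\<close> by (intro ennreal_plus[symmetric]) auto
    then show ?thesis
      by (simp add: add_divide_distrib[symmetric] algebra_simps)
  qed
  finally show ?case
    using d IH(2) by simp
qed


lemma negligible_borel_hull:
  assumes "negligible (N :: 'a::euclidean_space set)"
  obtains N' where "N \<subseteq> N'" "N' \<in> sets borel" "negligible N'"
proof -
  obtain N' where "N' \<in> null_sets lborel" "N \<subseteq> N'"
    using assms by (auto simp: negligible_iff_null_sets null_sets_completion_iff2)
  then show ?thesis
    by (intro that[of N']) (auto simp: negligible_iff_null_sets null_sets_completionI)
qed

text \<open>\<open>Z c\<close> collects the points at which arbitrarily short chords fall short by
  the fraction \<open>c\<close>. A polygon whose length is within \<open>c * e\<close> of the full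
  length bounds the outer measure of \<open>Z c\<close> by \<open>e\<close>, for every
  \<open>e\<close>, so \<open>Z c\<close> is null; a sequence of values of \<open>c\<close> tending
  to 0 suffices.\<close>

lemma unit_speed_almost_everywhere:
  fixes v :: "real \<Rightarrow> 'a::metric_space"
  assumes I: "is_interval I"
    and speed: "\<And>a b. a \<in> I \<Longrightarrow> b \<in> I \<Longrightarrow> a \<le> b \<Longrightarrow> curve_length v a b = ennreal (b - a)"
  obtains Z where "Z \<in> sets borel" "negligible Z"
    "\<And>s e. s \<in> I \<Longrightarrow> s \<notin> Z \<Longrightarrow> 0 < e \<Longrightarrow>
      \<exists>d>0. \<forall>t\<in>I. \<bar>t - s\<bar> < d \<longrightarrow> \<bar>t - s\<bar> \<le> (1 + e) * dist (v t) (v s)"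
proof -
  define Z where "Z c = {s \<in> I. \<forall>d>0. \<exists>t\<in>I. \<bar>t - s\<bar> < d \<and> t \<noteq> s \<and> c * \<bar>t - s\<bar> \<le> \<bar>t - s\<bar> - dist (v t) (v s)}"
    for c
  have lip: "dist (v s) (v t) \<le> \<bar>s - t\<bar>" if "s \<in> I" "t \<in> I" for s t
  proof -
    have "dist (v s) (v t) \<le> t - s" if "s \<in> I" "t \<in> I" "s \<le> t" for s t
      using dist_le_curve_length[OF that(3), of v] speed[OF that] that by simp
    from this[of s t] this[of t s] that show ?thesis
      by (cases "s \<le> t") (auto simp: dist_commute)
  qed
  have sub: "{a..b} \<subseteq> I" if "a \<in> I" "b \<in> I" for a b
    using I that unfolding is_interval_1 by (meson atLeastAtMost_iff subsetI)
  have cell: "negligible (Z c \<inter> {a..b})" if "0 < c" "a \<in> I" "b \<in> I" "a \<le> b" for a b c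
  proof (rule outer_measure_zero_negligible)
    have "outer (Z c \<inter> {a..b}) \<le> 0"
    proof (rule ennreal_le_epsilon)
      fix e :: real assume "0 < e"
      have "0 < c * e" "0 \<le> b - a"
        using that \<open>0 < e\<close> by auto
      from curve_length_approx[OF that(4) speed[OF that(2-4)] this(2,1)]
      obtain xs where xs: "sorted (a # xs @ [b])" "b - a - c * e < chain_length v (a # xs @ [b])"
        by blast
      have "outer (Z c \<inter> {a..b}) \<le> ennreal ((b - a - chain_length v (a # xs @ [b])) / c)"
        using sub[OF that(2,3)] that xs
        by (intro outer_deficit_set[THEN conjunct1] lip) (auto simp: Z_def)
      also have "\<dots> \<le> ennreal e"
        using xs \<open>0 < c\<close> by (intro ennreal_leI) (simp add: divide_le_eq mult.commute)
      finally show "outer (Z c \<inter> {a..b}) \<le> 0 + ennreal e"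
        by simp
    qed
    then show "outer (Z c \<inter> {a..b}) = 0"
      by simp
  qed
  have Zc: "negligible (Z c)" if "0 < c" for c
  proof -
    \<comment> \<open>Rational endpoints: countably many compact subintervals of \<open>I\<close>
      cover its interior.\<close>
    let ?R = "{(a, b) \<in> \<rat> \<times> \<rat>. a \<in> I \<and> b \<in> I \<and> a \<le> b}"
    have "countable ?R"
      by (rule countable_subset[of _ "\<rat> \<times> \<rat>"]) (auto intro: countable_rat)
    then have "negligible (\<Union>p\<in>?R. Z c \<inter> {fst p..snd p})"
      using cell[OF \<open>0 < c\<close>] by (intro negligible_countable_Union) auto
    moreover have "Z c \<subseteq> (I - interior I) \<union> (\<Union>p\<in>?R. Z c \<inter> {fst p..snd p})"
    proof
      fix s assume s: "s \<in> Z c"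
      show "s \<in> (I - interior I) \<union> (\<Union>p\<in>?R. Z c \<inter> {fst p..snd p})"
      proof (cases "s \<in> interior I")
        case True
        then obtain d where d: "d > 0" "ball s d \<subseteq> I"
          by (meson mem_interior)
        obtain a b where "a \<in> \<rat>" "s - d < a" "a < s" "b \<in> \<rat>" "s < b" "b < s + d"
          using Rats_dense_in_real[of "s - d" s] Rats_dense_in_real[of s "s + d"] d by auto
        moreover from this have "a \<in> ball s d" "b \<in> ball s d"
          by (auto simp: dist_real_def)
        ultimately have "(a, b) \<in> ?R" "s \<in> Z c \<inter> {fst (a, b)..snd (a, b)}"
          using d s by auto
        then show ?thesis by blast
      qed (use s in \<open>auto simp: Z_def\<close>)
    qed
    ultimately show ?thesis
      using is_interval_boundary_negligible[OF I] negligible_Un negligible_subset by blast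
  qed
  have "negligible (\<Union>n::nat. Z (1 / real (Suc n)))"
    by (intro negligible_Union_nat Zc) auto
  then obtain Z' where Z': "(\<Union>n::nat. Z (1 / real (Suc n))) \<subseteq> Z'" "Z' \<in> sets borel" "negligible Z'"
    by (rule negligible_borel_hull)
  show ?thesis
  proof (rule that[OF Z'(2,3)])
    fix s e :: real assume s: "s \<in> I" "s \<notin> Z'" and "0 < e"
    \<comment> \<open>If the deficit is at most the fraction \<open>e / (1 + e)\<close>, the chord
      is at least \<open>\<bar>t - s\<bar> / (1 + e)\<close>.\<close>
    obtain n where n: "1 / real (Suc n) < e / (1 + e)"
      using nat_approx_posE[of "e / (1 + e)"] \<open>0 < e\<close> by auto
    let ?c = "1 / real (Suc n)"
    have "s \<notin> Z ?c"
      using Z' s by auto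
    then obtain d where d: "d > 0" "\<And>t. t \<in> I \<Longrightarrow> \<bar>t - s\<bar> < d \<Longrightarrow> t \<noteq> s \<Longrightarrow> \<bar>t - s\<bar> - dist (v t) (v s) < ?c * \<bar>t - s\<bar>"
      using s by (auto simp: Z_def not_le)
    show "\<exists>d>0. \<forall>t\<in>I. \<bar>t - s\<bar> < d \<longrightarrow> \<bar>t - s\<bar> \<le> (1 + e) * dist (v t) (v s)"
    proof (intro exI[of _ d] conjI ballI impI)
      fix t assume t: "t \<in> I" "\<bar>t - s\<bar> < d"
      show "\<bar>t - s\<bar> \<le> (1 + e) * dist (v t) (v s)"
      proof (cases "t = s")
        case False
        have "?c * \<bar>t - s\<bar> \<le> e / (1 + e) * \<bar>t - s\<bar>"
          using n by (intro mult_right_mono) auto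
        then have "\<bar>t - s\<bar> - dist (v t) (v s) \<le> e / (1 + e) * \<bar>t - s\<bar>"
          using d(2)[OF t False] by simp
        then show ?thesis
          using \<open>0 < e\<close> by (simp add: field_simps)
      qed simp
    qed (rule d)
  qed
qed

section \<open>Continuity of the length function\<close>

lemma curve_length_finite_subset:
  assumes "curve_length \<gamma> a b < \<infinity>" "a \<le> s" "s \<le> t" "t \<le> b"
  shows "curve_length \<gamma> s t < \<infinity>"
proof -
  have "curve_length \<gamma> a b = curve_length \<gamma> a s + (curve_length \<gamma> s t + curve_length \<gamma> t b)"
    using assms by (simp add: curve_length_add[of a s b] curve_length_add[of s t b])
  with assms(1) show ?thesis
    by (auto simp: top_unique less_top)
qed

text \<open>On each cell the length is approximated by the distance to the left endpoint of the
  cell, with the chords of the earlier cells added. The error never exceeds the total length minus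
  the polygon length.\<close>

lemma continuous_on_length_from_approx:
  fixes \<gamma> :: "real \<Rightarrow> 'a::metric_space"
  assumes "sorted (a # xs @ [b])" "curve_length \<gamma> a b < \<infinity>" "continuous_on {a..b} \<gamma>"
  shows "\<exists>\<phi>. continuous_on {a..b} \<phi> \<and> \<phi> a = 0 \<and> (\<forall>s\<in>{a..b}. \<bar>enn2real (curve_length \<gamma> a s) - \<phi> s\<bar> \<le>
      enn2real (curve_length \<gamma> a b) - chain_length \<gamma> (a # xs @ [b]))"
  using assms
proof (induction xs arbitrary: a)
  let ?l = "\<lambda>s t. enn2real (curve_length \<gamma> s t)"
  \<comment> \<open>The excess of arc length over the chord from \<open>a\<close> is nonnegative
    and, by the triangle inequality, largest at the right end.\<close>
  have cell: "0 \<le> ?l a s - dist (\<gamma> a) (\<gamma> s) \<and> ?l a s - dist (\<gamma> a) (\<gamma> s) \<le> ?l a x - dist (\<gamma> a) (\<gamma> x)"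
    if fin: "curve_length \<gamma> a x < \<infinity>" and s: "s \<in> {a..x}" for a s x
  proof -
    have f: "curve_length \<gamma> a s < \<infinity>" "curve_length \<gamma> s x < \<infinity>"
      using s by (auto intro!: curve_length_finite_subset[OF fin] simp del: infinity_ennreal_def)
    have "?l a x = ?l a s + ?l s x"
      using s f by (simp add: curve_length_add[of a s x] enn2real_plus)
    moreover have "dist (\<gamma> p) (\<gamma> q) \<le> ?l p q" if "p \<le> q" "curve_length \<gamma> p q < \<infinity>" for p q
      using enn2real_mono[OF dist_le_curve_length[OF that(1)], of \<gamma>] that(2) by simp
    ultimately show ?thesis
      using s f dist_triangle[of "\<gamma> a" "\<gamma> x" "\<gamma> s"] by fastforce
  qed
  {
    case Nil
    then have "continuous_on {a..b} (\<lambda>s. dist (\<gamma> a) (\<gamma> s))"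
      by (intro continuous_intros)
    then show ?case
      using cell[OF Nil(2)] by (intro exI[of _ "\<lambda>s. dist (\<gamma> a) (\<gamma> s)"]) auto
  next
    case (Cons x xs)
    have ax: "a \<le> x" "x \<le> b" "sorted (x # xs @ [b])"
      using Cons.prems by auto
    note fin = curve_length_finite_subset[OF Cons.prems(2)]
    have cx: "continuous_on {x..b} \<gamma>" "continuous_on {a..x} \<gamma>"
      using ax by (auto intro: continuous_on_subset[OF Cons.prems(3)])
    obtain \<psi> where \<psi>: "continuous_on {x..b} \<psi>" "\<psi> x = 0"
      "\<And>s. s \<in> {x..b} \<Longrightarrow> \<bar>?l x s - \<psi> s\<bar> \<le> ?l x b - chain_length \<gamma> (x # xs @ [b])"
      using Cons.IH[OF ax(3) _ cx(1)] fin[of x b] ax by auto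
    define \<phi> where "\<phi> s = (if s \<le> x then dist (\<gamma> a) (\<gamma> s) else dist (\<gamma> a) (\<gamma> x) + \<psi> s)" for s
    have "continuous_on ({a..x} \<union> {x..b}) \<phi>"
      unfolding \<phi>_def using \<psi>(2) cx
      by (intro continuous_on_cases continuous_intros \<psi>(1)) auto
    moreover have "{a..x} \<union> {x..b} = {a..b}"
      using ax by auto
    moreover have add: "?l a t = ?l a x + ?l x t" if "x \<le> t" "t \<le> b" for t
      using that ax fin[of a x] fin[of x t] by (simp add: curve_length_add[of a x t] enn2real_plus)
    have "\<bar>?l a s - \<phi> s\<bar> \<le> ?l a b - chain_length \<gamma> (a # (x # xs) @ [b])" if s: "s \<in> {a..b}" for s
    proof (cases "s \<le> x")
      case True
      then show ?thesis
        using cell[of a x s] fin[of a x] add[of b] ax s \<psi>(3)[of x] by (auto simp: \<phi>_def)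
    next
      case False
      then show ?thesis
        using cell[of a x x] fin[of a x] add[of b] add[of s] ax s \<psi>(3)[of s] by (auto simp: \<phi>_def)
    qed
    ultimately show ?case
      using ax by (intro exI[of _ \<phi>]) (auto simp: \<phi>_def)
  }
qed

text \<open>Polygons with length tending to \<open>curve_length \<gamma> a b\<close> make the
  continuous approximations of the previous lemma converge uniformly.\<close>

lemma continuous_on_length_from:
  fixes \<gamma> :: "real \<Rightarrow> 'a::metric_space"
  assumes "a \<le> b" and fin: "curve_length \<gamma> a b < \<infinity>" and cont: "continuous_on {a..b} \<gamma>"
  shows "continuous_on {a..b} (\<lambda>s. enn2real (curve_length \<gamma> a s))"
proof -
  have "\<exists>\<phi>. continuous_on {a..b} \<phi> \<and> (\<forall>s\<in>{a..b}. \<bar>enn2real (curve_length \<gamma> a s) - \<phi> s\<bar> < 1 / real (Suc n))" for n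
  proof -
    have "curve_length \<gamma> a b = ennreal (enn2real (curve_length \<gamma> a b))"
      using fin by simp
    from curve_length_approx[OF \<open>a \<le> b\<close> this, of "1 / real (Suc n)"]
    obtain xs where xs: "sorted (a # xs @ [b])"
      "enn2real (curve_length \<gamma> a b) - 1 / real (Suc n) < chain_length \<gamma> (a # xs @ [b])"
      by auto
    from continuous_on_length_from_approx[OF xs(1) fin cont] xs(2) show ?thesis
      by (smt (verit))
  qed
  then obtain \<phi> where \<phi>: "\<And>n. continuous_on {a..b} (\<phi> n)"
    "\<And>n s. s \<in> {a..b} \<Longrightarrow> \<bar>enn2real (curve_length \<gamma> a s) - \<phi> n s\<bar> < 1 / real (Suc n)"
    by metis
  have "uniform_limit {a..b} \<phi> (\<lambda>s. enn2real (curve_length \<gamma> a s)) sequentially"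
  proof (rule uniform_limitI)
    fix e :: real assume "0 < e"
    then have "\<forall>\<^sub>F n in sequentially. 1 / real (Suc n) < e"
      by (rule order_tendstoD[OF LIMSEQ_Suc[OF lim_1_over_n]])
    then show "\<forall>\<^sub>F n in sequentially. \<forall>s\<in>{a..b}. dist (\<phi> n s) (enn2real (curve_length \<gamma> a s)) < e"
    proof eventually_elim
      case (elim n)
      then show ?case
        using \<phi>(2)[of _ n] by (force simp: dist_real_def abs_minus_commute)
    qed
  qed
  then show ?thesis
    by (rule uniform_limit_theorem[rotated]) (auto simp: \<phi>)
qed

section \<open>Line integrals along a curve and along its image\<close>

text \<open>The hypothesis bounds chords of \<open>v\<close> after \<open>\<phi>\<close>, not
  increments of \<open>\<phi>\<close>. Outside the null set \<open>Z\<close> of points without unit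
  speed the two are comparable. The preimage of \<open>Z\<close> may be large, but its image lies in
  \<open>Z\<close>, and a null image is all that is asked of the exceptional set, so it is joined to
  \<open>W\<close>.\<close>

lemma nn_integral_image_le_of_unit_speed:
  fixes \<phi> \<sigma> :: "real \<Rightarrow> real" and v :: "real \<Rightarrow> 'a::metric_space" and r :: "real \<Rightarrow> ennreal"
  assumes J: "is_interval J" and cont: "continuous_on J \<phi>"
    and N: "\<And>N. N \<subseteq> J \<Longrightarrow> negligible N \<Longrightarrow> negligible (\<phi> ` N)"
    and \<sigma>m: "\<sigma> \<in> borel_measurable borel" and \<sigma>: "\<And>t. t \<in> J \<Longrightarrow> 0 \<le> \<sigma> t"
    and W: "W \<in> sets borel" "negligible (\<phi> ` (J \<inter> W))"
    and speed: "\<And>a b. a \<in> \<phi> ` J \<Longrightarrow> b \<in> \<phi> ` J \<Longrightarrow> a \<le> b \<Longrightarrow> curve_length v a b = ennreal (b - a)"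
    and lip: "\<And>t e. t \<in> J \<Longrightarrow> t \<notin> W \<Longrightarrow> 0 < e \<Longrightarrow>
      \<exists>d>0. \<forall>t'\<in>J. \<bar>t' - t\<bar> < d \<longrightarrow> dist (v (\<phi> t')) (v (\<phi> t)) \<le> (\<sigma> t + e) * \<bar>t' - t\<bar>"
    and r: "(\<lambda>s. indicator (\<phi> ` J) s * r s) \<in> borel_measurable borel"
  shows "(\<integral>\<^sup>+ s. indicator (\<phi> ` J) s * r s \<partial>lborel) \<le> (\<integral>\<^sup>+ t. indicator J t * (ennreal (\<sigma> t) * r (\<phi> t)) \<partial>lborel)"
proof -
  have "is_interval (\<phi> ` J)"
    using J cont by (simp add: is_interval_connected_1 connected_continuous_image)
  from unit_speed_almost_everywhere[OF this speed]
  obtain Z where Z: "Z \<in> sets borel" "negligible Z"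
    "\<And>s e. s \<in> \<phi> ` J \<Longrightarrow> s \<notin> Z \<Longrightarrow> 0 < e \<Longrightarrow>
      \<exists>d>0. \<forall>t\<in>\<phi> ` J. \<bar>t - s\<bar> < d \<longrightarrow> \<bar>t - s\<bar> \<le> (1 + e) * dist (v t) (v s)"
    by blast
  have "\<phi> \<in> borel_measurable (restrict_space borel J)"
    by (rule borel_measurable_continuous_on_restrict[OF cont])
  from measurable_sets[OF this Z(1)] have "\<phi> -` Z \<inter> J \<in> sets (restrict_space borel J)"
    by (simp add: space_restrict_space)
  then have "\<phi> -` Z \<inter> J \<in> sets borel"
    using real_interval_borel_measurable[OF J] by (simp add: sets_restrict_space_iff)
  with W(1) have W': "W \<union> (\<phi> -` Z \<inter> J) \<in> sets borel"
    by auto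
  have "\<phi> ` (J \<inter> (W \<union> (\<phi> -` Z \<inter> J))) \<subseteq> \<phi> ` (J \<inter> W) \<union> Z"
    by auto
  then have nW': "negligible (\<phi> ` (J \<inter> (W \<union> (\<phi> -` Z \<inter> J))))"
    using W(2) Z(2) negligible_Un negligible_subset by metis
  show ?thesis
  proof (rule nn_integral_image_le[OF J cont N \<sigma>m \<sigma> W' nW' _ r])
    fix t e :: real assume t: "t \<in> J" "t \<notin> W \<union> (\<phi> -` Z \<inter> J)" and "0 < e"
    \<comment> \<open>Chosen so that \<open>(1 + e1) * (\<sigma> t + e1)\<close> is at most
      \<open>\<sigma> t + e\<close>; the cap at 1 controls the quadratic term in
      \<open>e1\<close>.\<close>
    define e1 where "e1 = min 1 (e / (\<sigma> t + 2))"
    have st: "0 \<le> \<sigma> t"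
      by (rule \<sigma>[OF t(1)])
    have e1: "0 < e1" "e1 \<le> 1"
      using \<open>0 < e\<close> st by (auto simp: e1_def)
    have "e1 * (\<sigma> t + 2) \<le> e / (\<sigma> t + 2) * (\<sigma> t + 2)"
      using st by (intro mult_right_mono) (auto simp: e1_def)
    with st have e1': "e1 * (\<sigma> t + 2) \<le> e"
      by simp
    have bound: "(1 + e1) * (\<sigma> t + e1) \<le> \<sigma> t + e"
    proof -
      have "(1 + e1) * (\<sigma> t + e1) = \<sigma> t + e1 * (\<sigma> t + 1 + e1)"
        by (simp add: algebra_simps)
      also have "e1 * (\<sigma> t + 1 + e1) \<le> e1 * (\<sigma> t + 2)"
        using e1 by (intro mult_left_mono) auto
      finally show ?thesis
        using e1' by simp
    qed
    obtain d1 where d1: "d1 > 0" "\<And>t'. t' \<in> J \<Longrightarrow> \<bar>t' - t\<bar> < d1 \<Longrightarrow>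
        dist (v (\<phi> t')) (v (\<phi> t)) \<le> (\<sigma> t + e1) * \<bar>t' - t\<bar>"
      using lip[OF t(1) _ e1(1)] t(2) by auto
    obtain d2 where d2: "d2 > 0" "\<And>s. s \<in> \<phi> ` J \<Longrightarrow> \<bar>s - \<phi> t\<bar> < d2 \<Longrightarrow>
        \<bar>s - \<phi> t\<bar> \<le> (1 + e1) * dist (v s) (v (\<phi> t))"
      using Z(3)[of "\<phi> t" e1] t e1 by auto
    obtain d3 where d3: "d3 > 0" "\<And>t'. t' \<in> J \<Longrightarrow> \<bar>t' - t\<bar> < d3 \<Longrightarrow> \<bar>\<phi> t' - \<phi> t\<bar> < d2"
      using cont t(1) d2(1) unfolding continuous_on_iff dist_real_def by metis
    show "\<exists>d>0. \<forall>t'\<in>J. \<bar>t' - t\<bar> < d \<longrightarrow> \<bar>\<phi> t' - \<phi> t\<bar> \<le> (\<sigma> t + e) * \<bar>t' - t\<bar>"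
    proof (intro exI[of _ "min d1 d3"] conjI ballI impI)
      fix t' assume t': "t' \<in> J" "\<bar>t' - t\<bar> < min d1 d3"
      have "\<bar>\<phi> t' - \<phi> t\<bar> \<le> (1 + e1) * dist (v (\<phi> t')) (v (\<phi> t))"
        using t' d3(2)[of t'] by (intro d2(2)) auto
      also have "\<dots> \<le> (1 + e1) * ((\<sigma> t + e1) * \<bar>t' - t\<bar>)"
        using t' d1(2)[of t'] e1 by (intro mult_left_mono) auto
      also have "\<dots> = ((1 + e1) * (\<sigma> t + e1)) * \<bar>t' - t\<bar>"
        by simp
      also have "\<dots> \<le> (\<sigma> t + e) * \<bar>t' - t\<bar>"
        using bound by (intro mult_right_mono) auto
      finally show "\<bar>\<phi> t' - \<phi> t\<bar> \<le> (\<sigma> t + e) * \<bar>t' - t\<bar>" .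
    qed (use d1 d3 in auto)
  qed auto
qed

text \<open>At a discontinuity a monotone function jumps, and a value inside the jump would be
  missing from the image.\<close>

lemma continuous_on_mono_onto_interval:
  fixes \<phi> :: "real \<Rightarrow> real"
  assumes mono: "\<And>s t. s \<in> J \<Longrightarrow> t \<in> J \<Longrightarrow> s \<le> t \<Longrightarrow> \<phi> s \<le> \<phi> t" and int: "is_interval (\<phi> ` J)"
  shows "continuous_on J \<phi>"
proof -
  have upper: "\<exists>d>0. \<forall>t\<in>J. t - s < d \<longrightarrow> \<phi> t < \<phi> s + e" if "s \<in> J" "0 < e" for s e
  proof (cases "\<exists>t\<in>J. s < t \<and> \<phi> t < \<phi> s + e")
    case True
    then obtain u where u: "u \<in> J" "s < u" "\<phi> u < \<phi> s + e"
      by blast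
    then have "\<phi> t < \<phi> s + e" if "t \<in> J" "t - s < u - s" for t
      using mono[of t u] that by auto
    then show ?thesis
      using u by (intro exI[of _ "u - s"]) auto
  next
    case False
    have "t \<le> s" if "t \<in> J" for t
    proof (rule ccontr)
      assume "\<not> t \<le> s"
      with False that have "\<phi> s + e \<le> \<phi> t"
        by (auto simp: not_less)
      \<comment> \<open>A value inside the gap is attained because the image is an interval;
        monotonicity places the point attaining it to the right of \<open>s\<close>, against the
        case assumption.\<close>
      then have "\<phi> s + e / 2 \<in> \<phi> ` J"
        using int \<open>s \<in> J\<close> that \<open>0 < e\<close> unfolding is_interval_1
        by (elim ballE[of _ _ "\<phi> s"] ballE[of _ _ "\<phi> t"] allE[of _ "\<phi> s + e / 2"]) auto
      then obtain w where w: "w \<in> J" "\<phi> w = \<phi> s + e / 2"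
        by auto
      with mono[of w s] \<open>s \<in> J\<close> \<open>0 < e\<close> have "s < w"
        by (cases "w \<le> s") auto
      with False w \<open>0 < e\<close> show False
        by auto
    qed
    then have "\<phi> t < \<phi> s + e" if "t \<in> J" for t
      using mono[OF that \<open>s \<in> J\<close>] that \<open>0 < e\<close> by fastforce
    then show ?thesis
      by (intro exI[of _ 1]) auto
  qed
  have lower: "\<exists>d>0. \<forall>t\<in>J. s - t < d \<longrightarrow> \<phi> s - e < \<phi> t" if "s \<in> J" "0 < e" for s e
  proof (cases "\<exists>t\<in>J. t < s \<and> \<phi> s - e < \<phi> t")
    case True
    then obtain u where u: "u \<in> J" "u < s" "\<phi> s - e < \<phi> u"
      by blast
    then have "\<phi> s - e < \<phi> t" if "t \<in> J" "s - t < s - u" for t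
      using mono[of u t] that by auto
    then show ?thesis
      using u by (intro exI[of _ "s - u"]) auto
  next
    case False
    have "s \<le> t" if "t \<in> J" for t
    proof (rule ccontr)
      assume "\<not> s \<le> t"
      with False that have "\<phi> t \<le> \<phi> s - e"
        by (auto simp: not_less)
      then have "\<phi> s - e / 2 \<in> \<phi> ` J"
        using int \<open>s \<in> J\<close> that \<open>0 < e\<close> unfolding is_interval_1
        by (elim ballE[of _ _ "\<phi> t"] ballE[of _ _ "\<phi> s"] allE[of _ "\<phi> s - e / 2"]) auto
      then obtain w where w: "w \<in> J" "\<phi> w = \<phi> s - e / 2"
        by auto
      with mono[of s w] \<open>s \<in> J\<close> \<open>0 < e\<close> have "w < s"
        by (cases "s \<le> w") auto
      with False w \<open>0 < e\<close> show False
        by auto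
    qed
    then have "\<phi> s - e < \<phi> t" if "t \<in> J" for t
      using mono[OF \<open>s \<in> J\<close> that] that \<open>0 < e\<close> by fastforce
    then show ?thesis
      by (intro exI[of _ 1]) auto
  qed
  show ?thesis
    unfolding continuous_on_iff dist_real_def
  proof (intro ballI allI impI)
    fix s e :: real assume s: "s \<in> J" "0 < e"
    obtain d1 d2 where "d1 > 0" "\<And>t. t \<in> J \<Longrightarrow> t - s < d1 \<Longrightarrow> \<phi> t < \<phi> s + e"
      "d2 > 0" "\<And>t. t \<in> J \<Longrightarrow> s - t < d2 \<Longrightarrow> \<phi> s - e < \<phi> t"
      using upper[OF s] lower[OF s] by blast
    then have "\<bar>\<phi> t - \<phi> s\<bar> < e" if "t \<in> J" "\<bar>t - s\<bar> < min d1 d2" for t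
      using that by (smt (verit))
    then show "\<exists>d>0. \<forall>t\<in>J. \<bar>t - s\<bar> < d \<longrightarrow> \<bar>\<phi> t - \<phi> s\<bar> < e"
      using \<open>d1 > 0\<close> \<open>d2 > 0\<close> by (intro exI[of _ "min d1 d2"]) auto
  qed
qed

section \<open>Arc length parametrization of a curve and of its image\<close>

lemma chain_length_map: "chain_length v (map h xs) = chain_length (v \<circ> h) xs"
  by (induction "v \<circ> h" xs rule: chain_length.induct) auto

lemma chain_length_cong: "(\<And>x. x \<in> set xs \<Longrightarrow> v x = w x) \<Longrightarrow> chain_length v xs = chain_length w xs"
  by (induction v xs rule: chain_length.induct) auto

locale rectifiable_curve =
  fixes c :: "'a::metric_space curve"
  assumes curve: "is_curve c" and rect: "loc_rectifiable c"
begin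

abbreviation "T \<equiv> fst c"
abbreviation "\<gamma> \<equiv> snd c"
abbreviation "len \<equiv> length_fun c"
abbreviation "S \<equiv> length_fun c ` fst c"
abbreviation "param \<equiv> arclength_param c"

lemma base_in: "base_point c \<in> T"
  using curve unfolding base_point_def is_curve_def by (auto intro: someI)

lemma curve_length_finite: "s \<in> T \<Longrightarrow> t \<in> T \<Longrightarrow> s \<le> t \<Longrightarrow> curve_length \<gamma> s t < \<infinity>"
  using rect by (auto simp: loc_rectifiable_def)

lemma
  assumes st: "s \<in> T" "t \<in> T" "s \<le> t"
  shows curve_length_eq_len_diff: "curve_length \<gamma> s t = ennreal (len t - len s)"
    and len_mono: "len s \<le> len t"
proof -
  let ?b = "base_point c" and ?l = "\<lambda>s t. enn2real (curve_length \<gamma> s t)"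
  have add: "?l s u = ?l s t + ?l t u" if "s \<in> T" "t \<in> T" "u \<in> T" "s \<le> t" "t \<le> u" for s t u
    using that curve_length_finite[of s t] curve_length_finite[of t u]
    by (simp add: curve_length_add[of s t u] enn2real_plus)
  \<comment> \<open>The sign convention in \<open>length_fun\<close> changes at the base point,
    which may lie to the left of both points, between them or to the right.\<close>
  consider "?b \<le> s" | "s < ?b" "?b \<le> t" | "t < ?b"
    using st by linarith
  then have eq: "len t - len s = ?l s t"
  proof cases
    case 1
    then show ?thesis using add[of ?b s t] st base_in by (simp add: length_fun_def)
  next
    case 2
    then show ?thesis using add[of s ?b t] st base_in by (simp add: length_fun_def)
  next
    case 3
    then show ?thesis using add[of s t ?b] st base_in by (simp add: length_fun_def)
  qed
  show "curve_length \<gamma> s t = ennreal (len t - len s)"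
    unfolding eq using curve_length_finite[OF st] by simp
  show "len s \<le> len t"
    using eq enn2real_nonneg[of "curve_length \<gamma> s t"] by linarith
qed

lemma Icc_subset_T: "a \<in> T \<Longrightarrow> b \<in> T \<Longrightarrow> {a..b} \<subseteq> T"
  using curve unfolding is_curve_def is_interval_1 by (meson atLeastAtMost_iff subsetI)

text \<open>On a compact parameter interval the length from the left end is continuous, and
  \<open>len\<close> differs from it by a constant, so the intermediate value theorem
  applies.\<close>

lemma is_interval_S: "is_interval S"
  unfolding is_interval_1
proof (intro ballI allI impI)
  fix u v w assume uv: "u \<in> S" "v \<in> S" and w: "u \<le> w \<and> w \<le> v"
  then obtain a b where ab: "a \<in> T" "b \<in> T" "u = len a" "v = len b"
    by auto
  show "w \<in> S"
  proof (cases "a \<le> b")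
    case True
    have "continuous_on {a..b} \<gamma>"
      using curve Icc_subset_T[of a b] ab continuous_on_subset unfolding is_curve_def by blast
    with continuous_on_length_from[OF True curve_length_finite] ab True
    have "continuous_on {a..b} (\<lambda>s. len a + enn2real (curve_length \<gamma> a s))"
      by (intro continuous_intros) auto
    moreover have "len a + enn2real (curve_length \<gamma> a s) = len s" if "s \<in> {a..b}" for s
      using that ab Icc_subset_T[of a b] curve_length_eq_len_diff[of a s] len_mono[of a s] by auto
    ultimately have "continuous_on {a..b} len"
      by (subst continuous_on_cong[OF refl, symmetric]) auto
    from IVT'[OF _ _ True this, of w] w ab obtain s where "a \<le> s" "s \<le> b" "len s = w"
      by auto
    then show ?thesis
      using Icc_subset_T[of a b] ab by auto
  next
    case False
    then have "w = u"
      using len_mono[of b a] ab w by auto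
    with uv show ?thesis by simp
  qed
qed

lemma S_borel: "S \<in> sets borel"
  by (rule real_interval_borel_measurable[OF is_interval_S])

text \<open>A piece of length zero has vanishing chords. Hence \<open>param\<close> does not depend
  on the preimage selected by \<open>SOME\<close>.\<close>

lemma len_eq_imp_eq:
  assumes "s \<in> T" "t \<in> T" "len s = len t"
  shows "\<gamma> s = \<gamma> t"
proof -
  have *: "\<gamma> s = \<gamma> t" if "s \<in> T" "t \<in> T" "len s = len t" "s \<le> t" for s t
    using dist_le_curve_length[OF that(4), of \<gamma>] curve_length_eq_len_diff[OF that(1,2,4)] that(3)
    by simp
  show ?thesis
  proof (cases "s \<le> t")
    case True
    then show ?thesis by (rule *[OF assms])
  next
    case False
    then show ?thesis using *[OF assms(2,1) assms(3)[symmetric]] by simp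
  qed
qed

lemma param_eq: "param u = \<gamma> (inv_into T len u)"
  by (simp add: arclength_param_def inv_into_def Bex_def)

lemma param_len: "t \<in> T \<Longrightarrow> param (len t) = \<gamma> t"
  unfolding param_eq by (rule len_eq_imp_eq) (auto intro: inv_into_into f_inv_into_f)

lemma param_in: "u \<in> S \<Longrightarrow> param u \<in> \<gamma> ` T"
  by (auto simp: param_len)

text \<open>\<open>len\<close> and its right inverse are both monotone and carry polygons of one
  curve to polygons of the other with the same vertices, so the two suprema agree.\<close>

lemma curve_length_param:
  assumes ab: "a \<in> S" "b \<in> S" "a \<le> b"
  shows "curve_length param a b = ennreal (b - a)"
proof -
  let ?h = "inv_into T len"
  have sub: "{a..b} \<subseteq> S"
    using is_interval_S ab unfolding is_interval_1 by (meson atLeastAtMost_iff subsetI)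
  have h: "?h u \<in> T" "len (?h u) = u" if "u \<in> S" for u
    using that by (auto intro: inv_into_into f_inv_into_f)
  have h_mono: "?h u \<le> ?h w" if "u \<in> S" "w \<in> S" "u \<le> w" for u w
  proof (rule ccontr)
    assume "\<not> ?h u \<le> ?h w"
    then have "w \<le> u"
      using len_mono[of "?h w" "?h u"] h[OF that(1)] h[OF that(2)] by auto
    with \<open>\<not> ?h u \<le> ?h w\<close> that show False by auto
  qed
  have hT: "{?h a..?h b} \<subseteq> T"
    by (intro Icc_subset_T h ab)
  have "curve_length param a b = curve_length \<gamma> (?h a) (?h b)"
    unfolding curve_length_eq_SUP_chain
  proof (intro antisym SUP_least; clarify)
    fix us :: "real list" assume us: "sorted us" "set us \<subseteq> {a..b}"
    have "chain_length param us = chain_length \<gamma> (map ?h us)"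
      unfolding chain_length_map by (rule chain_length_cong) (simp add: param_eq)
    moreover have "sorted (map ?h us)"
      unfolding sorted_map by (rule sorted_wrt_mono_rel[OF _ us(1)]) (use us sub in \<open>auto intro!: h_mono\<close>)
    moreover have "set (map ?h us) \<subseteq> {?h a..?h b}"
    proof
      fix t assume "t \<in> set (map ?h us)"
      then obtain u where "u \<in> {a..b}" "t = ?h u"
        using us by auto
      then show "t \<in> {?h a..?h b}"
        using h_mono[of a u] h_mono[of u b] sub ab by auto
    qed
    ultimately show "ennreal (chain_length param us) \<le>
        (SUP xs\<in>{xs. sorted xs \<and> set xs \<subseteq> {?h a..?h b}}. ennreal (chain_length \<gamma> xs))"
      by (intro SUP_upper2[of "map ?h us"]) auto
  next
    fix ts :: "real list" assume ts: "sorted ts" "set ts \<subseteq> {?h a..?h b}"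
    have "chain_length \<gamma> ts = chain_length param (map len ts)"
      unfolding chain_length_map using ts hT by (intro chain_length_cong) (auto simp: param_len)
    moreover have "sorted (map len ts)"
      unfolding sorted_map by (rule sorted_wrt_mono_rel[OF _ ts(1)]) (use ts hT in \<open>auto intro!: len_mono\<close>)
    moreover have "set (map len ts) \<subseteq> {a..b}"
    proof
      fix u assume "u \<in> set (map len ts)"
      then obtain t where t: "t \<in> {?h a..?h b}" "u = len t"
        using ts by auto
      then show "u \<in> {a..b}"
        using len_mono[of "?h a" t] len_mono[of t "?h b"] h[OF ab(1)] h[OF ab(2)] hT by auto
    qed
    ultimately show "ennreal (chain_length \<gamma> ts) \<le>
        (SUP xs\<in>{xs. sorted xs \<and> set xs \<subseteq> {a..b}}. ennreal (chain_length param xs))"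
      by (intro SUP_upper2[of "map len ts"]) auto
  qed
  also have "\<dots> = ennreal (b - a)"
    using curve_length_eq_len_diff[of "?h a" "?h b"] h ab h_mono by simp
  finally show ?thesis .
qed

lemma dist_param_le: "a \<in> S \<Longrightarrow> b \<in> S \<Longrightarrow> dist (param a) (param b) \<le> \<bar>a - b\<bar>"
proof -
  have "dist (param a) (param b) \<le> b - a" if "a \<in> S" "b \<in> S" "a \<le> b" for a b
    using dist_le_curve_length[OF that(3), of param] curve_length_param[OF that] that by simp
  from this[of a b] this[of b a] show "a \<in> S \<Longrightarrow> b \<in> S \<Longrightarrow> dist (param a) (param b) \<le> \<bar>a - b\<bar>"
    by (cases "a \<le> b") (auto simp: dist_commute)
qed

lemma continuous_on_param: "continuous_on S param"
  unfolding continuous_on_iff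
proof (intro ballI allI impI)
  fix s e :: real assume s: "s \<in> S" "0 < e"
  have "dist (param t) (param s) < e" if "t \<in> S" "dist t s < e" for t
    using dist_param_le[OF that(1) s(1)] that(2) by (simp add: dist_real_def)
  then show "\<exists>d>0. \<forall>t\<in>S. dist t s < d \<longrightarrow> dist (param t) (param s) < e"
    using s by blast
qed


lemma borel_measurable_along:
  fixes h :: "'a \<Rightarrow> ennreal"
  assumes "h \<in> borel_measurable borel"
  shows "(\<lambda>s. indicator S s * h (param s)) \<in> borel_measurable borel"
proof -
  have "(\<lambda>s. h (param s)) \<in> borel_measurable (restrict_space borel S)"
    using measurable_compose[OF borel_measurable_continuous_on_restrict[OF continuous_on_param] assms] .
  then show ?thesis
    using S_borel by (subst (asm) borel_measurable_restrict_space_iff_ennreal) (simp_all add: mult.commute)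
qed

lemma vimage_param_borel:
  assumes "B \<in> sets borel"
  shows "{s \<in> S. param s \<in> B} \<in> sets borel"
proof -
  have "param -` B \<inter> S \<in> sets (restrict_space borel S)"
    using measurable_sets[OF borel_measurable_continuous_on_restrict[OF continuous_on_param] assms]
    by (simp add: space_restrict_space)
  moreover have "param -` B \<inter> S = {s \<in> S. param s \<in> B}"
    by auto
  ultimately show ?thesis
    using S_borel by (simp add: sets_restrict_space_iff)
qed

end

locale rectifiable_curve_map = rectifiable_curve c + im: rectifiable_curve "(fst c, f \<circ> snd c)"
  for c :: "'a::metric_space curve" and f :: "'a \<Rightarrow> 'b::metric_space"
begin

abbreviation "ct \<equiv> (fst c, f \<circ> snd c)"
abbreviation "L \<equiv> L_fun f c"

lemma L_eq: "L s = length_fun ct (inv_into T len s)"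
  by (simp add: L_fun_def inv_into_def Bex_def)

text \<open>Where \<open>len\<close> is constant, \<open>\<gamma>\<close> is constant, hence so is
  its image under \<open>f\<close>, which has length zero there: \<open>L\<close> is well defined in
  spite of the choice in \<open>L_fun\<close>.\<close>

lemma L_len: "t \<in> T \<Longrightarrow> L (len t) = length_fun ct t"
proof -
  assume t: "t \<in> T"
  let ?s = "inv_into T len (len t)"
  have s: "?s \<in> T" "len ?s = len t"
    using t by (auto intro: inv_into_into f_inv_into_f)
  have "length_fun ct x = length_fun ct y" if "x \<in> T" "y \<in> T" "len x = len y" "x \<le> y" for x y
  proof -
    have const: "\<gamma> u = \<gamma> x" if u: "u \<in> {x..y}" for u
      using len_mono[of x u] len_mono[of u y] u Icc_subset_T[of x y] \<open>x \<in> T\<close> \<open>y \<in> T\<close> \<open>len x = len y\<close>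
      by (intro len_eq_imp_eq) auto
    have eq: "(f \<circ> \<gamma>) u = f (\<gamma> x)" if "u \<in> {x..y}" for u
      by (simp only: o_apply const[OF that])
    have "curve_length (f \<circ> \<gamma>) x y = 0"
    proof -
      have "chain_length (f \<circ> \<gamma>) us = 0" if "set us \<subseteq> {x..y}" for us
      proof -
        have "chain_length (f \<circ> \<gamma>) us = chain_length (\<lambda>_. f (\<gamma> x)) us"
          using that by (intro chain_length_cong eq) auto
        also have "\<dots> = 0"
          by (induction "\<lambda>_::real. f (\<gamma> x)" us rule: chain_length.induct) auto
        finally show ?thesis .
      qed
      then have "curve_length (f \<circ> \<gamma>) x y \<le> 0"
        unfolding curve_length_eq_SUP_chain by (intro SUP_least) auto
      then show ?thesis by simp
    qed
    then show ?thesis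
      using im.curve_length_eq_len_diff[of x y] im.len_mono[of x y] that by simp
  qed
  note * = this
  show ?thesis
  proof (cases "?s \<le> t")
    case True
    then show ?thesis unfolding L_eq by (rule *[OF s(1) t s(2)])
  next
    case False
    then show ?thesis unfolding L_eq using *[OF t s(1) s(2)[symmetric]] by simp
  qed
qed

lemma L_image: "L ` S = im.S"
  by (auto simp: L_len image_image)

lemma L_mono:
  assumes "s \<in> S" "t \<in> S" "s \<le> t"
  shows "L s \<le> L t"
proof -
  obtain x y where xy: "x \<in> T" "y \<in> T" "s = len x" "t = len y"
    using assms by auto
  show ?thesis
  proof (cases "x \<le> y")
    case True
    then show ?thesis using im.len_mono[of x y] xy by (simp add: L_len)
  next
    case False
    then have "s = t"
      using len_mono[of y x] xy assms by auto
    then show ?thesis by simp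
  qed
qed

text \<open>Continuity comes from the range: the values of the image's length function fill an
  interval, so the monotone \<open>L\<close> cannot jump.\<close>

lemma continuous_on_L: "continuous_on S L"
  by (rule continuous_on_mono_onto_interval[OF L_mono]) (simp_all only: L_image im.is_interval_S)

lemma param_L: "s \<in> S \<Longrightarrow> im.param (L s) = f (param s)"
  by (auto simp: L_len im.param_len param_len)

text \<open>A short chord of the image curve is at most \<open>n + e\<close> times the chord of
  \<open>c\<close>, which in turn is at most the increment of arc length. So \<open>L\<close>
  satisfies the chord hypothesis with \<open>\<sigma>\<close> equal to \<open>n\<close> along the
  curve, and \<open>L_N_prop\<close> is the remaining hypothesis on null sets.\<close>

lemma line_integral_image_le:
  fixes n :: "'a \<Rightarrow> real" and r :: "'b \<Rightarrow> ennreal" and k :: "'a \<Rightarrow> ennreal"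
  assumes N: "L_N_prop f c"
    and B: "B \<in> sets borel" "negligible {s \<in> S. param s \<notin> B}"
    and n: "n \<in> borel_measurable borel" "\<And>x. 0 \<le> n x"
    and f: "\<And>x e. x \<in> B \<inter> \<gamma> ` T \<Longrightarrow> 0 < e \<Longrightarrow>
      \<exists>d>0. \<forall>y\<in>\<gamma> ` T. dist y x < d \<longrightarrow> dist (f y) (f x) \<le> (n x + e) * dist y x"
    and r: "r \<in> borel_measurable borel"
    and k: "\<And>x. x \<in> B \<inter> \<gamma> ` T \<Longrightarrow> ennreal (n x) * r (f x) \<le> k x"
  shows "line_integral r ct \<le> line_integral k c"
proof -
  define \<sigma> where "\<sigma> s = (if s \<in> S then n (param s) else 0)" for s
  have \<sigma>m: "\<sigma> \<in> borel_measurable borel"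
  proof -
    have "(\<lambda>s. n (param s)) \<in> borel_measurable (restrict_space borel S)"
      using measurable_compose[OF borel_measurable_continuous_on_restrict[OF continuous_on_param] n(1)] .
    then show ?thesis
      using S_borel unfolding \<sigma>_def by (subst (asm) measurable_restrict_space_iff[of _ _ 0]) auto
  qed
  have W: "{s \<in> S. param s \<notin> B} \<in> sets borel"
    using vimage_param_borel[of "- B"] B by auto
  have Neg: "negligible (L ` X)" if "X \<subseteq> S" "negligible X" for X
    using N that by (auto simp: L_N_prop_def negligible_iff_null_sets)
  have "line_integral r ct = (\<integral>\<^sup>+ t. indicator (L ` S) t * r (im.param t) \<partial>lborel)"
    by (simp add: line_integral_def L_image del: image_image)
  also have "\<dots> \<le> (\<integral>\<^sup>+ s. indicator S s * (ennreal (\<sigma> s) * r (im.param (L s))) \<partial>lborel)"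
  proof (rule nn_integral_image_le_of_unit_speed[OF is_interval_S continuous_on_L Neg \<sigma>m _ W])
    show "negligible (L ` (S \<inter> {s \<in> S. param s \<notin> B}))"
      using B(2) by (intro Neg) (auto intro: negligible_subset)
    show "curve_length im.param a b = ennreal (b - a)" if "a \<in> L ` S" "b \<in> L ` S" "a \<le> b" for a b
      using that unfolding L_image by (rule im.curve_length_param)
    show "(\<lambda>s. indicator (L ` S) s * r (im.param s)) \<in> borel_measurable borel"
      unfolding L_image by (rule im.borel_measurable_along[OF r])
    fix s e :: real assume s: "s \<in> S" "s \<notin> {s \<in> S. param s \<notin> B}" and "0 < e"
    then have "param s \<in> B \<inter> \<gamma> ` T"
      using param_in[of s] by blast
    then obtain d where d: "d > 0" "\<And>y. y \<in> \<gamma> ` T \<Longrightarrow> dist y (param s) < d \<Longrightarrow>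
        dist (f y) (f (param s)) \<le> (n (param s) + e) * dist y (param s)"
      using f \<open>0 < e\<close> by blast
    show "\<exists>d>0. \<forall>t'\<in>S. \<bar>t' - s\<bar> < d \<longrightarrow>
        dist (im.param (L t')) (im.param (L s)) \<le> (\<sigma> s + e) * \<bar>t' - s\<bar>"
    proof (intro exI[of _ d] conjI ballI impI)
      fix t assume t: "t \<in> S" "\<bar>t - s\<bar> < d"
      have le: "dist (param t) (param s) \<le> \<bar>t - s\<bar>"
        by (rule dist_param_le[OF t(1) s(1)])
      have "dist (im.param (L t)) (im.param (L s)) = dist (f (param t)) (f (param s))"
        by (simp only: param_L[OF t(1)] param_L[OF s(1)])
      also have "\<dots> \<le> (n (param s) + e) * dist (param t) (param s)"
        using le t by (intro d(2) param_in) auto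
      also have "\<dots> \<le> (\<sigma> s + e) * \<bar>t - s\<bar>"
        using le s(1) n(2)[of "param s"] \<open>0 < e\<close> unfolding \<sigma>_def by (auto intro!: mult_left_mono)
      finally show "dist (im.param (L t)) (im.param (L s)) \<le> (\<sigma> s + e) * \<bar>t - s\<bar>" .
    qed (rule d)
  qed (auto simp: \<sigma>_def n)
  also have "\<dots> \<le> (\<integral>\<^sup>+ s. indicator S s * k (param s) \<partial>lborel)"
  proof (rule nn_integral_mono_AE)
    have "AE s in lebesgue. s \<notin> {s \<in> S. param s \<notin> B}"
      using B(2) by (intro AE_not_in) (simp add: negligible_iff_null_sets)
    then have "AE s in lborel. s \<notin> {s \<in> S. param s \<notin> B}"
      by (simp add: AE_completion_iff)
    then show "AE s in lborel. indicator S s * (ennreal (\<sigma> s) * r (im.param (L s))) \<le> indicator S s * k (param s)"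
    proof eventually_elim
      case (elim s)
      show ?case
      proof (cases "s \<in> S")
        case True
        with elim param_in[OF True] have "ennreal (n (param s)) * r (f (param s)) \<le> k (param s)"
          by (intro k) auto
        then show ?thesis
          unfolding param_L[OF True] using True by (simp add: \<sigma>_def)
      qed simp
    qed
  qed
  also have "\<dots> = line_integral k c"
    by (simp add: line_integral_def)
  finally show ?thesis .
qed

text \<open>The estimate is applied to the inverse \<open>?M\<close> of \<open>L\<close>, with the
  roles of the two curves exchanged: chords of the lifting are controlled by chords of the image
  divided by \<open>\<mu>\<close>. The exceptional set is measured in the arc length of the image,
  which is the variable of \<open>?M\<close>.\<close>

lemma line_integral_le_image:
  fixes \<mu> :: "'a \<Rightarrow> real" and r :: "'a \<Rightarrow> ennreal" and k :: "'b \<Rightarrow> ennreal"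
  assumes N: "L_Ninv_prop f c"
    and B: "B \<in> sets borel" "\<And>x. x \<in> \<gamma> ` T \<Longrightarrow> x \<notin> B \<Longrightarrow> f x \<in> E" "negligible {t \<in> im.S. im.param t \<in> E}"
    and \<mu>: "\<mu> \<in> borel_measurable borel" "\<And>x. x \<in> B \<Longrightarrow> 0 < \<mu> x"
    and f: "\<And>x e. x \<in> B \<inter> \<gamma> ` T \<Longrightarrow> 0 < e \<Longrightarrow>
      \<exists>d>0. \<forall>y\<in>\<gamma> ` T. dist y x < d \<longrightarrow> (\<mu> x - e) * dist y x \<le> dist (f y) (f x)"
    and r: "r \<in> borel_measurable borel"
    and k: "\<And>x. x \<in> B \<inter> \<gamma> ` T \<Longrightarrow> ennreal (1 / \<mu> x) * r x \<le> k (f x)"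
  shows "line_integral r c \<le> line_integral k ct"
proof -
  let ?M = "inv_into S L"
  have vim: "negligible {s \<in> S. L s \<in> X}" if "negligible X" for X
    using N that by (auto simp: L_Ninv_prop_def negligible_iff_null_sets)
  \<comment> \<open>If \<open>L\<close> were constant on a nondegenerate interval, the preimage of a
    single point would have positive measure, against \<open>L_Ninv_prop\<close>.\<close>
  have inj: "inj_on L S"
  proof -
    have "s = t" if st: "s \<in> S" "t \<in> S" "L s = L t" "s \<le> t" for s t
    proof (rule ccontr)
      assume "s \<noteq> t"
      have "{s..t} \<subseteq> {u \<in> S. L u \<in> {L s}}"
      proof
        fix u assume u: "u \<in> {s..t}"
        then have "u \<in> S"
          using is_interval_S st(1,2) unfolding is_interval_1 by (meson atLeastAtMost_iff)
        with u st show "u \<in> {u \<in> S. L u \<in> {L s}}"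
          using L_mono[of s u] L_mono[of u t] by auto
      qed
      then have "negligible {s..t}"
        using vim[of "{L s}"] negligible_subset by blast
      with st(4) \<open>s \<noteq> t\<close> show False
        using negligible_interval(1)[of s t] by (simp add: box_real)
    qed
    note * = this
    show ?thesis
    proof (rule inj_onI)
      fix s t assume st: "s \<in> S" "t \<in> S" "L s = L t"
      show "s = t"
        using *[OF st] *[OF st(2,1) st(3)[symmetric]] by linarith
    qed
  qed
  have M: "?M t \<in> S" "L (?M t) = t" if "t \<in> im.S" for t
    using that unfolding L_image[symmetric] by (auto intro: inv_into_into f_inv_into_f)
  have M_image: "?M ` im.S = S"
    unfolding L_image[symmetric] using inj by (rule inv_into_image_cancel) simp
  have M_mono: "?M s \<le> ?M t" if "s \<in> im.S" "t \<in> im.S" "s \<le> t" for s t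
  proof (rule ccontr)
    assume "\<not> ?M s \<le> ?M t"
    then have "t \<le> s"
      using L_mono[of "?M t" "?M s"] M[OF that(1)] M[OF that(2)] by auto
    with \<open>\<not> ?M s \<le> ?M t\<close> that show False by auto
  qed
  have contM: "continuous_on im.S ?M"
    by (rule continuous_on_mono_onto_interval[OF M_mono]) (simp_all only: M_image is_interval_S)
  \<comment> \<open>Images under \<open>?M\<close> are preimages under \<open>L\<close>, so this is
    \<open>L_Ninv_prop\<close> again.\<close>
  have Neg: "negligible (?M ` X)" if "X \<subseteq> im.S" "negligible X" for X
    using M that by (intro negligible_subset[OF vim[OF that(2)]]) (auto simp: subset_iff)
  have contgM: "continuous_on im.S (\<lambda>t. param (?M t))"
    by (rule continuous_on_compose2[OF continuous_on_param contM]) (simp only: M_image order.refl)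
  have gM: "im.param t = f (param (?M t))" if "t \<in> im.S" for t
    using param_L[of "?M t"] M[OF that] by simp
  define W where "W = {t \<in> im.S. param (?M t) \<notin> B}"
  have W: "W \<in> sets borel"
  proof -
    have "(\<lambda>t. param (?M t)) -` (- B) \<inter> im.S \<in> sets (restrict_space borel im.S)"
      using measurable_sets[OF borel_measurable_continuous_on_restrict[OF contgM], of "- B"] B
      by (simp add: space_restrict_space)
    moreover have "(\<lambda>t. param (?M t)) -` (- B) \<inter> im.S = W"
      by (auto simp: W_def)
    ultimately show ?thesis
      using im.S_borel by (simp add: sets_restrict_space_iff)
  qed
  have nW: "negligible W"
  proof (rule negligible_subset[OF B(3)])
    show "W \<subseteq> {t \<in> im.S. im.param t \<in> E}"
      using B(2) gM M param_in unfolding W_def by (metis (mono_tags, lifting) mem_Collect_eq subsetI)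
  qed
  \<comment> \<open>The value 0 off \<open>B\<close> keeps \<open>\<sigma>\<close> nonnegative,
    since \<open>\<mu>\<close> is known to be positive on \<open>B\<close> only; within
    \<open>im.S\<close> this concerns just the points of \<open>W\<close>.\<close>
  define \<sigma> where "\<sigma> t = (if t \<in> im.S then if param (?M t) \<in> B then 1 / \<mu> (param (?M t)) else 0 else 0)" for t
  have \<sigma>m: "\<sigma> \<in> borel_measurable borel"
  proof -
    have [measurable]: "B \<in> sets borel" "\<mu> \<in> borel_measurable borel"
      by fact+
    have "(\<lambda>x. if x \<in> B then 1 / \<mu> x else 0) \<in> borel_measurable borel"
      by measurable
    from measurable_compose[OF borel_measurable_continuous_on_restrict[OF contgM] this]
    show ?thesis
      using im.S_borel unfolding \<sigma>_def by (subst (asm) measurable_restrict_space_iff[of _ _ 0]) auto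
  qed
  have \<sigma>0: "0 \<le> \<sigma> t" for t
    using \<mu>(2) by (auto simp: \<sigma>_def less_imp_le)
  have "line_integral r c = (\<integral>\<^sup>+ s. indicator (?M ` im.S) s * r (param s) \<partial>lborel)"
    unfolding M_image by (simp add: line_integral_def)
  also have "\<dots> \<le> (\<integral>\<^sup>+ t. indicator im.S t * (ennreal (\<sigma> t) * r (param (?M t))) \<partial>lborel)"
  proof (rule nn_integral_image_le_of_unit_speed[OF im.is_interval_S contM Neg \<sigma>m \<sigma>0 W])
    show "negligible (?M ` (im.S \<inter> W))"
      using nW by (intro Neg) (auto intro: negligible_subset)
    show "curve_length param a b = ennreal (b - a)" if "a \<in> ?M ` im.S" "b \<in> ?M ` im.S" "a \<le> b" for a b
      using that unfolding M_image by (rule curve_length_param)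
    show "(\<lambda>s. indicator (?M ` im.S) s * r (param s)) \<in> borel_measurable borel"
      unfolding M_image by (rule borel_measurable_along[OF r])
    fix t e :: real assume t: "t \<in> im.S" "t \<notin> W" and "0 < e"
    let ?x = "param (?M t)"
    have x: "?x \<in> B \<inter> \<gamma> ` T"
      using t param_in[OF M(1)[OF t(1)]] by (auto simp: W_def)
    then have l: "0 < \<mu> ?x"
      using \<mu> by blast
    \<comment> \<open>This makes \<open>\<mu> - e1\<close> equal to
      \<open>\<mu> / (1 + e * \<mu>)\<close> at the point \<open>?x\<close>, whose reciprocal is
      \<open>1 / \<mu> + e\<close>.\<close>
    define e1 where "e1 = \<mu> ?x - \<mu> ?x / (1 + e * \<mu> ?x)"
    have "1 < 1 + e * \<mu> ?x"
      using l \<open>0 < e\<close> by simp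
    then have "\<mu> ?x / (1 + e * \<mu> ?x) < \<mu> ?x / 1"
      using l by (intro divide_strict_left_mono) auto
    then have e1: "0 < e1"
      by (simp add: e1_def)
    obtain d where d: "d > 0" "\<And>y. y \<in> \<gamma> ` T \<Longrightarrow> dist y ?x < d \<Longrightarrow>
        (\<mu> ?x - e1) * dist y ?x \<le> dist (f y) (f ?x)"
      using f[OF x e1] by blast
    obtain d' where d': "d' > 0" "\<And>t'. t' \<in> im.S \<Longrightarrow> dist t' t < d' \<Longrightarrow> dist (param (?M t')) ?x < d"
      using contgM t(1) d(1) unfolding continuous_on_iff by metis
    show "\<exists>d>0. \<forall>t'\<in>im.S. \<bar>t' - t\<bar> < d \<longrightarrow> dist (param (?M t')) ?x \<le> (\<sigma> t + e) * \<bar>t' - t\<bar>"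
    proof (intro exI[of _ d'] conjI ballI impI)
      fix t' assume t': "t' \<in> im.S" "\<bar>t' - t\<bar> < d'"
      have "(\<mu> ?x - e1) * dist (param (?M t')) ?x \<le> dist (f (param (?M t'))) (f ?x)"
        using t' by (intro d(2) d'(2) param_in M) (auto simp: dist_real_def)
      also have "\<dots> = dist (im.param t') (im.param t)"
        by (simp only: gM[OF t'(1)] gM[OF t(1)])
      also have "\<dots> \<le> \<bar>t' - t\<bar>"
        by (rule im.dist_param_le[OF t'(1) t(1)])
      finally have "\<mu> ?x / (1 + e * \<mu> ?x) * dist (param (?M t')) ?x \<le> \<bar>t' - t\<bar>"
        by (simp add: e1_def)
      then have "dist (param (?M t')) ?x \<le> (1 / \<mu> ?x + e) * \<bar>t' - t\<bar>"
        using l \<open>1 < 1 + e * \<mu> ?x\<close> by (simp add: field_simps)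
      also have "1 / \<mu> ?x = \<sigma> t"
        using t x by (simp add: \<sigma>_def)
      finally show "dist (param (?M t')) ?x \<le> (\<sigma> t + e) * \<bar>t' - t\<bar>" .
    qed (rule d')
  qed auto
  also have "\<dots> \<le> (\<integral>\<^sup>+ t. indicator im.S t * k (im.param t) \<partial>lborel)"
  proof (rule nn_integral_mono_AE)
    have "AE t in lebesgue. t \<notin> W"
      using nW by (intro AE_not_in) (simp add: negligible_iff_null_sets)
    then have "AE t in lborel. t \<notin> W"
      by (simp add: AE_completion_iff)
    then show "AE t in lborel. indicator im.S t * (ennreal (\<sigma> t) * r (param (?M t))) \<le>
        indicator im.S t * k (im.param t)"
    proof eventually_elim
      case (elim t)
      show ?case
      proof (cases "t \<in> im.S")
        case True
        with elim have "param (?M t) \<in> B"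
          by (simp add: W_def)
        moreover from this have "ennreal (1 / \<mu> (param (?M t))) * r (param (?M t)) \<le> k (f (param (?M t)))"
          using param_in[OF M(1)[OF True]] by (intro k) auto
        ultimately show ?thesis
          using True by (simp add: \<sigma>_def gM)
      qed simp
    qed
  qed
  also have "\<dots> = line_integral k ct"
    by (simp add: line_integral_def)
  finally show ?thesis .
qed

end

section \<open>Measurability and estimates for the derivative\<close>

lemma min_stretch_le:
  assumes "linear L"
  shows "min_stretch L * norm h \<le> norm (L h)"
proof (cases "h = 0")
  case False
  have "min_stretch L \<le> norm (L (h /\<^sub>R norm h))"
    unfolding min_stretch_def using False
    by (intro cInf_lower bdd_belowI[of _ 0]) (auto intro!: exI[of _ "h /\<^sub>R norm h"])
  also have "\<dots> = norm (L h) / norm h"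
    using linear_scale[OF assms, of "inverse (norm h)" h] by (simp add: divide_inverse mult.commute)
  finally show ?thesis
    using False by (simp add: field_simps)
qed (simp add: linear_0[OF assms])

lemma min_stretch_greatest:
  fixes L :: "real^'n \<Rightarrow> real^'n"
  assumes "\<And>h. norm h = 1 \<Longrightarrow> m \<le> norm (L h)"
  shows "m \<le> min_stretch L"
  unfolding min_stretch_def
proof (rule cInf_greatest)
  show "{norm (L h) |h. norm h = 1} \<noteq> {}"
    using vector_choose_size[of 1, where ?'a = "real^'n"] by auto
qed (use assms in auto)

text \<open>A nonzero determinant makes \<open>L\<close> injective, and an injective linear map in
  finite dimension is bounded below on the unit sphere.\<close>

lemma min_stretch_pos:
  fixes L :: "real^'n \<Rightarrow> real^'n"
  assumes "linear L" "det (matrix L) \<noteq> 0"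
  shows "0 < min_stretch L"
proof -
  have "inj L"
    using assms det_nz_iff_inj by blast
  then obtain m where "m > 0" "\<And>x. m * norm x \<le> norm (L x)"
    using linear_inj_bounded_below_pos[OF assms(1)] by metis
  then have "m \<le> min_stretch L"
    by (intro min_stretch_greatest) (metis mult.right_neutral)
  with \<open>m > 0\<close> show ?thesis by simp
qed

text \<open>A one-sided bound for all pairs becomes two-sided after swapping them. Applied to
  operator norm and minimal stretch, it lets both inherit measurability from the derivative
  matrix.\<close>

lemma continuous_on_of_component_sum_bound:
  fixes \<phi> :: "real^'n^'m \<Rightarrow> real"
  assumes "\<And>A B. \<phi> A - \<phi> B \<le> (\<Sum>i\<in>UNIV. \<Sum>j\<in>UNIV. \<bar>A $ i $ j - B $ i $ j\<bar>)"
  shows "continuous_on UNIV \<phi>"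
  unfolding continuous_on_def
proof
  fix A :: "real^'n^'m"
  have "((\<lambda>B. \<Sum>i\<in>UNIV. \<Sum>j\<in>UNIV. \<bar>B $ i $ j - A $ i $ j\<bar>) \<longlongrightarrow>
      (\<Sum>i\<in>UNIV. \<Sum>j\<in>UNIV. \<bar>A $ i $ j - A $ i $ j\<bar>)) (at A within UNIV)"
    by (intro tendsto_intros)
  then have lim: "((\<lambda>B. \<Sum>i\<in>UNIV. \<Sum>j\<in>UNIV. \<bar>B $ i $ j - A $ i $ j\<bar>) \<longlongrightarrow> 0) (at A within UNIV)"
    by simp
  have "\<bar>\<phi> B - \<phi> A\<bar> \<le> (\<Sum>i\<in>UNIV. \<Sum>j\<in>UNIV. \<bar>B $ i $ j - A $ i $ j\<bar>)" for B
  proof -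
    have "(\<Sum>i\<in>UNIV. \<Sum>j\<in>UNIV. \<bar>A $ i $ j - B $ i $ j\<bar>) = (\<Sum>i\<in>UNIV. \<Sum>j\<in>UNIV. \<bar>B $ i $ j - A $ i $ j\<bar>)"
      by (intro sum.cong refl abs_minus_commute)
    with assms[of A B] assms[of B A] show ?thesis
      by linarith
  qed
  note bound = this
  have "((\<lambda>B. \<phi> B - \<phi> A) \<longlongrightarrow> 0) (at A within UNIV)"
    by (rule Lim_null_comparison[OF _ lim]) (simp only: real_norm_def bound eventually_True)
  then show "(\<phi> \<longlongrightarrow> \<phi> A) (at A within UNIV)"
    by (simp add: LIM_zero_iff)
qed

lemma norm_matrix_diff_le:
  fixes A B :: "real^'n^'m"
  shows "norm (A *v h) \<le> norm (B *v h) + (\<Sum>i\<in>UNIV. \<Sum>j\<in>UNIV. \<bar>A $ i $ j - B $ i $ j\<bar>) * norm h"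
proof -
  have "norm (A *v h) = norm (B *v h + (A - B) *v h)"
    by (simp add: matrix_vector_mult_diff_rdistrib)
  also have "\<dots> \<le> norm (B *v h) + norm ((A - B) *v h)"
    by (rule norm_triangle_ineq)
  also have "norm ((A - B) *v h) \<le> onorm ((*v) (A - B)) * norm h"
    by (rule onorm) simp
  also have "\<dots> \<le> (\<Sum>i\<in>UNIV. \<Sum>j\<in>UNIV. \<bar>(A - B) $ i $ j\<bar>) * norm h"
    by (intro mult_right_mono onorm_le_matrix_component_sum) simp
  finally show ?thesis by simp
qed

lemma continuous_on_onorm_matrix: "continuous_on UNIV (\<lambda>A :: real^'n^'m. onorm ((*v) A))"
proof (rule continuous_on_of_component_sum_bound)
  fix A B :: "real^'n^'m"
  have "onorm ((*v) A) \<le> onorm ((*v) B) + (\<Sum>i\<in>UNIV. \<Sum>j\<in>UNIV. \<bar>A $ i $ j - B $ i $ j\<bar>)"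
  proof (rule onorm_bound)
    fix h :: "real^'n"
    note norm_matrix_diff_le[of A h B]
    also have "norm (B *v h) \<le> onorm ((*v) B) * norm h"
      by (rule onorm) simp
    finally show "norm (A *v h) \<le> (onorm ((*v) B) + (\<Sum>i\<in>UNIV. \<Sum>j\<in>UNIV. \<bar>A $ i $ j - B $ i $ j\<bar>)) * norm h"
      by (simp add: distrib_right)
  qed (simp add: onorm_pos_le sum_nonneg)
  then show "onorm ((*v) A) - onorm ((*v) B) \<le> (\<Sum>i\<in>UNIV. \<Sum>j\<in>UNIV. \<bar>A $ i $ j - B $ i $ j\<bar>)"
    by simp
qed

lemma continuous_on_min_stretch_matrix: "continuous_on UNIV (\<lambda>A :: real^'n^'n. min_stretch ((*v) A))"
proof (rule continuous_on_of_component_sum_bound)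
  fix A B :: "real^'n^'n"
  let ?d = "\<Sum>i\<in>UNIV. \<Sum>j\<in>UNIV. \<bar>A $ i $ j - B $ i $ j\<bar>"
  have "min_stretch ((*v) A) - ?d \<le> min_stretch ((*v) B)"
  proof (rule min_stretch_greatest)
    fix h :: "real^'n" assume h: "norm h = 1"
    have "min_stretch ((*v) A) \<le> norm (A *v h)"
      using min_stretch_le[of "(*v) A" h] h by simp
    with norm_matrix_diff_le[of A h B] h show "min_stretch ((*v) A) - ?d \<le> norm (B *v h)"
      by simp
  qed
  then show "min_stretch ((*v) A) - min_stretch ((*v) B) \<le> ?d"
    by simp
qed

lemma
  fixes f :: "real^'n \<Rightarrow> real^'n"
  assumes f: "(f has_derivative L) (at x)" and e: "0 < e"
  shows derivative_upper_estimate: "\<exists>d>0. \<forall>y. dist y x < d \<longrightarrow> dist (f y) (f x) \<le> (onorm L + e) * dist y x"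
    and derivative_lower_estimate: "\<exists>d>0. \<forall>y. dist y x < d \<longrightarrow> (min_stretch L - e) * dist y x \<le> dist (f y) (f x)"
proof -
  have L: "bounded_linear L" "linear L"
    using f has_derivative_bounded_linear bounded_linear.linear by blast+
  obtain d where d: "d > 0" "\<And>y. norm (y - x) < d \<Longrightarrow> norm (f y - f x - L (y - x)) \<le> e * norm (y - x)"
    using f e unfolding has_derivative_within_alt by auto
  have "dist (f y) (f x) \<le> (onorm L + e) * dist y x" "(min_stretch L - e) * dist y x \<le> dist (f y) (f x)"
    if "dist y x < d" for y
  proof -
    have 1: "norm (f y - f x - L (y - x)) \<le> e * norm (y - x)"
      using d that by (simp add: dist_norm)
    have 2: "norm (L (y - x)) \<le> onorm L * norm (y - x)"
      by (rule onorm[OF L(1)])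
    have 3: "min_stretch L * norm (y - x) \<le> norm (L (y - x))"
      by (rule min_stretch_le[OF L(2)])
    have 4: "norm (f y - f x) \<le> norm (f y - f x - L (y - x)) + norm (L (y - x))"
      using norm_triangle_ineq[of "f y - f x - L (y - x)" "L (y - x)"] by simp
    have 5: "norm (L (y - x)) \<le> norm (f y - f x) + norm (f y - f x - L (y - x))"
      using norm_triangle_ineq4[of "f y - f x" "f y - f x - L (y - x)"] by simp
    show "dist (f y) (f x) \<le> (onorm L + e) * dist y x" "(min_stretch L - e) * dist y x \<le> dist (f y) (f x)"
      using 1 2 3 4 5 by (auto simp: dist_norm algebra_simps)
  qed
  then show "\<exists>d>0. \<forall>y. dist y x < d \<longrightarrow> dist (f y) (f x) \<le> (onorm L + e) * dist y x"
    "\<exists>d>0. \<forall>y. dist y x < d \<longrightarrow> (min_stretch L - e) * dist y x \<le> dist (f y) (f x)"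
    using d(1) by blast+
qed

text \<open>Each matrix entry is a pointwise limit of difference quotients along
  \<open>1 / real (Suc m)\<close> times a unit vector, which are Borel because \<open>f\<close> is
  continuous on the open set \<open>D\<close>.\<close>

lemma derivative_matrix_measurable:
  fixes f :: "real^'n \<Rightarrow> real^'n"
  assumes D: "open D" and cont: "continuous_on D f"
    and A: "A \<in> sets lebesgue" "A \<subseteq> D" and f: "\<And>x. x \<in> A \<Longrightarrow> (f has_derivative f' x) (at x)"
  shows "(\<lambda>x. matrix (f' x)) \<in> borel_measurable (lebesgue_on A)"
proof -
  have entry: "(\<lambda>x. matrix (f' x) $ i $ j) \<in> borel_measurable (lebesgue_on A)" for i j
  proof -
    let ?h = "\<lambda>m::nat. axis j (1 / real (Suc m)) :: real^'n"
    \<comment> \<open>The value 0 where \<open>x + ?h m\<close> leaves \<open>D\<close> is harmless: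
      for each \<open>x\<close> in \<open>D\<close> the shifted point lies in \<open>D\<close> for
      large \<open>m\<close>.\<close>
    define F where "F m x = (if x \<in> D \<and> x + ?h m \<in> D then real (Suc m) * (f (x + ?h m) - f x) $ i else 0)"
      for m x
    have "F m \<in> borel_measurable borel" for m
    proof -
      have "open {x \<in> D. x + ?h m \<in> D}"
      proof -
        have "{x \<in> D. x + ?h m \<in> D} = D \<inter> (\<lambda>x. x + ?h m) -` D"
          by auto
        moreover have "open ((\<lambda>x. x + ?h m) -` D)"
          by (rule open_vimage[OF D]) (intro continuous_intros)
        ultimately show ?thesis
          using D by auto
      qed
      moreover have "continuous_on {x \<in> D. x + ?h m \<in> D} (\<lambda>x. real (Suc m) * (f (x + ?h m) - f x) $ i)"
        by (intro continuous_intros continuous_on_compose2[OF cont]) auto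
      ultimately have "(\<lambda>x. if x \<in> {x \<in> D. x + ?h m \<in> D} then real (Suc m) * (f (x + ?h m) - f x) $ i else 0)
          \<in> borel_measurable borel"
        by (intro borel_measurable_continuous_on_if) (auto simp: borel_open)
      then show ?thesis
        unfolding F_def by simp
    qed
    then have Fm: "F m \<in> borel_measurable (lebesgue_on A)" for m
      by (intro measurable_restrict_space1 measurable_completion) simp
    show ?thesis
    proof (rule borel_measurable_LIMSEQ_real[OF _ Fm])
      fix x assume "x \<in> space (lebesgue_on A)"
      then have x: "x \<in> A" "x \<in> D"
        using A by auto
      have lin: "linear (f' x)"
        using f[OF x(1)] has_derivative_linear by blast
      have h: "?h \<longlonglongrightarrow> 0"
      proof (rule vec_tendstoI)
        fix k
        have "(\<lambda>m. 1 / real (Suc m)) \<longlonglongrightarrow> 0"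
          by (rule LIMSEQ_Suc[OF lim_1_over_n])
        then show "(\<lambda>m. ?h m $ k) \<longlonglongrightarrow> 0 $ k"
          by (cases "k = j") (simp_all add: axis_def)
      qed
      have "(\<lambda>m. x + ?h m) \<longlonglongrightarrow> x + 0"
        by (intro tendsto_intros h)
      then have evD: "\<forall>\<^sub>F m in sequentially. x + ?h m \<in> D"
        using topological_tendstoD[OF _ D, of "\<lambda>m. x + ?h m" x sequentially] x by simp
      have "(\<lambda>m. real (Suc m) *\<^sub>R (f (x + ?h m) - f x)) \<longlonglongrightarrow> f' x (axis j 1)"
      proof -
        have "((\<lambda>h. norm (f (x + h) - f x - f' x h) / norm h) \<longlongrightarrow> 0) (at 0)"
          using f[OF x(1)] by (simp add: has_derivative_at)
        moreover have "filterlim ?h (at 0) sequentially"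
          using h by (auto simp: filterlim_at axis_eq_0_iff intro!: always_eventually)
        ultimately have "(\<lambda>m. norm (f (x + ?h m) - f x - f' x (?h m)) / norm (?h m)) \<longlonglongrightarrow> 0"
          by (rule filterlim_compose)
        moreover have "norm (f (x + ?h m) - f x - f' x (?h m)) / norm (?h m) =
            norm (real (Suc m) *\<^sub>R (f (x + ?h m) - f x) - f' x (axis j 1))" for m
        proof -
          have ax: "?h m = (1 / real (Suc m)) *\<^sub>R axis j 1"
            by (simp add: axis_def vec_eq_iff)
          have hn: "norm (?h m) = 1 / real (Suc m)"
            unfolding ax by (simp add: norm_axis_1)
          have "norm (real (Suc m) *\<^sub>R (f (x + ?h m) - f x) - f' x (axis j 1)) =
              norm (real (Suc m) *\<^sub>R (f (x + ?h m) - f x - f' x (?h m)))"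
            using linear_scale[OF lin, of "1 / real (Suc m)" "axis j 1"]
            unfolding ax by (simp add: scaleR_diff_right del: of_nat_Suc)
          also have "\<dots> = real (Suc m) * norm (f (x + ?h m) - f x - f' x (?h m))"
            by simp
          finally show ?thesis
            unfolding hn by simp
        qed
        ultimately have "(\<lambda>m. norm (real (Suc m) *\<^sub>R (f (x + ?h m) - f x) - f' x (axis j 1))) \<longlonglongrightarrow> 0"
          by simp
        then show ?thesis
          by (simp only: tendsto_norm_zero_iff LIM_zero_iff)
      qed
      then have "(\<lambda>m. (real (Suc m) *\<^sub>R (f (x + ?h m) - f x)) $ i) \<longlonglongrightarrow> f' x (axis j 1) $ i"
        by (rule tendsto_vec_nth)
      then have "(\<lambda>m. F m x) \<longlonglongrightarrow> f' x (axis j 1) $ i"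
      proof (rule Lim_transform_eventually)
        show "\<forall>\<^sub>F m in sequentially. (real (Suc m) *\<^sub>R (f (x + ?h m) - f x)) $ i = F m x"
          using evD by eventually_elim (use x in \<open>simp add: F_def\<close>)
      qed
      then show "(\<lambda>m. F m x) \<longlonglongrightarrow> matrix (f' x) $ i $ j"
        by (simp add: matrix_def)
    qed
  qed
  show ?thesis
    unfolding borel_measurable_euclidean_space[where f = "\<lambda>x. matrix (f' x)"]
    using entry by (auto simp: Basis_vec_def inner_axis)
qed

section \<open>Admissible functions and exceptional families\<close>

lemma enn_powr_mono: "0 \<le> p \<Longrightarrow> x \<le> y \<Longrightarrow> enn_powr x p \<le> enn_powr y p"
proof -
  assume p: "0 \<le> p" and xy: "x \<le> y"
  show ?thesis
  proof (cases "y = \<infinity>")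
    case False
    then have "x \<noteq> \<infinity>" "enn2real x \<le> enn2real y"
      using xy by (auto simp: top_unique less_top intro: enn2real_mono)
    then show ?thesis
      using False p unfolding enn_powr_def by (auto intro!: ennreal_leI powr_mono2)
  qed (simp add: enn_powr_def)
qed

lemma enn_powr_measurable [measurable]:
  assumes [measurable]: "f \<in> borel_measurable M"
  shows "(\<lambda>x. enn_powr (f x) p) \<in> borel_measurable M"
  unfolding enn_powr_def by measurable

lemma enn_powr_powr_inverse: "0 < p \<Longrightarrow> enn_powr (enn_powr x p) (1 / p) = x"
  by (cases x) (auto simp: enn_powr_def powr_powr)

lemma enn_powr_inverse_powr: "0 < p \<Longrightarrow> enn_powr (enn_powr x (1 / p)) p = x"
  by (cases x) (auto simp: enn_powr_def powr_powr)

lemma enn_powr_cmult: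
  assumes "0 \<le> a"
  shows "enn_powr (ennreal a * x) p = ennreal (a powr p) * enn_powr x p"
proof (cases x)
  case (real r)
  then show ?thesis
    using assms by (simp add: enn_powr_def powr_mult flip: ennreal_mult)
next
  case top
  then show ?thesis
    using assms by (cases "a = 0") (auto simp: enn_powr_def ennreal_mult_top)
qed

lemma nn_integral_enn_powr_max_le:
  assumes [measurable]: "f \<in> borel_measurable M" "g \<in> borel_measurable M"
  shows "(\<integral>\<^sup>+ x. enn_powr (max (f x) (g x)) p \<partial>M) \<le> (\<integral>\<^sup>+ x. enn_powr (f x) p \<partial>M) + (\<integral>\<^sup>+ x. enn_powr (g x) p \<partial>M)"
proof -
  have "(\<integral>\<^sup>+ x. enn_powr (max (f x) (g x)) p \<partial>M) \<le> (\<integral>\<^sup>+ x. enn_powr (f x) p + enn_powr (g x) p \<partial>M)"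
    by (intro nn_integral_mono) (auto simp: max_def)
  also have "\<dots> = (\<integral>\<^sup>+ x. enn_powr (f x) p \<partial>M) + (\<integral>\<^sup>+ x. enn_powr (g x) p \<partial>M)"
    by (intro nn_integral_add) measurable
  finally show ?thesis .
qed

lemma line_integral_mono: "(\<And>x. f x \<le> g x) \<Longrightarrow> line_integral f c \<le> line_integral g c"
  unfolding line_integral_def by (intro nn_integral_mono mult_left_mono) auto

text \<open>Modulus zero provides admissible functions for \<open>Exc\<close> with arbitrarily small
  integral. The maximum of such a function with \<open>h\<close> serves every curve of
  \<open>\<Gamma>\<close>, and the power of a maximum is at most the sum of the powers.\<close>

lemma modulus_le_of_exceptional:
  fixes h :: "'a::euclidean_space \<Rightarrow> ennreal"
  assumes Exc: "modulus p Exc = 0" and h: "h \<in> borel_measurable borel"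
    and adm: "\<And>c. c \<in> \<Gamma> \<Longrightarrow> c \<notin> Exc \<Longrightarrow> loc_rectifiable c \<Longrightarrow> 1 \<le> line_integral h c"
  shows "modulus p \<Gamma> \<le> (\<integral>\<^sup>+ x. enn_powr (h x) p \<partial>lebesgue)"
proof (rule ennreal_le_epsilon)
  fix e :: real assume "0 < e"
  then have "modulus p Exc < ennreal e"
    using Exc by simp
  then obtain \<rho> where \<rho>: "\<rho> \<in> adm Exc" "(\<integral>\<^sup>+ x. enn_powr (\<rho> x) p \<partial>lebesgue) < ennreal e"
    unfolding modulus_def INF_less_iff by blast
  have \<rho>m: "\<rho> \<in> borel_measurable borel"
    using \<rho> by (simp add: adm_def)
  have "(\<lambda>x. max (h x) (\<rho> x)) \<in> adm \<Gamma>"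
    unfolding adm_def
  proof (intro CollectI conjI ballI impI)
    show "(\<lambda>x. max (h x) (\<rho> x)) \<in> borel_measurable borel"
      using h \<rho>m by measurable
    fix c assume c: "c \<in> \<Gamma>" "loc_rectifiable c"
    show "1 \<le> line_integral (\<lambda>x. max (h x) (\<rho> x)) c"
    proof (cases "c \<in> Exc")
      case True
      then have "1 \<le> line_integral \<rho> c"
        using \<rho> c by (simp add: adm_def)
      also have "\<dots> \<le> line_integral (\<lambda>x. max (h x) (\<rho> x)) c"
        by (rule line_integral_mono) simp
      finally show ?thesis .
    next
      case False
      then have "1 \<le> line_integral h c"
        using adm c by blast
      also have "\<dots> \<le> line_integral (\<lambda>x. max (h x) (\<rho> x)) c"
        by (rule line_integral_mono) simp
      finally show ?thesis .
    qed
  qed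
  then have "modulus p \<Gamma> \<le> (\<integral>\<^sup>+ x. enn_powr (max (h x) (\<rho> x)) p \<partial>lebesgue)"
    unfolding modulus_def by (rule INF_lower)
  also have "\<dots> \<le> (\<integral>\<^sup>+ x. enn_powr (h x) p \<partial>lebesgue) + (\<integral>\<^sup>+ x. enn_powr (\<rho> x) p \<partial>lebesgue)"
    using h \<rho>m by (intro nn_integral_enn_powr_max_le measurable_completion) simp_all
  also have "\<dots> \<le> (\<integral>\<^sup>+ x. enn_powr (h x) p \<partial>lebesgue) + ennreal e"
    using \<rho> by (intro add_left_mono) simp
  finally show "modulus p \<Gamma> \<le> (\<integral>\<^sup>+ x. enn_powr (h x) p \<partial>lebesgue) + ennreal e" .
qed

text \<open>\<open>adm\<close> demands Borel functions, whereas the candidates built from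
  \<open>f\<close> are only Lebesgue measurable. Changing \<open>h\<close> to infinity on a Borel
  null set repairs this, leaves integrals alone and absorbs the bad set \<open>N\<close> as
  well.\<close>

lemma borel_majorant:
  fixes h :: "'a::euclidean_space \<Rightarrow> ennreal"
  assumes h: "h \<in> borel_measurable lebesgue" and N: "negligible N"
  shows "\<exists>h'\<in>borel_measurable borel. (\<forall>x. h x \<le> h' x) \<and> (\<forall>x\<in>N. h' x = \<infinity>) \<and> (AE x in lebesgue. h' x = h x)"
proof -
  obtain g where g: "g \<in> borel_measurable lborel" "AE x in lborel. h x = g x"
    using completion_ex_borel_measurable[OF h] by blast
  from g(2) obtain N1 where "{x \<in> space lborel. h x \<noteq> g x} \<subseteq> N1" "N1 \<in> null_sets lborel"
    by (rule AE_E3) auto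
  then have N1: "\<And>x. x \<notin> N1 \<Longrightarrow> h x = g x" "negligible N1"
    by (auto simp: negligible_iff_null_sets intro: null_sets_completionI)
  obtain N2 where N2: "N \<union> N1 \<subseteq> N2" "N2 \<in> sets borel" "negligible N2"
    using negligible_borel_hull negligible_Un[OF N N1(2)] by metis
  have [measurable]: "g \<in> borel_measurable borel" "N2 \<in> sets borel"
    using g N2 by auto
  show ?thesis
  proof (intro bexI[of _ "\<lambda>x. if x \<in> N2 then \<infinity> else g x"] conjI allI)
    show "(\<lambda>x. if x \<in> N2 then \<infinity> else g x) \<in> borel_measurable borel"
      by measurable
    have "AE x in lebesgue. x \<notin> N2"
      using N2(3) by (intro AE_not_in) (simp add: negligible_iff_null_sets)
    then show "AE x in lebesgue. (if x \<in> N2 then \<infinity> else g x) = h x"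
    proof eventually_elim
      case (elim x)
      then have "x \<notin> N1"
        using N2 by blast
      with elim N1(1)[of x] show ?case
        by simp
    qed
    show "h x \<le> (if x \<in> N2 then \<infinity> else g x)" for x
    proof (cases "x \<in> N2")
      case False
      then have "x \<notin> N1"
        using N2(1) by blast
      with False N1(1) show ?thesis
        by simp
    qed simp
  qed (use N2 in auto)
qed

text \<open>Combined with \<open>borel_majorant\<close>, this settles the curves that spend positive
  length in a bad null set; for all others that set has length zero along the curve.\<close>

lemma (in rectifiable_curve) line_integral_infinite:
  assumes h: "h \<in> borel_measurable borel" and pos: "\<not> negligible {s \<in> S. param s \<in> {x. h x = \<infinity>}}"
  shows "line_integral h c = \<infinity>"
proof -
  have "{x. h x = \<infinity>} \<in> sets borel"
    using measurable_sets[OF h, of "{\<infinity>}"] by (simp add: vimage_def)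
  then have V: "{s \<in> S. param s \<in> {x. h x = \<infinity>}} \<in> sets borel" (is "?V \<in> _")
    by (rule vimage_param_borel)
  have "emeasure lborel ?V \<noteq> 0"
    using pos V by (auto simp: negligible_iff_null_sets null_sets_def)
  then have "\<infinity> = (\<infinity>::ennreal) * emeasure lborel ?V"
    by (simp add: ennreal_top_mult)
  also have "\<dots> = (\<integral>\<^sup>+ s. \<infinity> * indicator ?V s \<partial>lborel)"
    using V by (simp add: nn_integral_cmult_indicator)
  also have "\<dots> \<le> line_integral h c"
    unfolding line_integral_def by (intro nn_integral_mono) (auto simp: indicator_def)
  finally show ?thesis
    by (simp add: top_unique)
qed

section \<open>Decomposition into injective pieces\<close>

text \<open>The constants in the lower bound depend on \<open>x\<close>. The set \<open>E m\<close>
  gathers the points where \<open>1 / real (Suc m)\<close> serves both as radius and as lower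
  constant; two of its points in a ball of half that radius with equal images must coincide.\<close>

lemma countable_injective_pieces:
  fixes f :: "'a::euclidean_space \<Rightarrow> 'b::metric_space"
  assumes D: "open D" and cont: "continuous_on D f" and B: "B \<in> sets borel" "B \<subseteq> D"
    and low: "\<And>x. x \<in> B \<Longrightarrow> \<exists>m>0. \<exists>d>0. \<forall>y\<in>D. dist y x < d \<longrightarrow> m * dist y x \<le> dist (f y) (f x)"
  shows "\<exists>X :: nat \<Rightarrow> 'a set. disjoint_family X \<and> (\<Union>k. X k) = B \<and>
    (\<forall>k. X k \<in> sets borel \<and> inj_on f (X k))"
proof -
  define E where "E m = {x \<in> D. \<forall>y\<in>D. dist y x < 1 / real (Suc m) \<longrightarrow> dist y x \<le> real (Suc m) * dist (f y) (f x)}"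
    for m
  have E: "E m \<in> sets borel" for m
  proof -
    \<comment> \<open>For fixed \<open>y\<close> the points of \<open>D\<close> violating the
      condition form an open set; arbitrary unions over \<open>y\<close> remain open, so
      \<open>E m\<close> is relatively closed in \<open>D\<close>.\<close>
    let ?U = "\<lambda>y. D \<inter> (\<lambda>x. dist y x - real (Suc m) * dist (f y) (f x)) -` {0<..} \<inter> ball y (1 / real (Suc m))"
    have "open (?U y)" for y
      by (rule open_Int[OF continuous_open_preimage open_ball]) (auto intro!: continuous_intros D cont)
    then have "open (\<Union>y\<in>D. ?U y)"
      by blast
    moreover have "E m = D - (\<Union>y\<in>D. ?U y)"
      by (auto simp: E_def not_less not_le)
    ultimately show ?thesis
      using D by (auto intro: borel_open)
  qed
  have BE: "\<exists>m. x \<in> E m" if x: "x \<in> B" for x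
  proof -
    obtain \<mu> d where md: "\<mu> > 0" "d > 0" "\<And>y. y \<in> D \<Longrightarrow> dist y x < d \<Longrightarrow> \<mu> * dist y x \<le> dist (f y) (f x)"
      using low[OF x] by blast
    obtain m where m: "1 / real (Suc m) < min d \<mu>"
      using nat_approx_posE[of "min d \<mu>"] md by auto
    have "dist y x \<le> real (Suc m) * dist (f y) (f x)" if "y \<in> D" "dist y x < 1 / real (Suc m)" for y
    proof -
      have "1 / real (Suc m) * dist y x \<le> \<mu> * dist y x"
        using m by (intro mult_right_mono) auto
      also have "\<dots> \<le> dist (f y) (f x)"
        using md(3)[OF that(1)] that(2) m by auto
      finally show ?thesis
        by (simp add: field_simps del: of_nat_Suc)
    qed
    then show ?thesis
      using x B by (auto simp: E_def)
  qed
  obtain Q :: "'a set" where Q: "countable Q" "\<And>U. open U \<Longrightarrow> U \<noteq> {} \<Longrightarrow> \<exists>q\<in>Q. q \<in> U"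
    by (rule countable_dense_setE) blast
  \<comment> \<open>Half the radius, so that any two points of a piece are closer than
    \<open>1 / real (Suc m)\<close>.\<close>
  define P where "P = (\<lambda>(m, q). B \<inter> E m \<inter> ball q (1 / (2 * real (Suc m))))"
  have ne: "(UNIV :: nat set) \<times> Q \<noteq> {}"
    using Q(2)[of UNIV] by auto
  have cnt: "countable ((UNIV :: nat set) \<times> Q)"
    using Q(1) by simp
  define Y where "Y k = P (from_nat_into (UNIV \<times> Q) k)" for k
  have Yrange: "range Y = P ` (UNIV \<times> Q)"
    unfolding Y_def using range_from_nat_into[OF ne cnt] by (metis image_image)
  have Y_inj: "inj_on f (Y k)" for k
  proof -
    obtain m :: nat and q where "from_nat_into (UNIV \<times> Q) k = (m, q)"
      by fastforce
    then have Yk: "Y k = P (m, q)"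
      by (simp add: Y_def)
    show ?thesis
    proof (rule inj_onI)
      fix x y assume xy: "x \<in> Y k" "y \<in> Y k" "f x = f y"
      then have q: "dist q x < 1 / (2 * real (Suc m))" "dist q y < 1 / (2 * real (Suc m))"
        and "x \<in> E m" "y \<in> D"
        using B unfolding Yk P_def by auto
      have "dist y x \<le> dist q x + dist q y"
        using dist_triangle[of y x q] by (simp add: dist_commute add.commute)
      also have "\<dots> < 1 / (2 * real (Suc m)) + 1 / (2 * real (Suc m))"
        by (rule add_strict_mono[OF q])
      also have "\<dots> = 1 / real (Suc m)"
        by (simp add: field_simps)
      finally have "dist y x < 1 / real (Suc m)" .
      with \<open>x \<in> E m\<close> \<open>y \<in> D\<close> xy(3) have "dist y x \<le> 0"
        unfolding E_def by fastforce
      then show "x = y" by simp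
    qed
  qed
  have Y_sets: "Y k \<in> sets borel" for k
    using B E by (auto simp: Y_def P_def split: prod.split)
  have Y_UN: "(\<Union>k. Y k) = B"
  proof -
    have "\<exists>k. x \<in> Y k" if x: "x \<in> B" for x
    proof -
      obtain m where m: "x \<in> E m"
        using BE[OF x] by blast
      obtain q where "q \<in> Q" "q \<in> ball x (1 / (2 * real (Suc m)))"
        using Q(2)[of "ball x (1 / (2 * real (Suc m)))"] by auto
      then have "x \<in> P (m, q)" "(m, q) \<in> UNIV \<times> Q"
        using x m by (auto simp: P_def dist_commute)
      then show ?thesis
        using Yrange by (metis imageE image_eqI)
    qed
    moreover have "Y k \<subseteq> B" for k
      by (auto simp: Y_def P_def split: prod.splits)
    ultimately show ?thesis by blast
  qed
  show ?thesis
  proof (intro exI[of _ "disjointed Y"] conjI allI)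
    show "disjointed Y k \<in> sets borel" for k
      using sets.range_disjointed_sets[of Y borel] Y_sets by auto
    show "inj_on f (disjointed Y k)" for k
      using Y_inj disjointed_subset inj_on_subset by metis
  qed (simp_all add: disjoint_family_disjointed UN_disjointed_eq Y_UN)
qed


section \<open>The regular part of the domain\<close>

lemma borel_restriction_full_measure:
  fixes g :: "'a::euclidean_space \<Rightarrow> real"
  assumes A: "A \<in> sets lebesgue" and g: "g \<in> borel_measurable (lebesgue_on A)"
  obtains g' N where "g' \<in> borel_measurable borel" "negligible N" "\<And>x. x \<in> A \<Longrightarrow> x \<notin> N \<Longrightarrow> g' x = g x"
proof -
  have "(\<lambda>x. if x \<in> A then g x else 0) \<in> borel_measurable lebesgue"
    using A g by (subst borel_measurable_if) auto
  from completion_ex_borel_measurable_real[OF this]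
  obtain g' where g': "g' \<in> borel_measurable lborel" "AE x in lborel. (if x \<in> A then g x else 0) = g' x"
    by blast
  from g'(2) obtain N where N: "{x \<in> space lborel. (if x \<in> A then g x else 0) \<noteq> g' x} \<subseteq> N" "N \<in> null_sets lborel"
    by (rule AE_E3) auto
  have "g' x = g x" if "x \<in> A" "x \<notin> N" for x
    using N(1) that by force
  with g' N show ?thesis
    by (intro that[of g' N]) (auto simp: negligible_iff_null_sets intro: null_sets_completionI)
qed

text \<open>\<open>n\<close> and \<open>\<mu>\<close> are Borel on the whole space, as the
  comparison of line integrals demands, and represent operator norm and minimal stretch on
  \<open>B\<close>. Both \<open>D - B\<close> and its image are null: the image is the bad set for
  the first inequality, \<open>D - B\<close> itself for the second.\<close>

locale regular_part =
  fixes f :: "real^'n \<Rightarrow> real^'n" and D B :: "(real^'n) set" and X :: "nat \<Rightarrow> (real^'n) set"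
    and n \<mu> :: "real^'n \<Rightarrow> real"
  assumes D: "open D" and cont: "continuous_on D f"
    and B: "B \<in> sets borel" "B \<subseteq> D" "negligible (D - B)" "negligible (f ` (D - B))"
    and der: "\<And>x. x \<in> B \<Longrightarrow> (f has_derivative frechet_derivative f (at x)) (at x)"
    and jac: "\<And>x. x \<in> B \<Longrightarrow> jacobian f x \<noteq> 0"
    and jac_measurable: "jacobian f \<in> borel_measurable (lebesgue_on B)"
    and X: "disjoint_family X" "(\<Union>k. X k) = B" "\<And>k. X k \<in> sets borel" "\<And>k. inj_on f (X k)"
    and n: "n \<in> borel_measurable borel" "\<And>x. x \<in> B \<Longrightarrow> n x = onorm (frechet_derivative f (at x))" "\<And>x. 0 \<le> n x"
    and \<mu>: "\<mu> \<in> borel_measurable borel" "\<And>x. x \<in> B \<Longrightarrow> \<mu> x = min_stretch (frechet_derivative f (at x))"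

lemma regular_part_exists:
  fixes f :: "real^'n \<Rightarrow> real^'n"
  assumes D: "open D" and cont: "continuous_on D f"
    and diff: "AE x in lebesgue. x \<in> D \<longrightarrow> f differentiable (at x)"
    and N: "N_prop f D" and Ninv: "Ninv_prop f D"
  shows "\<exists>B X n \<mu>. regular_part f D B X n \<mu>"
proof -
  let ?f' = "\<lambda>x. frechet_derivative f (at x)"
  define A where "A = {x \<in> D. f differentiable (at x)}"
  have derA: "(f has_derivative ?f' x) (at x)" if "x \<in> A" for x
    using that by (simp add: A_def frechet_derivative_works)
  from diff obtain N0 where N0: "{x \<in> space lebesgue. \<not> (x \<in> D \<longrightarrow> f differentiable (at x))} \<subseteq> N0"
    "N0 \<in> null_sets lebesgue"
    by (rule AE_E3) auto
  have nDA: "negligible (D - A)"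
  proof (rule negligible_subset)
    show "negligible N0"
      using N0(2) by (simp only: negligible_iff_null_sets)
    show "D - A \<subseteq> N0"
      using N0(1) by (auto simp: A_def)
  qed
  have "A = D - (D - A)"
    by (auto simp: A_def)
  moreover have "D - (D - A) \<in> sets lebesgue"
    by (intro sets.Diff negligible_imp_sets nDA sets_completionI_sets) (simp add: D borel_open)
  ultimately have A: "A \<in> sets lebesgue" "A \<subseteq> D"
    by (simp_all add: A_def)
  have mat: "(\<lambda>x. matrix (?f' x)) \<in> borel_measurable (lebesgue_on A)"
    by (rule derivative_matrix_measurable[OF D cont A derA])
  have mat_eq: "(*v) (matrix (?f' x)) = ?f' x" if "x \<in> A" for x
    using derA[OF that] has_derivative_linear by (auto simp: fun_eq_iff matrix_works)
  have entry: "(\<lambda>x. matrix (?f' x) $ i $ j) \<in> borel_measurable (lebesgue_on A)" for i j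
  proof -
    have "(\<lambda>M :: real^'n^'n. M $ i $ j) \<in> borel_measurable borel"
      by (intro borel_measurable_continuous_onI continuous_intros)
    from measurable_compose[OF mat this] show ?thesis .
  qed
  have jacm: "jacobian f \<in> borel_measurable (lebesgue_on A)"
    unfolding jacobian_def[abs_def] det_def using entry by measurable
  have J0: "negligible {x \<in> A. jacobian f x = 0}"
  proof -
    have "negligible (f ` {x \<in> A. jacobian f x = 0})"
      by (rule Sard_negligible[where f' = ?f']) (auto simp: jacobian_def intro: has_derivative_at_withinI[OF derA])
    then have "negligible (D \<inter> f -` f ` {x \<in> A. jacobian f x = 0})"
      using Ninv by (simp add: Ninv_prop_def negligible_iff_null_sets)
    then show ?thesis
      by (rule negligible_subset) (use A in auto)
  qed
  have "(\<lambda>x. onorm ((*v) (matrix (?f' x)))) \<in> borel_measurable (lebesgue_on A)"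
    using measurable_compose[OF mat borel_measurable_continuous_onI[OF continuous_on_onorm_matrix]] .
  then obtain n1 N1 where n1: "n1 \<in> borel_measurable borel" "negligible N1"
    "\<And>x. x \<in> A \<Longrightarrow> x \<notin> N1 \<Longrightarrow> n1 x = onorm ((*v) (matrix (?f' x)))"
    using borel_restriction_full_measure[OF A(1)] by blast
  have "(\<lambda>x. min_stretch ((*v) (matrix (?f' x)))) \<in> borel_measurable (lebesgue_on A)"
    using measurable_compose[OF mat borel_measurable_continuous_onI[OF continuous_on_min_stretch_matrix]] .
  then obtain \<mu> N2 where \<mu>: "\<mu> \<in> borel_measurable borel" "negligible N2"
    "\<And>x. x \<in> A \<Longrightarrow> x \<notin> N2 \<Longrightarrow> \<mu> x = min_stretch ((*v) (matrix (?f' x)))"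
    using borel_restriction_full_measure[OF A(1)] by blast
  \<comment> \<open>Points without derivative, critical points and the points where the two Borel
    representatives may fail are removed through one Borel null set, so that \<open>B\<close> is
    Borel.\<close>
  have "negligible ((D - A) \<union> {x \<in> A. jacobian f x = 0} \<union> N1 \<union> N2)"
    using nDA J0 n1(2) \<mu>(2) by (intro negligible_Un)
  then obtain N3 where N3: "(D - A) \<union> {x \<in> A. jacobian f x = 0} \<union> N1 \<union> N2 \<subseteq> N3" "N3 \<in> sets borel" "negligible N3"
    by (rule negligible_borel_hull)
  define B where "B = D - N3"
  have BA: "B \<subseteq> A" "B \<in> sets borel"
    using N3 D by (auto simp: B_def borel_open)
  have nDB: "negligible (D - B)"
    by (rule negligible_subset[OF N3(3)]) (auto simp: B_def)
  have jac: "jacobian f x \<noteq> 0" if "x \<in> B" for x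
    using that N3 BA by (auto simp: B_def)
  have "\<exists>m>0. \<exists>d>0. \<forall>y\<in>D. dist y x < d \<longrightarrow> m * dist y x \<le> dist (f y) (f x)" if x: "x \<in> B" for x
  proof -
    have d: "(f has_derivative ?f' x) (at x)"
      using derA x BA by blast
    have m: "0 < min_stretch (?f' x)"
      by (rule min_stretch_pos[OF has_derivative_linear[OF d]]) (use jac[OF x] in \<open>simp add: jacobian_def\<close>)
    then obtain e where "e > 0" "\<forall>y. dist y x < e \<longrightarrow>
        (min_stretch (?f' x) - min_stretch (?f' x) / 2) * dist y x \<le> dist (f y) (f x)"
      using derivative_lower_estimate[OF d, of "min_stretch (?f' x) / 2"] by auto
    with m show ?thesis
      by (intro exI[of _ "min_stretch (?f' x) / 2"] conjI exI[of _ e]) simp_all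
  qed
  note low = this
  have BD: "B \<subseteq> D"
    by (auto simp: B_def)
  obtain X :: "nat \<Rightarrow> (real^'n) set" where X0: "disjoint_family X" "(\<Union>k. X k) = B"
    "\<forall>k. X k \<in> sets borel \<and> inj_on f (X k)"
    using countable_injective_pieces[OF D cont BA(2) BD low] by blast
  then have X: "disjoint_family X" "(\<Union>k. X k) = B" "\<And>k. X k \<in> sets borel" "\<And>k. inj_on f (X k)"
    by blast+
  \<comment> \<open>The absolute value makes the representative nonnegative everywhere and changes
    nothing on \<open>B\<close>, where it is an operator norm.\<close>
  have "regular_part f D B X (\<lambda>x. \<bar>n1 x\<bar>) \<mu>"
  proof
    show "negligible (f ` (D - B))"
      using N nDB by (simp add: N_prop_def negligible_iff_null_sets)
    show "jacobian f \<in> borel_measurable (lebesgue_on B)"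
      using jacm BA(1) by (rule measurable_restrict_mono)
    show "(\<lambda>x. \<bar>n1 x\<bar>) \<in> borel_measurable borel"
      using n1 by measurable
    show "\<bar>n1 x\<bar> = onorm (?f' x)" if "x \<in> B" for x
    proof -
      have "x \<in> A" "x \<notin> N1"
        using that BA N3 by (auto simp: B_def)
      moreover have "0 \<le> onorm (?f' x)"
        by (rule onorm_pos_le[OF has_derivative_bounded_linear[OF derA[OF \<open>x \<in> A\<close>]]])
      ultimately show ?thesis
        using n1(3) mat_eq by simp
    qed
    show "\<mu> x = min_stretch (?f' x)" if "x \<in> B" for x
    proof -
      have "x \<in> A" "x \<notin> N2"
        using that BA N3 by (auto simp: B_def)
      then show ?thesis
        using \<mu>(3) mat_eq by simp
    qed
    show "B \<subseteq> D" by (rule BD)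
  qed (use D cont BA nDB derA jac X \<mu> in auto)
  then show ?thesis by blast
qed

context regular_part
begin

lemma min_stretch_derivative_pos: "x \<in> B \<Longrightarrow> 0 < \<mu> x"
  using \<mu>(2)[of x] min_stretch_pos[OF has_derivative_linear[OF der]] jac by (simp add: jacobian_def)

lemma pieces_subset: "X k \<subseteq> B"
  using X(2) by blast

text \<open>For fixed \<open>y\<close> the series runs over the preimages of \<open>y\<close> in
  \<open>B \<inter> E\<close>, each piece contributing at most one. Pieces are integrated separately
  by the push-forward formula and reassembled by disjointness.\<close>

lemma
  fixes u :: "real^'n \<Rightarrow> ennreal"
  assumes E: "E \<in> sets lebesgue" and u: "u \<in> borel_measurable (lebesgue_on (B \<inter> E))"
  shows push_piece_measurable:
      "(\<lambda>y. u (inv_into (X k \<inter> E) f y) * indicator (f ` (X k \<inter> E)) y) \<in> borel_measurable lebesgue"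
    and nn_integral_push_pieces:
      "(\<integral>\<^sup>+ y. (\<Sum>k. u (inv_into (X k \<inter> E) f y) * indicator (f ` (X k \<inter> E)) y) \<partial>lebesgue) =
        (\<integral>\<^sup>+ x. ennreal \<bar>jacobian f x\<bar> * u x * indicator (B \<inter> E) x \<partial>lebesgue)"
proof -
  have XE: "X k \<inter> E \<in> sets lebesgue" for k
    using X(3)[of k] E by (auto intro: sets_completionI_sets)
  have d: "(f has_derivative frechet_derivative f (at x)) (at x within X k \<inter> E)" if "x \<in> X k \<inter> E" for x k
  proof -
    have "x \<in> B"
      using that pieces_subset by blast
    then show ?thesis
      by (rule has_derivative_at_withinI[OF der])
  qed
  have j: "(\<lambda>x. det (matrix (frechet_derivative f (at x)))) \<in> borel_measurable (lebesgue_on (X k \<inter> E))" for k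
    using measurable_restrict_mono[OF jac_measurable, of "X k \<inter> E"] pieces_subset[of k]
    by (auto simp: jacobian_def[abs_def])
  have uk: "u \<in> borel_measurable (lebesgue_on (X k \<inter> E))" for k
    by (rule measurable_restrict_mono[OF u]) (use pieces_subset in auto)
  have inj: "inj_on f (X k \<inter> E)" for k
    by (rule inj_on_subset[OF X(4)]) auto
  show m: "(\<lambda>y. u (inv_into (X k \<inter> E) f y) * indicator (f ` (X k \<inter> E)) y) \<in> borel_measurable lebesgue" for k
    by (rule push_measurable[OF XE d inj j uk])
  have piece: "(\<integral>\<^sup>+ y. u (inv_into (X k \<inter> E) f y) * indicator (f ` (X k \<inter> E)) y \<partial>lebesgue) =
      (\<integral>\<^sup>+ x. ennreal \<bar>jacobian f x\<bar> * u x * indicator (X k \<inter> E) x \<partial>lebesgue)" for k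
    unfolding jacobian_def by (rule nn_integral_push[OF XE d inj j uk])
  have ju: "(\<lambda>x. ennreal \<bar>jacobian f x\<bar> * u x * indicator (X k \<inter> E) x) \<in> borel_measurable lebesgue" for k
  proof -
    have "(\<lambda>x. ennreal \<bar>jacobian f x\<bar> * u x) \<in> borel_measurable (lebesgue_on (X k \<inter> E))"
      using j[of k] uk[of k] unfolding jacobian_def by measurable
    then show ?thesis
      using XE by (subst (asm) borel_measurable_restrict_space_iff_ennreal) auto
  qed
  have "(\<integral>\<^sup>+ y. (\<Sum>k. u (inv_into (X k \<inter> E) f y) * indicator (f ` (X k \<inter> E)) y) \<partial>lebesgue) =
      (\<Sum>k. \<integral>\<^sup>+ y. u (inv_into (X k \<inter> E) f y) * indicator (f ` (X k \<inter> E)) y \<partial>lebesgue)"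
    by (rule nn_integral_suminf[OF m])
  also have "\<dots> = (\<Sum>k. \<integral>\<^sup>+ x. ennreal \<bar>jacobian f x\<bar> * u x * indicator (X k \<inter> E) x \<partial>lebesgue)"
    unfolding piece ..
  also have "\<dots> = (\<integral>\<^sup>+ x. (\<Sum>k. ennreal \<bar>jacobian f x\<bar> * u x * indicator (X k \<inter> E) x) \<partial>lebesgue)"
    by (rule nn_integral_suminf[OF ju, symmetric])
  also have "\<dots> = (\<integral>\<^sup>+ x. ennreal \<bar>jacobian f x\<bar> * u x * indicator (B \<inter> E) x \<partial>lebesgue)"
  proof (intro nn_integral_cong)
    fix x
    have disj: "disjoint_family (\<lambda>k. X k \<inter> E)"
      using X(1) by (auto simp: disjoint_family_on_def)
    have "(\<Sum>k. indicator (X k \<inter> E) x) = (indicator (\<Union>k. X k \<inter> E) x :: ennreal)"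
      by (rule suminf_indicator[OF disj])
    also have "(\<Union>k. X k \<inter> E) = B \<inter> E"
      using X(2) by blast
    finally show "(\<Sum>k. ennreal \<bar>jacobian f x\<bar> * u x * indicator (X k \<inter> E) x) =
        ennreal \<bar>jacobian f x\<bar> * u x * indicator (B \<inter> E) x"
      by simp
  qed
  finally show "(\<integral>\<^sup>+ y. (\<Sum>k. u (inv_into (X k \<inter> E) f y) * indicator (f ` (X k \<inter> E)) y) \<partial>lebesgue) =
        (\<integral>\<^sup>+ x. ennreal \<bar>jacobian f x\<bar> * u x * indicator (B \<inter> E) x \<partial>lebesgue)" .
qed


section \<open>The two modulus inequalities\<close>

lemma curve_map:
  assumes c: "curve_in D c" "loc_rectifiable c" and ct: "loc_rectifiable (fst c, f \<circ> snd c)"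
  shows "rectifiable_curve_map c f"
proof
  have "continuous_on (fst c) (f \<circ> snd c)"
    using c cont unfolding curve_in_def is_curve_def
    by (intro continuous_on_compose) (auto intro: continuous_on_subset)
  then show "is_curve (fst c, f \<circ> snd c)"
    using c by (simp add: curve_in_def is_curve_def)
  show "is_curve c"
    using c by (simp add: curve_in_def)
qed (use c ct in auto)

theorem modulus_image_le:
  assumes q: "0 < q" and L2: "prop_L2 q f D"
    and \<Gamma>: "\<And>c. c \<in> \<Gamma> \<Longrightarrow> curve_in D c" and \<rho>: "\<rho> \<in> adm \<Gamma>"
  shows "modulus q (curve_image f \<Gamma>) \<le> (\<integral>\<^sup>+ x. indicator D x * K_I q f x * enn_powr (\<rho> x) q \<partial>lebesgue)"
proof -
  have \<rho>m: "\<rho> \<in> borel_measurable borel"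
    using \<rho> by (simp add: adm_def)
  define u where "u x = enn_powr (ennreal (1 / \<mu> x) * \<rho> x) q" for x
  have "u \<in> borel_measurable borel"
    using \<rho>m \<mu>(1) unfolding u_def by measurable
  \<comment> \<open>The set \<open>E\<close> of the push-forward lemmas is \<open>UNIV\<close> here,
    as all preimages in \<open>B\<close> count.\<close>
  then have u: "u \<in> borel_measurable (lebesgue_on (B \<inter> UNIV))"
    by (intro measurable_restrict_space1 measurable_completion) simp
  let ?t = "\<lambda>k y. u (inv_into (X k \<inter> UNIV) f y) * indicator (f ` (X k \<inter> UNIV)) y"
  define G where "G y = (\<Sum>k. ?t k y)" for y
  define h where "h y = enn_powr (G y) (1 / q)" for y
  have tm: "?t k \<in> borel_measurable lebesgue" for k
    by (rule push_piece_measurable[OF _ u]) simp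
  have "G \<in> borel_measurable lebesgue"
    unfolding G_def by (rule borel_measurable_suminf_order[OF tm])
  then have "h \<in> borel_measurable lebesgue"
    unfolding h_def by (rule enn_powr_measurable)
  from borel_majorant[OF this B(4)]
  obtain h' where "h' \<in> borel_measurable borel" "\<forall>y. h y \<le> h' y" "\<forall>y\<in>f ` (D - B). h' y = \<infinity>"
    "AE y in lebesgue. h' y = h y"
    by blast
  then have h': "h' \<in> borel_measurable borel" "\<And>y. h y \<le> h' y"
    "\<And>y. y \<in> f ` (D - B) \<Longrightarrow> h' y = \<infinity>" "AE y in lebesgue. h' y = h y"
    by blast+
  \<comment> \<open>The point \<open>x\<close> is the preimage of \<open>f x\<close> in its own
    piece, so its term is one summand of \<open>G (f x)\<close>; the power \<open>1 / q\<close> then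
    undoes the power in \<open>u\<close>.\<close>
  have key: "ennreal (1 / \<mu> x) * \<rho> x \<le> h' (f x)" if x: "x \<in> B" for x
  proof -
    obtain k where k: "x \<in> X k"
      using x X(2) by blast
    have "u x = ?t k (f x)"
      using k X(4) by (simp add: inv_into_f_f)
    also have "\<dots> \<le> G (f x)"
    proof -
      have "t k \<le> (\<Sum>k. t k)" for t :: "nat \<Rightarrow> ennreal"
        using sum_le_suminf[of t "{k}"] by (simp add: summableI)
      then show ?thesis
        unfolding G_def .
    qed
    finally have "enn_powr (u x) (1 / q) \<le> h (f x)"
      unfolding h_def using q by (intro enn_powr_mono) auto
    then show ?thesis
      unfolding u_def using q h'(2)[of "f x"] by (simp add: enn_powr_powr_inverse)
  qed
  let ?P = "\<lambda>ct. loc_rectifiable ct \<longrightarrow> (\<forall>c. is_lifting f D c ct \<longrightarrow> loc_rectifiable c \<and> L_Ninv_prop f c)"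
  define Exc where "Exc = {ct \<in> {ct. curve_in (f ` D) ct}. \<not> ?P ct}"
  have "modulus q Exc = 0"
    using L2 by (simp add: prop_L2_def ae_curves_def Exc_def)
  then have "modulus q (curve_image f \<Gamma>) \<le> (\<integral>\<^sup>+ y. enn_powr (h' y) q \<partial>lebesgue)"
  proof (rule modulus_le_of_exceptional[OF _ h'(1)])
    fix ct assume ct: "ct \<in> curve_image f \<Gamma>" "ct \<notin> Exc" "loc_rectifiable ct"
    then obtain c where c: "c \<in> \<Gamma>" "ct = (fst c, f \<circ> snd c)"
      by (auto simp: curve_image_def)
    have cD: "curve_in D c"
      by (rule \<Gamma>[OF c(1)])
    then have "curve_in (f ` D) ct"
      using cont unfolding curve_in_def is_curve_def c(2)
      by (auto simp: o_def intro: continuous_on_compose2[OF cont])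
    with ct have P: "?P ct"
      by (simp add: Exc_def)
    have "is_lifting f D c ct"
      using cD by (simp add: is_lifting_def c(2))
    with P ct(3) have c': "loc_rectifiable c" "L_Ninv_prop f c"
      by blast+
    interpret cm: rectifiable_curve_map c f
      using cD c'(1) ct(3) unfolding c(2) by (rule curve_map)
    have img: "snd c ` fst c \<subseteq> D"
      using cD by (simp add: curve_in_def)
    show "1 \<le> line_integral h' ct"
    \<comment> \<open>Either the image curve spends positive length where \<open>h'\<close> is
      infinite, or that length is zero and the exceptional set of the comparison is null.\<close>
    proof (cases "negligible {t \<in> cm.im.S. cm.im.param t \<in> {y. h' y = \<infinity>}}")
      case False
      then show ?thesis
        using cm.im.line_integral_infinite[OF h'(1)] unfolding c(2) by simp
    next
      case True
      have "1 \<le> line_integral \<rho> c"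
        using \<rho> c(1) c'(1) by (simp add: adm_def)
      also have "\<dots> \<le> line_integral h' ct"
        unfolding c(2)
      proof (rule cm.line_integral_le_image[OF c'(2) B(1) _ True \<mu>(1) min_stretch_derivative_pos _ \<rho>m])
        show "f x \<in> {y. h' y = \<infinity>}" if "x \<in> snd c ` fst c" "x \<notin> B" for x
          using that img h'(3) by blast
        show "ennreal (1 / \<mu> x) * \<rho> x \<le> h' (f x)" if "x \<in> B \<inter> snd c ` fst c" for x
          using that key by blast
        show "\<exists>d>0. \<forall>y\<in>snd c ` fst c. dist y x < d \<longrightarrow> (\<mu> x - e) * dist y x \<le> dist (f y) (f x)"
          if "x \<in> B \<inter> snd c ` fst c" "0 < e" for x e
          using derivative_lower_estimate[OF der that(2), of x] that(1) \<mu>(2)[of x] by auto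
      qed
      finally show ?thesis .
    qed
  qed
  also have "\<dots> = (\<integral>\<^sup>+ y. enn_powr (h y) q \<partial>lebesgue)"
    using h'(4) by (intro nn_integral_cong_AE) (auto elim: eventually_mono)
  also have "\<dots> = (\<integral>\<^sup>+ y. G y \<partial>lebesgue)"
    unfolding h_def using q by (simp add: enn_powr_inverse_powr)
  also have "\<dots> = (\<integral>\<^sup>+ x. ennreal \<bar>jacobian f x\<bar> * u x * indicator (B \<inter> UNIV) x \<partial>lebesgue)"
    unfolding G_def by (rule nn_integral_push_pieces[OF _ u]) simp
  \<comment> \<open>On \<open>B\<close> the integrands agree, because the absolute Jacobian divided
    by the power of \<open>\<mu>\<close> is \<open>K_I\<close>; off \<open>B\<close> the left one
    vanishes.\<close>
  also have "\<dots> \<le> (\<integral>\<^sup>+ x. indicator D x * K_I q f x * enn_powr (\<rho> x) q \<partial>lebesgue)"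
  proof (intro nn_integral_mono)
    fix x
    show "ennreal \<bar>jacobian f x\<bar> * u x * indicator (B \<inter> UNIV) x \<le> indicator D x * K_I q f x * enn_powr (\<rho> x) q"
    proof (cases "x \<in> B")
      case True
      have m: "0 < \<mu> x"
        by (rule min_stretch_derivative_pos[OF True])
      have "K_I q f x = ennreal (\<bar>jacobian f x\<bar> / \<mu> x powr q)"
        using jac[OF True] \<mu>(2)[OF True] by (simp add: K_I_def)
      also have "\<dots> = ennreal \<bar>jacobian f x\<bar> * ennreal ((1 / \<mu> x) powr q)"
        using m by (simp add: powr_divide flip: ennreal_mult)
      finally show ?thesis
        using True B(2) m by (auto simp: u_def enn_powr_cmult mult.assoc)
    qed simp
  qed
  finally show ?thesis .
qed

theorem modulus_le_image:
  assumes p: "0 < p" and L1: "prop_L1 p f D"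
    and E: "E \<in> sets lebesgue" "E \<subseteq> D"
    and \<Gamma>: "\<And>c. c \<in> \<Gamma> \<Longrightarrow> curve_in E c" and \<rho>: "\<rho> \<in> adm (curve_image f \<Gamma>)"
  shows "modulus p \<Gamma> \<le> (\<integral>\<^sup>+ y. indicator (f ` E) y * K_I_inv p f E y * enn_powr (\<rho> y) p \<partial>lebesgue)"
proof -
  have \<rho>m: "\<rho> \<in> borel_measurable borel"
    using \<rho> by (simp add: adm_def)
  have BE: "B \<inter> E \<in> sets lebesgue"
    using B(1) E(1) by (auto intro: sets_completionI_sets)
  have \<rho>f: "(\<lambda>x. \<rho> (f x)) \<in> borel_measurable (lebesgue_on (B \<inter> E))"
  proof -
    have "f \<in> borel_measurable (lebesgue_on (B \<inter> E))"
      using BE continuous_on_subset[OF cont, of "B \<inter> E"] E(2)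
      by (intro continuous_imp_measurable_on_sets_lebesgue) auto
    from measurable_compose[OF this \<rho>m] show ?thesis .
  qed
  \<comment> \<open>Restricting to \<open>E\<close>, which contains the curves of
    \<open>\<Gamma>\<close>, keeps other preimages out of the integral, to match the sum in
    \<open>K_I_inv\<close>.\<close>
  define h where "h x = indicator (B \<inter> E) x * (ennreal (n x) * \<rho> (f x))" for x
  have nm: "n \<in> borel_measurable (lebesgue_on (B \<inter> E))"
    using n(1) by (intro measurable_restrict_space1 measurable_completion) simp
  have "(\<lambda>x. ennreal (n x) * \<rho> (f x)) \<in> borel_measurable (lebesgue_on (B \<inter> E))"
    using nm \<rho>f by measurable
  then have "h \<in> borel_measurable lebesgue"
    unfolding h_def using BE
    by (subst (asm) borel_measurable_restrict_space_iff_ennreal) (simp_all add: mult.commute)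
  from borel_majorant[OF this B(3)]
  obtain h' where "h' \<in> borel_measurable borel" "\<forall>x. h x \<le> h' x" "\<forall>x\<in>D - B. h' x = \<infinity>"
    "AE x in lebesgue. h' x = h x"
    by blast
  then have h': "h' \<in> borel_measurable borel" "\<And>x. h x \<le> h' x"
    "\<And>x. x \<in> D - B \<Longrightarrow> h' x = \<infinity>" "AE x in lebesgue. h' x = h x"
    by blast+
  let ?P = "\<lambda>c. loc_rectifiable c \<longrightarrow> loc_rectifiable (fst c, f \<circ> snd c) \<and> L_N_prop f c"
  define Exc where "Exc = {c \<in> {c. curve_in D c}. \<not> ?P c}"
  have "modulus p Exc = 0"
    using L1 by (simp add: prop_L1_def ae_curves_def Exc_def)
  then have "modulus p \<Gamma> \<le> (\<integral>\<^sup>+ x. enn_powr (h' x) p \<partial>lebesgue)"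
  proof (rule modulus_le_of_exceptional[OF _ h'(1)])
    fix c assume c: "c \<in> \<Gamma>" "c \<notin> Exc" "loc_rectifiable c"
    have img: "snd c ` fst c \<subseteq> E"
      using \<Gamma>[OF c(1)] by (simp add: curve_in_def)
    have cD: "curve_in D c"
      using \<Gamma>[OF c(1)] E(2) by (auto simp: curve_in_def)
    with c have P: "loc_rectifiable (fst c, f \<circ> snd c)" "L_N_prop f c"
      by (auto simp: Exc_def)
    interpret cm: rectifiable_curve_map c f
      using cD c(3) P(1) by (rule curve_map)
    show "1 \<le> line_integral h' c"
    proof (cases "negligible {s \<in> cm.S. cm.param s \<in> {x. h' x = \<infinity>}}")
      case False
      then show ?thesis
        using cm.line_integral_infinite[OF h'(1)] by simp
    next
      case True
      have "(fst c, f \<circ> snd c) \<in> curve_image f \<Gamma>"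
        using c(1) by (auto simp: curve_image_def)
      then have "1 \<le> line_integral \<rho> (fst c, f \<circ> snd c)"
        using \<rho> P(1) by (simp add: adm_def)
      also have "\<dots> \<le> line_integral h' c"
      proof (rule cm.line_integral_image_le[OF P(2) B(1) _ n(1,3) _ \<rho>m])
        show "negligible {s \<in> cm.S. cm.param s \<notin> B}"
        proof (rule negligible_subset[OF True])
          show "{s \<in> cm.S. cm.param s \<notin> B} \<subseteq> {s \<in> cm.S. cm.param s \<in> {x. h' x = \<infinity>}}"
            using h'(3) img E(2) cm.param_in by blast
        qed
        show "ennreal (n x) * \<rho> (f x) \<le> h' x" if "x \<in> B \<inter> snd c ` fst c" for x
          using that img h'(2)[of x] by (auto simp: h_def)
        show "\<exists>d>0. \<forall>y\<in>snd c ` fst c. dist y x < d \<longrightarrow> dist (f y) (f x) \<le> (n x + e) * dist y x"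
          if "x \<in> B \<inter> snd c ` fst c" "0 < e" for x e
          using derivative_upper_estimate[OF der that(2), of x] that(1) n(2)[of x] by auto
      qed
      finally show ?thesis .
    qed
  qed
  also have "\<dots> = (\<integral>\<^sup>+ x. enn_powr (h x) p \<partial>lebesgue)"
    using h'(4) by (intro nn_integral_cong_AE) (auto elim: eventually_mono)
  \<comment> \<open>The Jacobian is split off as the weight for the change of variables; on
    \<open>B\<close> this leaves exactly \<open>K_O\<close> times the power of
    \<open>\<rho> (f x)\<close>.\<close>
  also have "\<dots> = (\<integral>\<^sup>+ x. ennreal \<bar>jacobian f x\<bar> * (K_O p f x * enn_powr (\<rho> (f x)) p) * indicator (B \<inter> E) x \<partial>lebesgue)"
  proof (intro nn_integral_cong)
    fix x
    show "enn_powr (h x) p = ennreal \<bar>jacobian f x\<bar> * (K_O p f x * enn_powr (\<rho> (f x)) p) * indicator (B \<inter> E) x"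
    proof (cases "x \<in> B \<inter> E")
      case True
      then have x: "x \<in> B" by simp
      have "ennreal \<bar>jacobian f x\<bar> * K_O p f x = ennreal (n x powr p)"
        using jac[OF x] n(2)[OF x] by (simp add: K_O_def flip: ennreal_mult)
      then show ?thesis
        using True n(3)[of x] by (simp add: h_def enn_powr_cmult mult.assoc[symmetric])
    next
      case False
      then show ?thesis
        using p by (auto simp: h_def enn_powr_def)
    qed
  qed
  also have "\<dots> = (\<integral>\<^sup>+ y. (\<Sum>k. K_O p f (inv_into (X k \<inter> E) f y) * enn_powr (\<rho> (f (inv_into (X k \<inter> E) f y))) p *
      indicator (f ` (X k \<inter> E)) y) \<partial>lebesgue)"
  proof (rule nn_integral_push_pieces[OF E(1), symmetric])
    have "jacobian f \<in> borel_measurable (lebesgue_on (B \<inter> E))"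
      by (rule measurable_restrict_mono[OF jac_measurable]) auto
    with nm have "(\<lambda>x. ennreal (n x powr p / \<bar>jacobian f x\<bar>)) \<in> borel_measurable (lebesgue_on (B \<inter> E))"
      by measurable
    then have "K_O p f \<in> borel_measurable (lebesgue_on (B \<inter> E))"
      by (rule measurable_cong[THEN iffD1, rotated]) (auto simp: K_O_def jac n(2))
    with \<rho>f show "(\<lambda>x. K_O p f x * enn_powr (\<rho> (f x)) p) \<in> borel_measurable (lebesgue_on (B \<inter> E))"
      by measurable
  qed
  \<comment> \<open>Only an inequality: points of \<open>E\<close> over \<open>y\<close> outside
    \<open>B\<close> appear in \<open>K_I_inv\<close> but in no piece.\<close>
  also have "\<dots> \<le> (\<integral>\<^sup>+ y. indicator (f ` E) y * K_I_inv p f E y * enn_powr (\<rho> y) p \<partial>lebesgue)"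
  proof (intro nn_integral_mono)
    fix y
    let ?g = "\<lambda>k. inv_into (X k \<inter> E) f y"
    let ?i = "\<lambda>k. indicator (f ` (X k \<inter> E)) y :: ennreal"
    have g: "?g k \<in> X k \<inter> E" "f (?g k) = y" if "y \<in> f ` (X k \<inter> E)" for k
      using inv_into_into[OF that] f_inv_into_f[OF that] by blast+
    have "(\<Sum>k. K_O p f (?g k) * ?i k) \<le> K_I_inv p f E y"
    proof (rule suminf_le_const)
      fix N :: nat
      let ?K = "{k \<in> {..<N}. y \<in> f ` (X k \<inter> E)}"
      \<comment> \<open>Different pieces are disjoint, so a finite partial sum is a sum of
        \<open>K_O\<close> over distinct preimages of \<open>y\<close> in \<open>E\<close> and lies
        below the unordered sum.\<close>
      have inj: "inj_on ?g ?K"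
      proof (rule inj_onI)
        fix i j assume ij: "i \<in> ?K" "j \<in> ?K" "?g i = ?g j"
        then have "?g i \<in> X i \<inter> X j"
          using g(1)[of i] g(1)[of j] by auto
        then show "i = j"
          using X(1) by (auto simp: disjoint_family_on_def)
      qed
      have "(\<Sum>k<N. K_O p f (?g k) * ?i k) = (\<Sum>k\<in>?K. K_O p f (?g k))"
        by (rule sum.mono_neutral_cong_right) (auto simp: indicator_def)
      also have "\<dots> = (\<Sum>x\<in>?g ` ?K. K_O p f x)"
        by (rule sum.reindex[OF inj, unfolded o_def, symmetric])
      also have "\<dots> \<le> K_I_inv p f E y"
      proof -
        have "?g ` ?K \<subseteq> E \<inter> f -` {y}"
          using g by auto
        then show ?thesis
          unfolding K_I_inv_def nonneg_infsum_complete[OF zero_le]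
          by (intro SUP_upper) auto
      qed
      finally show "(\<Sum>k<N. K_O p f (?g k) * ?i k) \<le> K_I_inv p f E y" .
    qed (rule summableI)
    moreover have "(\<Sum>k. K_O p f (?g k) * enn_powr (\<rho> (f (?g k))) p * ?i k) = (\<Sum>k. K_O p f (?g k) * ?i k) * enn_powr (\<rho> y) p"
    proof -
      have "K_O p f (?g k) * enn_powr (\<rho> (f (?g k))) p * ?i k = K_O p f (?g k) * ?i k * enn_powr (\<rho> y) p" for k
        using g(2)[of k] by (cases "y \<in> f ` (X k \<inter> E)") (simp_all add: mult.commute)
      then show ?thesis by simp
    qed
    moreover have "(\<Sum>k. K_O p f (?g k) * ?i k) = 0" if "y \<notin> f ` E"
    proof -
      have "?i k = 0" for k
        using that by (auto simp: indicator_def)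
      then show ?thesis by simp
    qed
    ultimately show "(\<Sum>k. K_O p f (?g k) * enn_powr (\<rho> (f (?g k))) p * ?i k) \<le>
        indicator (f ` E) y * K_I_inv p f E y * enn_powr (\<rho> y) p"
      by (cases "y \<in> f ` E") (simp_all add: mult_right_mono)
  qed
  finally show ?thesis .
qed

end

theorem theorem1p1:
  fixes f :: "real^'n \<Rightarrow> real^'n" and D :: "(real^'n) set" and p q :: real
  assumes "CARD('n) \<ge> 2"
    and "open D" and "connected D" and "D \<noteq> {}"
    and "continuous_on D f"
    and "orientation_preserving f D"
    and "p \<ge> 1" and "q \<ge> 1"
    and "finite_length_distortion p q f D"
  shows "(\<forall>\<Gamma> \<rho>. (\<forall>c\<in>\<Gamma>. curve_in D c) \<and> \<rho> \<in> adm \<Gamma> \<longrightarrow>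
            modulus q (curve_image f \<Gamma>) \<le> (\<integral>\<^sup>+ x. indicator D x * K_I q f x * enn_powr (\<rho> x) q \<partial>lebesgue))
       \<and> (\<forall>E \<Gamma> \<rho>s. E \<in> sets lebesgue \<and> E \<subseteq> D \<and> (\<forall>c\<in>\<Gamma>. curve_in E c) \<and> \<rho>s \<in> adm (curve_image f \<Gamma>) \<longrightarrow>
            modulus p \<Gamma> \<le> (\<integral>\<^sup>+ y. indicator (f ` E) y * K_I_inv p f E y * enn_powr (\<rho>s y) p \<partial>lebesgue))"
proof -
  obtain B X n \<mu> where "regular_part f D B X n \<mu>"
    using regular_part_exists[of D f] assms by (auto simp: finite_length_distortion_def)
  then interpret regular_part f D B X n \<mu> .
  have "prop_L1 p f D" "prop_L2 q f D" "0 < p" "0 < q"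
    using assms by (auto simp: finite_length_distortion_def)
  then show ?thesis
    by (intro conjI allI impI modulus_image_le modulus_le_image) auto
qed

end
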